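(* Let $R$ be a commutative unitary ring, let $n\ge 2$, and let $\gamma_1<\dots<\gamma_n$ be positive integers with $\gcd(\gamma_1,\dots,\gamma_n)=1$ and $\gamma_i\nmid\gamma_j$ for all $i<j$. Let $\Gamma$ be the numerical semigroup generated by $\gamma_1,\dots,\gamma_n$. Let $B$ be an $R$-subalgebra of $R[[t]]$ containing $R[t]$, and let $A$ be an $R$-subalgebra of $B\cap R[[t^{\gamma_1},\dots,t^{\gamma_n}]]$ containing $R[t^{\gamma_1},\dots,t^{\gamma_n}]$. Let $r\in\{2,\dots,n\}$ be such that $d_r=1$. If $A$ is $(\Gamma,B)$-closed and $R$ is a noetherian $\gamma_1$-nice ring, then (a) $A^*_{B,R}=A+R\cdot t^{\bigcup_{j=1}^{r-1}L_j}+A\cdot t^{\tilde L(r)}$; (b) $A^*_{B,R}=A+A\cdot t^{\bigcup_{j=1}^{r-1}\mathcal L_j}+A\cdot t^{\tilde L(r)}$; (c) $A^*_{B,R}=A[t^{\mathcal L(r)}]=A[t^{L(r)}]$.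
   Context: All rings are commutative and unitary. For ring morphisms $R\to A\xrightarrow{g}B$, let $\Delta:B\to B\otimes_R B$, $\Delta(b)=b\otimes_R 1-1\otimes_R b$, and let $\varphi:B\otimes_R B\to B\otimes_A B$ be the canonical $R$-algebra morphism $x\otimes_R y\mapsto x\otimes_A y$. The Lipschitz saturation of $A$ in $B$ relative to $R\to A\to B$ is $A^*_{B,R}:=\{x\in B\mid \Delta(x)\in\overline{\ker\varphi}\}$, where $\overline{I}$ denotes the integral closure of an ideal $I$ (here in the ring $B\otimes_R B$). Here $R\to A\to B$ are the structure map and the inclusion. $R[[t^{\gamma_1},\dots,t^{\gamma_n}]]\subseteq R[[t]]$ is the subring of formal power series in $t^{\gamma_1},\dots,t^{\gamma_n}$. Put $d_j:=\gcd(\gamma_1,\dots,\gamma_j)$ for $j\in\{1,\dots,n\}$ and $G(\Gamma):=\mathbb Z_{\ge0}\setminus\Gamma$, where $\Gamma\subseteq\mathbb Z_{\geq 0}$ contains $0$. Define: - $t^Y:=\{t^\ell\mid \ell\in Y\}$ for $Y\subseteq\mathbb Z_{\ge0}$; - $L_j:=\{\ell\in G(\Gamma)\mid \gamma_j<\ell<\gamma_{j+1},\ d_j\mid\ell\}$ for $j\in\{1,\dots,n-1\}$; - $\tilde L(m):=\{\ell\in G(\Gamma)\mid \gamma_m+1\le\ell\le\gamma_m+\gamma_1-1\}$ for $m\in\{2,\dots,n\}$; - $L(m):=\left(\bigcup_{j=1}^{m-1}L_j\right)\cup\tilde L(m)$ for $m\in\{2,\dots,n\}$; - $\mathcal L_j:=\{\ell\in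 L_j\mid \ell\le\gamma_j+\gamma_1-1\}$ for $j\in\{1,\dots,n-1\}$; - $\mathcal L(m):=\left(\bigcup_{j=1}^{m-1}\mathcal L_j\right)\cup\tilde L(m)$ for $m\in\{2,\dots,n\}$. For a subset $S\subseteq B$, $R\cdot S$ and $A\cdot S$ denote the $R$-submodule and $A$-submodule of $B$ generated by $S$, and $A[S]$ the $A$-subalgebra of $B$ generated by $S$. $A$ is called $(\Gamma,B)$-closed if for every $f=\sum_{i\ge0}a_it^i\in B$ ($a_i\in R$) one has $\sum_{i\in\Gamma}a_it^i\in A$. $R$ is called $\gamma_1$-nice if one of the following holds: (1) $R$ is a domain and $\operatorname{char}(R)\nmid\gamma_1$; (2) $R$ is reduced and $\operatorname{char}(R/\mathfrak p)\nmid\gamma_1$ for all $\mathfrak p\in\operatorname{Spec}R$. (The characteristic may be $0$, and $0$ divides no positive integer.) *)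

theory Defs
  imports
    "HOL-Algebra.Algebra"
    "HOL-Algebra.Algebraic_Closure_Type"
    "HOL-Computational_Algebra.Formal_Power_Series"
    "HOL-Library.Poly_Mapping"
    "HOL-Library.Set_Algebras"
begin

section \<open>Commutative algebra over ring records\<close>

text \<open>The monic equation is \<open>x\<^sup>n + a\<^sub>1 x\<^sup>n\<^sup>-\<^sup>1 + \<dots> + a\<^sub>n = 0\<close> with \<open>a\<^sub>i \<in> I\<^sup>i\<close>; powers of the ideal are
  taken in the multiplicative monoid \<^const>\<open>ideals_set\<close> of ideals.\<close>

definition integral_closure :: "('a, 'm) ring_scheme \<Rightarrow> 'a set \<Rightarrow> 'a set" where
  "integral_closure S I =
    {x \<in> carrier S. \<exists>n::nat. n > 0 \<and>
      (\<exists>a. (\<forall>i\<in>{1..n}. a i \<in> I [^]\<^bsub>ideals_set S\<^esub> i) \<and>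
           x [^]\<^bsub>S\<^esub> n \<oplus>\<^bsub>S\<^esub> (\<Oplus>\<^bsub>S\<^esub>i\<in>{1..n}. a i \<otimes>\<^bsub>S\<^esub> x [^]\<^bsub>S\<^esub> (n - i)) = \<zero>\<^bsub>S\<^esub>)}"

definition ring_char :: "('a, 'm) ring_scheme \<Rightarrow> nat" where
  "ring_char R = Gcd {n. [n] \<cdot>\<^bsub>R\<^esub> \<one>\<^bsub>R\<^esub> = \<zero>\<^bsub>R\<^esub>}"

lemma ring_char_ring_of_type_algebra: "ring_char (ring_of_type_algebra :: 'a::comm_ring_1 ring) = CHAR('a)"
proof -
  have "[n] \<cdot>\<^bsub>(ring_of_type_algebra::'a ring)\<^esub> \<one>\<^bsub>(ring_of_type_algebra::'a ring)\<^esub> = of_nat n" for n::nat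
    by (induction n) (auto simp: add_pow_def ring_of_type_algebra_def nat_pow_def add.commute)
  then show ?thesis by (simp add: ring_char_def semiring_char_def ring_of_type_algebra_def)
qed

definition reduced_ring :: "('a, 'm) ring_scheme \<Rightarrow> bool" where
  "reduced_ring R \<longleftrightarrow> (\<forall>x\<in>carrier R. \<forall>n::nat. x [^]\<^bsub>R\<^esub> n = \<zero>\<^bsub>R\<^esub> \<longrightarrow> x = \<zero>\<^bsub>R\<^esub>)"

text \<open>As \<open>g > 0\<close> in all uses, characteristic \<open>0\<close> never divides \<open>g\<close>.\<close>

definition nice_ring :: "nat \<Rightarrow> ('a, 'm) ring_scheme \<Rightarrow> bool" where
  "nice_ring g R \<longleftrightarrow>
     (domain R \<and> \<not> ring_char R dvd g) \<or>
     (reduced_ring R \<and> (\<forall>P. primeideal P R \<longrightarrow> \<not> ring_char (R Quot P) dvd g))"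

section \<open>Tensor products of algebras\<close>

text \<open>For algebras \<open>f : R \<rightarrow> B\<close> and \<open>g : R \<rightarrow> C\<close>, the ring \<open>B \<otimes>\<^sub>R C\<close> is the quotient of the integral
  monoid ring of the multiplicative monoid \<open>B \<times> C\<close> by the biadditivity and \<open>R\<close>-balancing relations.
  Its additive group is the usual quotient of the free abelian group on \<open>B \<times> C\<close>: the subgroup
  generated by these relations is already an ideal.\<close>

definition integral_monoid_ring :: "('g, 'm) monoid_scheme \<Rightarrow> ('g \<Rightarrow>\<^sub>0 int) ring" where
  "integral_monoid_ring G =
    \<lparr>carrier = {p. Poly_Mapping.keys p \<subseteq> carrier G},
     monoid.mult = (\<lambda>p q. frag_extend (\<lambda>x. frag_extend (\<lambda>y. frag_of (x \<otimes>\<^bsub>G\<^esub> y)) q) p),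
     one = frag_of \<one>\<^bsub>G\<^esub>,
     ring.zero = 0,
     ring.add = (+)\<rparr>"

lemma frag_extend_zero_fun[simp]: "frag_extend (\<lambda>x. 0) p = 0"
  by (simp add: frag_extend_def)

lemma frag_extend_minus_fun: "frag_extend (\<lambda>x. f x - g x) p = frag_extend f p - frag_extend g p"
proof -
  have "frag_cmul (Poly_Mapping.lookup p i) (f i - g i) =
      frag_cmul (Poly_Mapping.lookup p i) (f i) - frag_cmul (Poly_Mapping.lookup p i) (g i)" for i
    by (rule poly_mapping_eqI) (simp add: lookup_minus right_diff_distrib)
  then show ?thesis by (simp add: frag_extend_def sum_subtractf)
qed

lemma integral_monoid_ring_cring:
  assumes "comm_monoid G" shows "cring (integral_monoid_ring G)"
proof -
  interpret G: comm_monoid G by fact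
  let ?m = "\<lambda>p q. frag_extend (\<lambda>x. frag_extend (\<lambda>y. frag_of (x \<otimes>\<^bsub>G\<^esub> y)) q) p"
  have cl: "Poly_Mapping.keys (?m p q) \<subseteq> carrier G" if "Poly_Mapping.keys p \<subseteq> carrier G" "Poly_Mapping.keys q \<subseteq> carrier G" for p q
    using keys_frag_extend[of "\<lambda>x. frag_extend (\<lambda>y. frag_of (x \<otimes>\<^bsub>G\<^esub> y)) q" p] keys_frag_extend[of "\<lambda>y. frag_of (_ \<otimes>\<^bsub>G\<^esub> y)" q] that
    by fastforce
  have addl: "?m (p + p') q = ?m p q + ?m p' q" for p p' q by (simp add: frag_extend_add)
  have comm: "?m p q = ?m q p" if p: "Poly_Mapping.keys p \<subseteq> carrier G" and q: "Poly_Mapping.keys q \<subseteq> carrier G" for p q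
    using p
  proof (induction p rule: frag_induction)
    case (one x)
    from q show ?case
      by (induction q rule: frag_induction) (use one in \<open>simp_all add: frag_extend_diff frag_extend_minus_fun G.m_comm\<close>)
  qed (simp_all add: frag_extend_diff frag_extend_minus_fun)
  have assoc: "?m (?m p q) r = ?m p (?m q r)" if p: "Poly_Mapping.keys p \<subseteq> carrier G" and q: "Poly_Mapping.keys q \<subseteq> carrier G"
     and r: "Poly_Mapping.keys r \<subseteq> carrier G"  for p q r
    using p
  proof (induction p rule: frag_induction)
    case (one x)
    from q show ?case
    proof (induction q rule: frag_induction)
      case (one y)
      from r show ?case
        by (induction r rule: frag_induction) (use one \<open>x \<in> _\<close> in \<open>simp_all add: frag_extend_diff frag_extend_minus_fun G.m_assoc\<close>)
    qed (simp_all add: frag_extend_diff frag_extend_minus_fun)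
  qed (simp_all add: frag_extend_diff frag_extend_minus_fun)
  have one: "?m (frag_of \<one>\<^bsub>G\<^esub>) q = q" if "Poly_Mapping.keys q \<subseteq> carrier G" for q
    using that by (induction q rule: frag_induction) (simp_all add: frag_extend_diff)
  show ?thesis
    apply (intro cringI abelian_groupI comm_monoidI)
    using cl comm assoc one addl
    apply (simp_all add: integral_monoid_ring_def add.assoc add.commute cl keys_frag_of)
     apply (meson dual_order.trans keys_add le_sup_iff)
    subgoal for p by (rule exI[of _ "-p"]) simp
    done
qed

definition tensor_relations ::
  "('r, 'k) ring_scheme \<Rightarrow> ('r \<Rightarrow> 'b) \<Rightarrow> ('b, 'm) ring_scheme \<Rightarrow> ('r \<Rightarrow> 'c) \<Rightarrow> ('c, 'n) ring_scheme
    \<Rightarrow> (('b \<times> 'c) \<Rightarrow>\<^sub>0 int) set" where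
  "tensor_relations R f B g C =
     {frag_of (b \<oplus>\<^bsub>B\<^esub> b', c) - frag_of (b, c) - frag_of (b', c) | b b' c.
        b \<in> carrier B \<and> b' \<in> carrier B \<and> c \<in> carrier C} \<union>
     {frag_of (b, c \<oplus>\<^bsub>C\<^esub> c') - frag_of (b, c) - frag_of (b, c') | b c c'.
        b \<in> carrier B \<and> c \<in> carrier C \<and> c' \<in> carrier C} \<union>
     {frag_of (f r \<otimes>\<^bsub>B\<^esub> b, c) - frag_of (b, g r \<otimes>\<^bsub>C\<^esub> c) | r b c.
        r \<in> carrier R \<and> b \<in> carrier B \<and> c \<in> carrier C}"

definition tensor_ideal ::
  "('r, 'k) ring_scheme \<Rightarrow> ('r \<Rightarrow> 'b) \<Rightarrow> ('b, 'm) ring_scheme \<Rightarrow> ('r \<Rightarrow> 'c) \<Rightarrow> ('c, 'n) ring_scheme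
    \<Rightarrow> (('b \<times> 'c) \<Rightarrow>\<^sub>0 int) set" where
  "tensor_ideal R f B g C =
     Idl\<^bsub>integral_monoid_ring (B \<times>\<times> C)\<^esub> (tensor_relations R f B g C)"

definition tensor_ring ::
  "('r, 'k) ring_scheme \<Rightarrow> ('r \<Rightarrow> 'b) \<Rightarrow> ('b, 'm) ring_scheme \<Rightarrow> ('r \<Rightarrow> 'c) \<Rightarrow> ('c, 'n) ring_scheme
    \<Rightarrow> (('b \<times> 'c) \<Rightarrow>\<^sub>0 int) set ring" where
  "tensor_ring R f B g C = integral_monoid_ring (B \<times>\<times> C) Quot tensor_ideal R f B g C"

definition pure_tensor ::
  "('r, 'k) ring_scheme \<Rightarrow> ('r \<Rightarrow> 'b) \<Rightarrow> ('b, 'm) ring_scheme \<Rightarrow> ('r \<Rightarrow> 'c) \<Rightarrow> ('c, 'n) ring_scheme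
    \<Rightarrow> 'b \<Rightarrow> 'c \<Rightarrow> (('b \<times> 'c) \<Rightarrow>\<^sub>0 int) set" where
  "pure_tensor R f B g C b c =
     tensor_ideal R f B g C +>\<^bsub>integral_monoid_ring (B \<times>\<times> C)\<^esub> frag_of (b, c)"

lemma tensor_relations_subset:
  assumes "cring B" "cring C" "f \<in> carrier R \<rightarrow> carrier B" "g \<in> carrier R \<rightarrow> carrier C"
  shows "tensor_relations R f B g C \<subseteq> carrier (integral_monoid_ring (B \<times>\<times> C))"
proof -
  interpret B: cring B by fact interpret C: cring C by fact
  show ?thesis using assms(3,4)
    unfolding tensor_relations_def integral_monoid_ring_def
    by (auto simp: Pi_iff in_keys_iff lookup_minus split: if_splits)
qed

lemma cring_tensor:
  assumes "cring B" "cring C" "f \<in> carrier R \<rightarrow> carrier B" "g \<in> carrier R \<rightarrow> carrier C"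
  shows "cring (tensor_ring R f B g C)" "ideal (tensor_ideal R f B g C) (integral_monoid_ring (B \<times>\<times> C))"
proof -
  interpret B: cring B by fact interpret C: cring C by fact
  have "comm_monoid (B \<times>\<times> C)"
    by (rule comm_monoidI) (auto simp: B.m_ac C.m_ac)
  then interpret M: cring "integral_monoid_ring (B \<times>\<times> C)" by (rule integral_monoid_ring_cring)
  show i: "ideal (tensor_ideal R f B g C) (integral_monoid_ring (B \<times>\<times> C))"
    unfolding tensor_ideal_def by (rule M.genideal_ideal) (rule tensor_relations_subset[OF assms])
  show "cring (tensor_ring R f B g C)"
    unfolding tensor_ring_def by (rule ideal.quotient_is_cring[OF i]) (rule M.is_cring)
qed

section \<open>Lipschitz saturation\<close>

text \<open>Throughout, \<open>f : R \<rightarrow> A\<close> and \<open>g : A \<rightarrow> B\<close>.\<close>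

definition lipschitz_diff ::
  "('r, 'k) ring_scheme \<Rightarrow> ('r \<Rightarrow> 'a) \<Rightarrow> ('a \<Rightarrow> 'b) \<Rightarrow> ('b, 'm) ring_scheme
    \<Rightarrow> 'b \<Rightarrow> (('b \<times> 'b) \<Rightarrow>\<^sub>0 int) set" where
  "lipschitz_diff R f g B b =
     pure_tensor R (g \<circ> f) B (g \<circ> f) B b \<one>\<^bsub>B\<^esub>
       \<ominus>\<^bsub>tensor_ring R (g \<circ> f) B (g \<circ> f) B\<^esub> pure_tensor R (g \<circ> f) B (g \<circ> f) B \<one>\<^bsub>B\<^esub> b"

text \<open>The map \<open>B \<otimes>\<^sub>R B \<rightarrow> B \<otimes>\<^sub>A B\<close>, \<open>x \<otimes> y \<mapsto> x \<otimes> y\<close>: the relations over \<open>R\<close> hold over \<open>A\<close>, so a coset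
  modulo the first tensor ideal lies in a single coset modulo the second.\<close>

definition tensor_base_change ::
  "('a, 'k) ring_scheme \<Rightarrow> ('a \<Rightarrow> 'b) \<Rightarrow> ('b, 'm) ring_scheme
    \<Rightarrow> (('b \<times> 'b) \<Rightarrow>\<^sub>0 int) set \<Rightarrow> (('b \<times> 'b) \<Rightarrow>\<^sub>0 int) set" where
  "tensor_base_change A g B T =
     (\<Union>p\<in>T. tensor_ideal A g B g B +>\<^bsub>integral_monoid_ring (B \<times>\<times> B)\<^esub> p)"

lemma tensor_base_change_hom:
  assumes "cring A" "cring B" "f \<in> carrier R \<rightarrow> carrier A" "g \<in> carrier A \<rightarrow> carrier B"
  shows "p \<in> carrier (integral_monoid_ring (B \<times>\<times> B)) \<Longrightarrow>
    tensor_base_change A g B (tensor_ideal R (g \<circ> f) B (g \<circ> f) B +>\<^bsub>integral_monoid_ring (B \<times>\<times> B)\<^esub> p)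
     = tensor_ideal A g B g B +>\<^bsub>integral_monoid_ring (B \<times>\<times> B)\<^esub> p"
    and "tensor_base_change A g B \<in> ring_hom (tensor_ring R (g \<circ> f) B (g \<circ> f) B) (tensor_ring A g B g B)"
proof -
  let ?M = "integral_monoid_ring (B \<times>\<times> B)"
  interpret B: cring B by fact
  have "comm_monoid (B \<times>\<times> B)"
    by (rule comm_monoidI) (auto simp: B.m_ac)
  then interpret M: cring ?M by (rule integral_monoid_ring_cring)
  have gf: "(g \<circ> f) \<in> carrier R \<rightarrow> carrier B" using assms by auto
  let ?I = "tensor_ideal R (g \<circ> f) B (g \<circ> f) B" and ?J = "tensor_ideal A g B g B"
  interpret I: ideal ?I ?M using cring_tensor(2)[OF assms(2,2) gf gf] .
  interpret J: ideal ?J ?M using cring_tensor(2)[OF assms(2,2,4,4)] .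
  have "tensor_relations R (g \<circ> f) B (g \<circ> f) B \<subseteq> tensor_relations A g B g B"
  proof -
    have "\<exists>a b' c'. frag_of (g (f r) \<otimes>\<^bsub>B\<^esub> b, c) - frag_of (b, g (f r) \<otimes>\<^bsub>B\<^esub> c) =
          frag_of (g a \<otimes>\<^bsub>B\<^esub> b', c') - frag_of (b', g a \<otimes>\<^bsub>B\<^esub> c') \<and>
          a \<in> carrier A \<and> b' \<in> carrier B \<and> c' \<in> carrier B"
      if "r \<in> carrier R" "b \<in> carrier B" "c \<in> carrier B" for r b c
      using that assms(3) by blast
    then show ?thesis
      unfolding tensor_relations_def by (intro Un_mono order_refl) auto
  qed
  also have "\<dots> \<subseteq> ?J"
    unfolding tensor_ideal_def by (rule M.genideal_self) (rule tensor_relations_subset[OF assms(2,2,4,4)])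
  finally have IJ: "?I \<subseteq> ?J"
    unfolding tensor_ideal_def[of R] by (rule M.genideal_minimal[OF J.is_ideal])
  show *: "tensor_base_change A g B (?I +>\<^bsub>?M\<^esub> p) = ?J +>\<^bsub>?M\<^esub> p" if p: "p \<in> carrier ?M" for p
  proof -
    have "?J +>\<^bsub>?M\<^esub> q = ?J +>\<^bsub>?M\<^esub> p" if "q \<in> ?I +>\<^bsub>?M\<^esub> p" for q
    proof -
      have "q \<in> ?J +>\<^bsub>?M\<^esub> p" using that IJ by (auto simp: a_r_coset_def r_coset_def)
      then show ?thesis using M.a_repr_independence[OF _ p J.a_subgroup] by simp
    qed
    moreover have "p \<in> ?I +>\<^bsub>?M\<^esub> p" using p by (rule I.a_rcos_self)
    ultimately show ?thesis unfolding tensor_base_change_def by blast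
  qed
  show "tensor_base_change A g B \<in> ring_hom (tensor_ring R (g \<circ> f) B (g \<circ> f) B) (tensor_ring A g B g B)"
    unfolding tensor_ring_def
  proof (rule ring_hom_memI)
    have carr: "T \<in> carrier (?M Quot K) \<longleftrightarrow> (\<exists>p\<in>carrier ?M. T = K +>\<^bsub>?M\<^esub> p)" for T K
      by (auto simp: FactRing_def A_RCOSETS_def')
    fix S assume "S \<in> carrier (?M Quot ?I)"
    then obtain p where p: "p \<in> carrier ?M" "S = ?I +>\<^bsub>?M\<^esub> p" by (auto simp: carr)
    show "tensor_base_change A g B S \<in> carrier (?M Quot ?J)" using p by (auto simp: carr *)
    fix T assume "T \<in> carrier (?M Quot ?I)"
    then obtain q where q: "q \<in> carrier ?M" "T = ?I +>\<^bsub>?M\<^esub> q" by (auto simp: carr)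
    show "tensor_base_change A g B (S \<otimes>\<^bsub>?M Quot ?I\<^esub> T) =
        tensor_base_change A g B S \<otimes>\<^bsub>?M Quot ?J\<^esub> tensor_base_change A g B T"
      using p q by (simp add: FactRing_def * I.rcoset_mult_add J.rcoset_mult_add)
    show "tensor_base_change A g B (S \<oplus>\<^bsub>?M Quot ?I\<^esub> T) =
        tensor_base_change A g B S \<oplus>\<^bsub>?M Quot ?J\<^esub> tensor_base_change A g B T"
      using p q by (simp add: FactRing_def * I.a_rcos_sum J.a_rcos_sum)
  qed (simp add: FactRing_def *)
qed

corollary tensor_base_change_pure_tensor:
  assumes "cring A" "cring B" "f \<in> carrier R \<rightarrow> carrier A" "g \<in> carrier A \<rightarrow> carrier B"
    and "b \<in> carrier B" "c \<in> carrier B"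
  shows "tensor_base_change A g B (pure_tensor R (g \<circ> f) B (g \<circ> f) B b c) = pure_tensor A g B g B b c"
proof -
  have "frag_of (b, c) \<in> carrier (integral_monoid_ring (B \<times>\<times> B))"
    using assms(5,6) by (simp add: integral_monoid_ring_def keys_frag_of)
  then show ?thesis
    unfolding pure_tensor_def by (rule tensor_base_change_hom(1)[OF assms(1-4)])
qed

definition lipschitz_saturation ::
  "('r, 'k) ring_scheme \<Rightarrow> ('r \<Rightarrow> 'a) \<Rightarrow> ('a, 'l) ring_scheme \<Rightarrow> ('a \<Rightarrow> 'b) \<Rightarrow> ('b, 'm) ring_scheme
    \<Rightarrow> 'b set" where
  "lipschitz_saturation R f A g B =
     {x \<in> carrier B. lipschitz_diff R f g B x \<in>
        integral_closure (tensor_ring R (g \<circ> f) B (g \<circ> f) B)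
          (a_kernel (tensor_ring R (g \<circ> f) B (g \<circ> f) B) (tensor_ring A g B g B)
             (tensor_base_change A g B))}"

section \<open>Subalgebras of the power series ring\<close>

text \<open>The base ring \<open>R\<close> is the type \<^typ>\<open>'a::comm_ring_1\<close>, embedded in \<open>R[[t]]\<close> as the constants;
  subalgebras of \<open>R[[t]]\<close> are sets of power series.\<close>

abbreviation fps_ring :: "'a::comm_ring_1 fps ring" where
  "fps_ring \<equiv> ring_of_type_algebra"

abbreviation constants :: "'a::comm_ring_1 fps set" where
  "constants \<equiv> range fps_const"

definition fps_subalgebra :: "'a::comm_ring_1 fps set \<Rightarrow> bool" where
  "fps_subalgebra S \<longleftrightarrow> subring S fps_ring \<and> constants \<subseteq> S"

definition adjoin :: "'a::comm_ring_1 fps set \<Rightarrow> 'a fps set \<Rightarrow> 'a fps set" where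
  "adjoin A S = generate_ring fps_ring (A \<union> S)"

text \<open>The library's \<^const>\<open>subalgebra\<close> only asks for an additive subgroup stable under multiplication by
  its first argument, i.e. for an \<open>A\<close>-submodule.\<close>

definition submodule_span :: "'a::comm_ring_1 fps set \<Rightarrow> 'a fps set \<Rightarrow> 'a fps set" where
  "submodule_span A S = (\<lambda>M. subalgebra A M fps_ring) hull S"

definition t_powers :: "nat set \<Rightarrow> 'a::comm_ring_1 fps set" where
  "t_powers Y = (\<lambda>l. fps_X ^ l) ` Y"

text \<open>\<open>R[[t\<^bsup>\<gamma> 1\<^esup>, \<dots>, t\<^bsup>\<gamma> n\<^esup>]]\<close>: the series \<open>\<Sum>\<^sub>\<alpha> c\<^sub>\<alpha> t\<^bsup>\<alpha> 1 \<gamma> 1 + \<dots> + \<alpha> n \<gamma> n\<^esup>\<close> over all multi-indices \<open>\<alpha>\<close>. For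
  positive \<open>\<gamma> i\<close> only finitely many \<open>\<alpha>\<close> contribute to a given coefficient.\<close>

definition monomial_power_series :: "nat \<Rightarrow> (nat \<Rightarrow> nat) \<Rightarrow> 'a::comm_ring_1 fps set" where
  "monomial_power_series n \<gamma> =
     {Abs_fps (\<lambda>k. \<Sum>\<alpha> | \<alpha> \<in> {1..n} \<rightarrow>\<^sub>E UNIV \<and> (\<Sum>i=1..n. \<alpha> i * \<gamma> i) = k. c \<alpha>) | c. True}"

definition gamma_closed :: "nat set \<Rightarrow> 'a::comm_ring_1 fps set \<Rightarrow> 'a fps set \<Rightarrow> bool" where
  "gamma_closed \<Gamma> B A \<longleftrightarrow>
     (\<forall>f\<in>B. Abs_fps (\<lambda>i. if i \<in> \<Gamma> then fps_nth f i else 0) \<in> A)"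

section \<open>Numerical semigroups and their gaps\<close>

definition semigroup_gen :: "nat \<Rightarrow> (nat \<Rightarrow> nat) \<Rightarrow> nat set" where
  "semigroup_gen n \<gamma> = {\<Sum>i=1..n. c i * \<gamma> i | c :: nat \<Rightarrow> nat. True}"

definition gaps :: "nat set \<Rightarrow> nat set" where
  "gaps \<Gamma> = - \<Gamma>"

definition partial_gcd :: "(nat \<Rightarrow> nat) \<Rightarrow> nat \<Rightarrow> nat" where
  "partial_gcd \<gamma> j = Gcd (\<gamma> ` {1..j})"

definition gap_L :: "nat set \<Rightarrow> (nat \<Rightarrow> nat) \<Rightarrow> nat \<Rightarrow> nat set" where
  "gap_L \<Gamma> \<gamma> j = {l \<in> gaps \<Gamma>. \<gamma> j < l \<and> l < \<gamma> (j + 1) \<and> partial_gcd \<gamma> j dvd l}"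

definition gap_Ltilde :: "nat set \<Rightarrow> (nat \<Rightarrow> nat) \<Rightarrow> nat \<Rightarrow> nat set" where
  "gap_Ltilde \<Gamma> \<gamma> m = {l \<in> gaps \<Gamma>. \<gamma> m + 1 \<le> l \<and> l \<le> \<gamma> m + \<gamma> 1 - 1}"

definition gap_L_upto :: "nat set \<Rightarrow> (nat \<Rightarrow> nat) \<Rightarrow> nat \<Rightarrow> nat set" where
  "gap_L_upto \<Gamma> \<gamma> m = (\<Union>j\<in>{1..m - 1}. gap_L \<Gamma> \<gamma> j) \<union> gap_Ltilde \<Gamma> \<gamma> m"

definition gap_cL :: "nat set \<Rightarrow> (nat \<Rightarrow> nat) \<Rightarrow> nat \<Rightarrow> nat set" where
  "gap_cL \<Gamma> \<gamma> j = {l \<in> gap_L \<Gamma> \<gamma> j. l \<le> \<gamma> j + \<gamma> 1 - 1}"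

definition gap_cL_upto :: "nat set \<Rightarrow> (nat \<Rightarrow> nat) \<Rightarrow> nat \<Rightarrow> nat set" where
  "gap_cL_upto \<Gamma> \<gamma> m = (\<Union>j\<in>{1..m - 1}. gap_cL \<Gamma> \<gamma> j) \<union> gap_Ltilde \<Gamma> \<gamma> m"

end

theory Submission
  imports Defs
begin

text \<open>Let \<open>E\<close> consist of \<open>0\<close> and of all \<open>\<ell>\<close> for which some \<open>j\<close> has \<open>\<gamma> j \<le> \<ell>\<close> and \<open>d\<^sub>j dvd \<ell>\<close>, where
  \<open>d\<^sub>j = gcd (\<gamma> 1, \<dots>, \<gamma> j)\<close>. The set \<open>E\<close> is a semigroup containing \<open>\<Gamma>\<close>, and the heart of the matter is that
  the saturation consists of the series in \<open>B\<close> with support in \<open>E\<close>. The presentations then only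
  describe the finite set of exponents \<open>E - \<Gamma>\<close>: those between \<open>\<gamma> j\<close> and \<open>\<gamma> (j + 1)\<close> form
  \<open>L\<^sub>j\<close>, and subtracting multiples of \<open>\<gamma> 1\<close> moves them into the window of length \<open>\<gamma> 1\<close> above
  \<open>\<gamma> j\<close>; above \<open>\<gamma> r\<close>, where \<open>d\<^sub>r = 1\<close>, all gaps belong to \<open>E\<close> and one such window
  suffices. The part of the series supported in \<open>\<Gamma>\<close> belongs to \<open>A\<close> because \<open>A\<close> is closed.

  Exponents in \<open>E\<close> are reached. Put \<open>x = t \<otimes> 1\<close>, \<open>y = 1 \<otimes> t\<close> and let \<open>K\<close> be the kernel of
  \<open>B \<otimes>\<^sub>R B \<rightarrow> B \<otimes>\<^sub>A B\<close>. Then \<open>x\<^sup>s - y\<^sup>s \<in> K\<close> for each generator \<open>s = \<gamma> i\<close>, \<open>i \<le> j\<close>. The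
  set of all \<open>s\<close> such that \<open>x\<^sup>a y\<^sup>b (x\<^sup>s - y\<^sup>s)\<close> is, for large \<open>a + b\<close>, a form in \<open>x, y\<close> of degree
  \<open>a + b + s - \<gamma> j\<close> with coefficients in \<open>K\<close> is closed under sums and differences, so by the Euclidean
  algorithm it contains all multiples of \<open>d\<^sub>j\<close>. If such a multiple \<open>\<ell>\<close> is at least \<open>\<gamma> j\<close>,
  then \<open>x\<^sup>\<ell> - y\<^sup>\<ell>\<close> maps the forms of a large degree \<open>q\<close> into the forms of degree \<open>q\<close> with
  coefficients in \<open>K\<close>. The determinant trick turns this into an equation of integral dependence on \<open>K\<close>.
  The property is additive, so finite sums of such elements and elements of \<open>K\<close> need no
  separate argument (\<open>power_diff_bform\<close>, \<open>integral_closure_if_controlled\<close>).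

  No other exponents occur. For \<open>\<ell> \<ge> \<gamma> 1\<close> outside \<open>E\<close> let \<open>j\<close> be maximal with \<open>\<gamma> j \<le> \<ell>\<close>, and let
  \<open>\<zeta>\<close> be a root of unity of order \<open>d\<^sub>j\<close>. The map \<open>f \<otimes> g \<mapsto> f(s) g(\<zeta> s)\<close> sends \<open>K\<close> into the series of order
  at least \<open>\<gamma> (j + 1)\<close>, since smaller elements of \<open>\<Gamma>\<close> are multiples of \<open>d\<^sub>j\<close>; an element integral
  over \<open>K\<close> then has an image of at least that order, which forces \<open>a\<^sub>\<ell> (1 - \<zeta>\<^sup>\<ell>) = 0\<close> for the
  coefficient \<open>a\<^sub>\<ell>\<close>, where \<open>\<zeta>\<^sup>\<ell> \<noteq> 1\<close>. To avoid extensions of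
  \<open>R\<close>, the root is replaced by the indeterminate \<open>Z\<close> of a polynomial ring and equations are read modulo
  \<open>Z^d\<^sub>j - 1\<close>, or modulo \<open>Z\<close> if \<open>0 < \<ell> < \<gamma> 1\<close>. The quotient ring may fail to be a domain, but it
  suffices that \<open>a (1 - Z\<^sup>\<ell>)\<^sup>N \<equiv> 0\<close> implies \<open>a = 0\<close> for \<open>a \<in> R\<close>, which holds as \<open>\<gamma> 1\<close> is not a zero divisor
  in \<open>R\<close> (\<open>const_eq_0_if_root_of_unity_dvd\<close>, \<open>integral_twist_difference\<close>). Reducedness of \<open>R\<close> removes
  the powers of coefficients.\<close>

section \<open>Integral dependence by elimination\<close>

text \<open>The elements \<open>c z\<^sup>k + \<Sum> a\<^sub>i z\<^sup>k\<^sup>-\<^sup>i\<close> with \<open>a\<^sub>i \<in> I\<^sup>i\<close>, built by Horner's scheme. The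
  case \<open>c = 1\<close> collects the left-hand sides of equations of integral dependence of degree \<open>k\<close>, and
  \<open>c = 0\<close> the elements of \<open>I (I + (z))\<^sup>k\<^sup>-\<^sup>1\<close> for positive \<open>k\<close>.\<close>

inductive integral_form ::
  "('a, 'm) ring_scheme \<Rightarrow> 'a set \<Rightarrow> 'a \<Rightarrow> 'a \<Rightarrow> nat \<Rightarrow> 'a \<Rightarrow> bool" for R I z c where
  base: "integral_form R I z c 0 c"
| step: "integral_form R I z c k h \<Longrightarrow> a \<in> I [^]\<^bsub>ideals_set R\<^esub> Suc k \<Longrightarrow>
    integral_form R I z c (Suc k) (z \<otimes>\<^bsub>R\<^esub> h \<oplus>\<^bsub>R\<^esub> a)"

locale integral_element = cring R + I: ideal I R for R (structure) and I and z +
  assumes z_closed: "z \<in> carrier R"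
begin

abbreviation ipow :: "nat \<Rightarrow> 'a set" where "ipow k \<equiv> I [^]\<^bsub>ideals_set R\<^esub> k"

abbreviation form :: "'a \<Rightarrow> nat \<Rightarrow> 'a \<Rightarrow> bool" where "form \<equiv> integral_form R I z"

lemma ipow_ideal: "ideal (ipow k) R"
  using monoid.nat_pow_closed[OF comm_monoid.axioms(1)[OF ideals_set_is_comm_monoid], of I k] I.is_ideal
  by (simp add: ideals_set_def)

lemma ipow_1: "ipow 1 = I"
  using monoid.nat_pow_eone[OF comm_monoid.axioms(1)[OF ideals_set_is_comm_monoid], of I] I.is_ideal
  by (simp add: ideals_set_def)

lemma ipow_mult: "a \<in> ipow i \<Longrightarrow> b \<in> ipow j \<Longrightarrow> a \<otimes> b \<in> ipow (i + j)"
  using monoid.nat_pow_mult[OF comm_monoid.axioms(1)[OF ideals_set_is_comm_monoid], of I i j]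
    I.is_ideal ideal_prod.prod[of a "ipow i" b "ipow j" R]
  by (simp add: ideals_set_def)

lemma ipow_carr: "a \<in> ipow i \<Longrightarrow> a \<in> carrier R"
  using ipow_ideal ideal.Icarr by metis

lemma ipow_add: "a \<in> ipow i \<Longrightarrow> b \<in> ipow i \<Longrightarrow> a \<oplus> b \<in> ipow i"
  using ipow_ideal[of i] by (simp add: additive_subgroup.a_closed ideal.axioms(1))

lemma ipow_neg: "a \<in> ipow i \<Longrightarrow> \<ominus> a \<in> ipow i"
  using ipow_ideal[of i] by (simp add: additive_subgroup.a_inv_closed ideal.axioms(1))

lemma ipow_zero: "\<zero> \<in> ipow i"
  using ipow_ideal[of i] by (simp add: additive_subgroup.zero_closed ideal.axioms(1))

lemma form_carr: "form c k h \<Longrightarrow> c \<in> carrier R \<Longrightarrow> h \<in> carrier R"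
  by (induction rule: integral_form.induct) (use ipow_carr z_closed in \<open>auto simp del: Group.nat_pow_Suc\<close>)

lemma form_add:
  assumes "form c k h" "form c' k h'" "c \<in> carrier R" "c' \<in> carrier R"
  shows "form (c \<oplus> c') k (h \<oplus> h')"
  using assms
proof (induction arbitrary: h' rule: integral_form.induct)
  case base
  then show ?case by (auto elim: integral_form.cases intro: integral_form.base)
next
  case (step k h a)
  from step.prems(1) obtain g b where g: "form c' k g" "b \<in> ipow (Suc k)" "h' = z \<otimes> g \<oplus> b"
    by (auto elim: integral_form.cases)
  have carr: "h \<in> carrier R" "g \<in> carrier R" "a \<in> carrier R" "b \<in> carrier R"
    using form_carr[OF step.hyps(1)] form_carr[OF g(1)] step ipow_carr[OF g(2)] ipow_carr[OF step.hyps(2)] by auto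
  have "z \<otimes> h \<oplus> a \<oplus> h' = z \<otimes> (h \<oplus> g) \<oplus> (a \<oplus> b)"
    unfolding g(3) using carr z_closed by algebra
  then show ?case
    using integral_form.step[OF step.IH[OF g(1) step.prems(2,3)] ipow_add[OF step.hyps(2) g(2)]] by simp
qed

lemma form_neg:
  assumes "form c k h" "c \<in> carrier R" shows "form (\<ominus> c) k (\<ominus> h)"
  using assms
proof (induction rule: integral_form.induct)
  case (step k h a)
  have "h \<in> carrier R" "a \<in> carrier R" using step form_carr ipow_carr by blast+
  then have "\<ominus> (z \<otimes> h \<oplus> a) = z \<otimes> (\<ominus> h) \<oplus> \<ominus> a" using z_closed by algebra
  then show ?case using integral_form.step[OF step.IH ipow_neg] step by simp
qed (auto intro: integral_form.base)

lemma form_zero_coeff: "a \<in> ipow (Suc i) \<Longrightarrow> form \<zero> (Suc i) a"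
proof -
  assume a: "a \<in> ipow (Suc i)"
  have "form \<zero> i \<zero>" for i
    by (induction i) (use integral_form.base integral_form.step[OF _ ipow_zero] z_closed in fastforce)+
  from integral_form.step[OF this a] show ?thesis using z_closed ipow_carr[OF a] by simp
qed

lemma form_scale:
  assumes "form c k h" "c \<in> carrier R" "a \<in> ipow (Suc i)" shows "form \<zero> (Suc i + k) (a \<otimes> h)"
  using assms
proof (induction rule: integral_form.induct)
  case base
  have "a \<otimes> c \<in> ipow (Suc i)" using base ipow_ideal[of "Suc i"] by (simp add: ideal.I_r_closed)
  then show ?case using form_zero_coeff by simp
next
  case (step k h b)
  have carr: "h \<in> carrier R" "a \<in> carrier R" "b \<in> carrier R" using step form_carr ipow_carr by blast+
  have "a \<otimes> (z \<otimes> h \<oplus> b) = z \<otimes> (a \<otimes> h) \<oplus> a \<otimes> b" using z_closed carr by algebra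
  moreover have "a \<otimes> b \<in> ipow (Suc (Suc i + k))" using ipow_mult[OF step.prems(2) step.hyps(2)] by simp
  ultimately show ?case using integral_form.step[OF step.IH] step by simp
qed

text \<open>The forms thus behave like homogeneous polynomials whose leading coefficient is multiplicative.
  Carrying \<open>c\<close> along makes one lemma serve both the monic forms and those without leading term.\<close>

lemma form_mult:
  assumes "form c k h" "form c' l h'" "c \<in> carrier R" "c' \<in> carrier R"
  shows "form (c \<otimes> c') (k + l) (h \<otimes> h')"
  using assms
proof (induction rule: integral_form.induct)
  case base
  from base(1,3) show ?case
  proof (induction rule: integral_form.induct)
    case (step l h a)
    have carr: "h \<in> carrier R" "a \<in> carrier R" using step form_carr ipow_carr by blast+
    have "c \<otimes> (z \<otimes> h \<oplus> a) = z \<otimes> (c \<otimes> h) \<oplus> c \<otimes> a" using z_closed carr \<open>c \<in> carrier R\<close> by algebra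
    moreover have "c \<otimes> a \<in> ipow (Suc l)"
      using ideal.I_l_closed[OF ipow_ideal step.hyps(2) \<open>c \<in> carrier R\<close>] .
    ultimately show ?case using integral_form.step[OF step.IH] step by simp
  qed (auto intro: integral_form.base)
next
  case (step k h a)
  have carr: "h \<in> carrier R" "h' \<in> carrier R" "a \<in> carrier R"
    using step form_carr ipow_carr by blast+
  have "form (c \<otimes> c') (Suc (k + l)) (z \<otimes> (h \<otimes> h'))"
    using integral_form.step[OF step.IH[OF step.prems] ipow_zero] carr z_closed by simp
  from form_add[OF this form_scale[OF step.prems(1,3) step.hyps(2), simplified]]
  have "form (c \<otimes> c') (Suc (k + l)) (z \<otimes> (h \<otimes> h') \<oplus> a \<otimes> h')" using step by simp
  moreover have "z \<otimes> (h \<otimes> h') \<oplus> a \<otimes> h' = (z \<otimes> h \<oplus> a) \<otimes> h'" using carr z_closed by algebra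
  ultimately show ?case by simp
qed

lemma form_expand:
  assumes "form c k h" "c \<in> carrier R"
  shows "\<exists>a. (\<forall>i\<in>{1..k}. a i \<in> ipow i) \<and>
    h = c \<otimes> z [^] k \<oplus> (\<Oplus>i\<in>{1..k}. a i \<otimes> z [^] (k - i))"
  using assms
proof (induction rule: integral_form.induct)
  case (step k h b)
  then obtain a where a: "\<forall>i\<in>{1..k}. a i \<in> ipow i"
    "h = c \<otimes> z [^] k \<oplus> (\<Oplus>i\<in>{1..k}. a i \<otimes> z [^] (k - i))" by blast
  define a' where "a' = a(Suc k := b)"
  have b: "b \<in> carrier R" using step ipow_carr by blast
  have ac: "a i \<in> carrier R" if "i \<in> {1..k}" for i using a that ipow_carr by blast
  have "(\<Oplus>i\<in>{1..Suc k}. a' i \<otimes> z [^] (Suc k - i)) =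
      b \<oplus> (\<Oplus>i\<in>{1..k}. a' i \<otimes> z [^] (Suc k - i))"
    using b ac z_closed by (subst atLeastAtMostSuc_conv, simp, subst finsum_insert) (auto simp: a'_def)
  also have "(\<Oplus>i\<in>{1..k}. a' i \<otimes> z [^] (Suc k - i)) = (\<Oplus>i\<in>{1..k}. z \<otimes> (a i \<otimes> z [^] (k - i)))"
  proof (rule finsum_cong')
    fix i assume i: "i \<in> {1..k}"
    then have "z [^] (Suc k - i) = z [^] (k - i) \<otimes> z" by (simp add: Suc_diff_le)
    then show "a' i \<otimes> z [^] (Suc k - i) = z \<otimes> (a i \<otimes> z [^] (k - i))"
      using i ac[OF i] z_closed by (simp add: a'_def m_ac)
  qed (use ac z_closed in auto)
  also have "\<dots> = z \<otimes> (\<Oplus>i\<in>{1..k}. a i \<otimes> z [^] (k - i))"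
    using ac z_closed by (subst finsum_rdistr) auto
  finally have *: "(\<Oplus>i\<in>{1..Suc k}. a' i \<otimes> z [^] (Suc k - i)) =
      b \<oplus> z \<otimes> (\<Oplus>i\<in>{1..k}. a i \<otimes> z [^] (k - i))" .
  have sc: "(\<Oplus>i\<in>{1..k}. a i \<otimes> z [^] (k - i)) \<in> carrier R"
    using ac z_closed by (auto intro: finsum_closed)
  have rearrange: "z \<otimes> (c \<otimes> p \<oplus> s) \<oplus> b = c \<otimes> (z \<otimes> p) \<oplus> (b \<oplus> z \<otimes> s)"
    if "p \<in> carrier R" "s \<in> carrier R" for p s
    using that b step.prems z_closed by algebra
  have zk: "z [^] Suc k = z \<otimes> z [^] k" using z_closed by (simp add: m_comm)
  have "z \<otimes> h \<oplus> b = c \<otimes> z [^] Suc k \<oplus> (\<Oplus>i\<in>{1..Suc k}. a' i \<otimes> z [^] (Suc k - i))"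
    unfolding * a(2) zk
    by (rule rearrange) (use sc z_closed in auto)
  moreover have "\<forall>i\<in>{1..Suc k}. a' i \<in> ipow i" using a step by (auto simp: a'_def le_Suc_eq)
  ultimately show ?case by blast
qed (auto simp: simp del: Group.nat_pow_Suc)

lemma integral_closureI:
  assumes "form \<one> k \<zero>" "k > 0" shows "z \<in> integral_closure R I"
proof -
  from form_expand[OF assms(1)] obtain a where a: "\<forall>i\<in>{1..k}. a i \<in> ipow i"
    "\<zero> = \<one> \<otimes> z [^] k \<oplus> (\<Oplus>i\<in>{1..k}. a i \<otimes> z [^] (k - i))" by auto
  then show ?thesis
    unfolding integral_closure_def using z_closed assms(2) by (auto intro!: exI[of _ k] exI[of _ a])
qed

lemma form_pow: "form \<one> k h \<Longrightarrow> form \<one> (k * m) (h [^] m)"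
proof (induction m)
  case 0
  show ?case using integral_form.base[of R I z \<one>] by simp
next
  case (Suc m)
  show ?case using form_mult[OF Suc.IH[OF Suc.prems] Suc.prems] by (simp add: add.commute)
qed

text \<open>The determinant trick without determinants. A square linear system with monic forms on the diagonal and
  forms without leading term elsewhere stays of this shape, with doubled degree, when the last
  unknown is eliminated by cross-multiplication. Hence some monic form annihilates every unknown,
  just as the determinant would.\<close>

lemma elimination:
  fixes n :: nat
  assumes "\<And>i. i < n \<Longrightarrow> form \<one> k (b i i)"
    and "\<And>i j. i < n \<Longrightarrow> j < n \<Longrightarrow> i \<noteq> j \<Longrightarrow> form \<zero> k (b i j)"
    and "\<And>j. j < n \<Longrightarrow> e j \<in> carrier R"
    and "\<And>i. i < n \<Longrightarrow> (\<Oplus>j\<in>{..<n}. b i j \<otimes> e j) = \<zero>"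
  shows "\<exists>q h. form \<one> q h \<and> (\<forall>j<n. h \<otimes> e j = \<zero>)"
  using assms
proof (induction n arbitrary: k b)
  case 0
  show ?case by (intro exI[of _ 0] exI[of _ \<one>]) (simp add: integral_form.base)
next
  case (Suc n)
  note diag = Suc.prems(1) and off = Suc.prems(2) and ec = Suc.prems(3) and rel = Suc.prems(4)
  \<comment> \<open>Multiply row \<open>i\<close> by the pivot \<open>d\<close> and subtract \<open>b i n\<close> times the last row.\<close>
  define d where "d = b n n"
  define b' where "b' i j = d \<otimes> b i j \<oplus> \<ominus> (b i n) \<otimes> b n j" for i j
  have bc: "b i j \<in> carrier R" if "i < Suc n" "j < Suc n" for i j
    using diag[OF that(1)] off[OF that] form_carr by (cases "i = j") auto
  define s where "s i = (\<Oplus>j\<in>{..<n}. b i j \<otimes> e j)" for i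
  have sc: "s i \<in> carrier R" if "i < Suc n" for i
    unfolding s_def using bc[OF that] ec by (auto intro: finsum_closed)
  have s_neg: "s i = \<ominus> (b i n \<otimes> e n)" if "i < Suc n" for i
  proof -
    have "b i n \<otimes> e n \<oplus> s i = \<zero>"
      using rel[OF that] bc[OF that] ec by (simp add: s_def lessThan_Suc finsum_insert Pi_def)
    then have "s i \<oplus> b i n \<otimes> e n = \<zero>" using sc[OF that] bc[OF that, of n] ec[of n] by (simp add: a_comm)
    then show ?thesis using minus_equality[of "s i" "b i n \<otimes> e n"] sc[OF that] bc[OF that, of n] ec[of n]
      by simp
  qed
  have dform: "form \<one> k d" using diag[of n] by (simp add: d_def)
  have "\<exists>q h. form \<one> q h \<and> (\<forall>j<n. h \<otimes> e j = \<zero>)"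
  proof (rule Suc.IH[of "k + k" b'])
    fix i assume i: "i < n"
    have "form (\<one> \<otimes> \<one> \<oplus> \<ominus> \<zero> \<otimes> \<zero>) (k + k) (b' i i)"
      unfolding b'_def using i by (intro form_add form_mult form_neg dform diag off) auto
    then show "form \<one> (k + k) (b' i i)" by simp
    have "(\<Oplus>j\<in>{..<n}. b' i j \<otimes> e j) =
        (\<Oplus>j\<in>{..<n}. d \<otimes> (b i j \<otimes> e j) \<oplus> (\<ominus> (b i n)) \<otimes> (b n j \<otimes> e j))"
    proof (rule finsum_cong')
      fix j assume "j \<in> {..<n}"
      then have "b i j \<in> carrier R" "b i n \<in> carrier R" "b n j \<in> carrier R" "e j \<in> carrier R" "d \<in> carrier R"
        using bc ec i by (auto simp: d_def)
      then show "b' i j \<otimes> e j = d \<otimes> (b i j \<otimes> e j) \<oplus> (\<ominus> (b i n)) \<otimes> (b n j \<otimes> e j)"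
        unfolding b'_def by algebra
    qed (use bc ec i in \<open>auto simp: d_def\<close>)
    also have "\<dots> = (\<Oplus>j\<in>{..<n}. d \<otimes> (b i j \<otimes> e j)) \<oplus> (\<Oplus>j\<in>{..<n}. \<ominus> (b i n) \<otimes> (b n j \<otimes> e j))"
      using bc ec i by (intro finsum_addf) (auto simp: d_def)
    also have "\<dots> = d \<otimes> s i \<oplus> \<ominus> (b i n) \<otimes> s n"
      unfolding s_def using bc ec i by (subst (1 2) finsum_rdistr) (auto simp: d_def)
    also have "\<dots> = \<zero>"
    proof -
      have "b i n \<in> carrier R" "e n \<in> carrier R" "d \<in> carrier R" using bc ec i by (auto simp: d_def)
      moreover have "s i = \<ominus> (b i n \<otimes> e n)" "s n = \<ominus> (d \<otimes> e n)" using s_neg i by (auto simp: d_def)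
      ultimately show ?thesis by (simp only:) algebra
    qed
    finally show "(\<Oplus>j\<in>{..<n}. b' i j \<otimes> e j) = \<zero>" .
    fix j assume j: "j < n" "i \<noteq> j"
    have "form (\<one> \<otimes> \<zero> \<oplus> \<ominus> \<zero> \<otimes> \<zero>) (k + k) (b' i j)"
      unfolding b'_def using i j by (intro form_add form_mult form_neg dform off) auto
    then show "form \<zero> (k + k) (b' i j)" by simp
  qed (use ec in auto)
  then obtain q h where h: "form \<one> q h" "\<And>j. j < n \<Longrightarrow> h \<otimes> e j = \<zero>" by blast
  have hc: "h \<in> carrier R" "d \<in> carrier R" using form_carr[OF h(1)] bc by (auto simp: d_def)
  \<comment> \<open>The last row expresses \<open>d \<otimes> e n\<close> by the other unknowns, so the extra factor \<open>d\<close> makes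
    \<open>h\<close> annihilate \<open>e n\<close> as well.\<close>
  have "(h \<otimes> d) \<otimes> e j = \<zero>" if "j < n" for j
  proof -
    have "(h \<otimes> d) \<otimes> e j = d \<otimes> (h \<otimes> e j)" using hc ec[of j] that by (simp add: m_ac)
    then show ?thesis using h(2)[OF that] hc by simp
  qed
  moreover have "(h \<otimes> d) \<otimes> e n = \<zero>"
  proof -
    have "h \<otimes> s n = (\<Oplus>j\<in>{..<n}. h \<otimes> (b n j \<otimes> e j))"
      unfolding s_def using hc bc ec by (subst finsum_rdistr) auto
    also have "\<dots> = (\<Oplus>j\<in>{..<n}. \<zero>)"
    proof (rule finsum_cong')
      fix j assume j: "j \<in> {..<n}"
      have "h \<otimes> (b n j \<otimes> e j) = b n j \<otimes> (h \<otimes> e j)" using hc bc[of n j] ec[of j] j by (simp add: m_lcomm)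
      then show "h \<otimes> (b n j \<otimes> e j) = \<zero>" using h(2)[of j] bc[of n j] j by simp
    qed auto
    finally have "h \<otimes> s n = \<zero>" by simp
    moreover have "h \<otimes> s n = \<ominus> ((h \<otimes> d) \<otimes> e n)"
      using s_neg[of n] hc ec[of n] by (simp add: d_def r_minus m_assoc)
    ultimately have "\<ominus> ((h \<otimes> d) \<otimes> e n) = \<zero>" by simp
    then show ?thesis using hc ec[of n] by (metis a_inv_inj m_closed lessI minus_zero minus_minus zero_closed)
  qed
  moreover have "form \<one> (q + k) (h \<otimes> d)" using form_mult[OF h(1) dform] by simp
  ultimately show ?case by (metis less_Suc_eq)
qed

end

section \<open>Differences of powers and the Euclidean algorithm\<close>

text \<open>The subtractive Euclidean algorithm.\<close>

lemma Gcd_if_diff_closed: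
  fixes P :: "nat \<Rightarrow> bool"
  assumes diff: "\<And>s s'. P s \<Longrightarrow> P s' \<Longrightarrow> s' \<le> s \<Longrightarrow> P (s - s')"
    and T: "finite T" "T \<noteq> {}" "\<And>s. s \<in> T \<Longrightarrow> P s"
  shows "P (Gcd T)"
proof -
  have gcd: "P (gcd a b)" if "P a" "P b" for a b
    using that
  proof (induction "a + b" arbitrary: a b rule: less_induct)
    case less
    show ?case
    proof (cases "a = 0 \<or> b = 0 \<or> a = b")
      case True
      then show ?thesis using less.prems by auto
    next
      case False
      show ?thesis
      proof (cases "a < b")
        case True
        then have "P (gcd (b - a) a)" using False less.prems by (intro less.hyps diff) auto
        then show ?thesis using True using gcd_diff1_nat[of a b] by (simp add: gcd.commute)
      next
        case False': False
        then have "P (gcd (a - b) b)" using False less.prems by (intro less.hyps diff) auto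
        then show ?thesis using False' by (simp add: gcd_diff1_nat)
      qed
    qed
  qed
  from T show ?thesis
    by (induction T rule: finite_ne_induct) (auto intro: gcd)
qed

text \<open>The forms \<open>\<Sum> a\<^sub>j x\<^sup>j y\<^sup>q\<^sup>-\<^sup>j\<close> of degree \<open>q\<close> with coefficients in \<open>I\<close>, built by Horner's
  scheme.\<close>

inductive bihom_form ::
  "('a, 'm) ring_scheme \<Rightarrow> 'a set \<Rightarrow> 'a \<Rightarrow> 'a \<Rightarrow> nat \<Rightarrow> 'a \<Rightarrow> bool" for R I x y where
  base: "a \<in> I \<Longrightarrow> bihom_form R I x y 0 a"
| step: "bihom_form R I x y q h \<Longrightarrow> a \<in> I \<Longrightarrow>
    bihom_form R I x y (Suc q) (x \<otimes>\<^bsub>R\<^esub> h \<oplus>\<^bsub>R\<^esub> a \<otimes>\<^bsub>R\<^esub> y [^]\<^bsub>R\<^esub> Suc q)"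

locale ideal_and_pair = cring R + I: ideal I R for R (structure) and I and x y +
  assumes xy_closed[simp]: "x \<in> carrier R" "y \<in> carrier R"
begin

abbreviation bform :: "nat \<Rightarrow> 'a \<Rightarrow> bool" where "bform \<equiv> bihom_form R I x y"

lemma bform_carr: "bform q h \<Longrightarrow> h \<in> carrier R"
  by (induction rule: bihom_form.induct) (auto simp: I.Icarr)

lemma bform_zero: "bform q \<zero>"
  by (induction q) (use bihom_form.base[of \<zero> I R x y] bihom_form.step[of R I x y _ \<zero> \<zero>] in auto)

lemma bform_add: "bform q h \<Longrightarrow> bform q h' \<Longrightarrow> bform q (h \<oplus> h')"
proof (induction arbitrary: h' rule: bihom_form.induct)
  case (base a)
  then show ?case by (auto elim!: bihom_form.cases[of R I x y 0] intro!: bihom_form.base)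
next
  case (step q h a)
  from step.prems obtain g b where g: "bform q g" "b \<in> I" "h' = x \<otimes> g \<oplus> b \<otimes> y [^] Suc q"
    by (auto elim: bihom_form.cases)
  have carr: "h \<in> carrier R" "g \<in> carrier R" "a \<in> carrier R" "b \<in> carrier R"
    using step g bform_carr I.Icarr by auto
  have "x \<otimes> h \<oplus> a \<otimes> p \<oplus> (x \<otimes> g \<oplus> b \<otimes> p) = x \<otimes> (h \<oplus> g) \<oplus> (a \<oplus> b) \<otimes> p"
    if "p \<in> carrier R" for p using that carr xy_closed by algebra
  from this[of "y [^] Suc q"] show ?case
    using bihom_form.step[OF step.IH[OF g(1)]] g step.hyps by (simp del: nat_pow_Suc)
qed

lemma bform_scale: "bform q h \<Longrightarrow> s \<in> carrier R \<Longrightarrow> bform q (s \<otimes> h)"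
proof (induction rule: bihom_form.induct)
  case (base a)
  then show ?case by (auto intro!: bihom_form.base I.I_l_closed)
next
  case (step q h a)
  have carr: "h \<in> carrier R" "a \<in> carrier R" using step bform_carr I.Icarr by auto
  have "s \<otimes> (x \<otimes> h \<oplus> a \<otimes> p) = x \<otimes> (s \<otimes> h) \<oplus> (s \<otimes> a) \<otimes> p"
    if "p \<in> carrier R" for p using that carr step.prems xy_closed by algebra
  from this[of "y [^] Suc q"] show ?case
    using bihom_form.step[OF step.IH[OF step.prems]] I.I_l_closed step by (simp del: nat_pow_Suc)
qed

lemma bform_minus: "bform q h \<Longrightarrow> bform q h' \<Longrightarrow> bform q (h \<ominus> h')"
  using bform_add[OF _ bform_scale[of q h' "\<ominus> \<one>"]] bform_carr by (simp add: minus_eq l_minus)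

lemma bform_x: "bform q h \<Longrightarrow> bform (Suc q) (x \<otimes> h)"
  using bihom_form.step[of R I x y q h \<zero>] bform_carr by simp

lemma bform_y: "bform q h \<Longrightarrow> bform (Suc q) (y \<otimes> h)"
proof (induction rule: bihom_form.induct)
  case (base a)
  then show ?case
    using bihom_form.step[OF bform_zero[of 0] base] I.Icarr by (simp add: m_comm)
next
  case (step q h a)
  have carr: "h \<in> carrier R" "a \<in> carrier R" using step bform_carr I.Icarr by auto
  have "y \<otimes> (x \<otimes> h \<oplus> a \<otimes> p) = x \<otimes> (y \<otimes> h) \<oplus> a \<otimes> (p \<otimes> y)"
    if "p \<in> carrier R" for p using that carr xy_closed by algebra
  from this[of "y [^] Suc q"] show ?case
    using bihom_form.step[OF step.IH step.hyps(2)] by simp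
qed

text \<open>One factor \<open>x\<close> or \<open>y\<close> of each monomial can be absorbed into its coefficient.\<close>

lemma bform_lower: "bform (Suc q) h \<Longrightarrow> bform q h"
proof (induction q arbitrary: h)
  case 0
  then obtain g a where "g \<in> I" "a \<in> I" "h = x \<otimes> g \<oplus> a \<otimes> y [^] Suc 0"
    by (auto elim!: bihom_form.cases[of R I x y "Suc 0"] bihom_form.cases[of R I x y 0])
  then show ?case by (simp add: bihom_form.base I.I_l_closed I.I_r_closed)
next
  case (Suc q)
  from Suc.prems obtain g a where g: "bform (Suc q) g" "a \<in> I"
    "h = x \<otimes> g \<oplus> a \<otimes> y [^] Suc (Suc q)"
    by (auto elim: bihom_form.cases)
  have "bform (Suc q) (x \<otimes> \<zero> \<oplus> (a \<otimes> y) \<otimes> y [^] Suc q)"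
    using g by (intro bihom_form.step bform_zero I.I_r_closed) auto
  moreover have "x \<otimes> \<zero> \<oplus> (a \<otimes> y) \<otimes> y [^] Suc q = a \<otimes> y [^] Suc (Suc q)"
    using I.Icarr[OF g(2)] by (simp add: m_ac)
  ultimately show ?case unfolding g(3) using bform_add[OF bform_scale[OF g(1)]] by simp
qed

lemma bform_le: "p \<le> q \<Longrightarrow> bform q h \<Longrightarrow> bform p h"
  by (induction q rule: dec_induct) (auto dest: bform_lower)

lemma bform_monomial:
  assumes "g \<in> I" shows "bform (a + b) (x [^] a \<otimes> y [^] b \<otimes> g)"
proof -
  have y: "bform b (y [^] b \<otimes> g)" for b
  proof (induction b)
    case (Suc b)
    have "y \<otimes> (y [^] b \<otimes> g) = y [^] Suc b \<otimes> g" using I.Icarr[OF assms] by (simp add: m_ac)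
    then show ?case using bform_y[OF Suc] by (simp del: nat_pow_Suc)
  qed (use assms I.Icarr in \<open>simp add: bihom_form.base\<close>)
  show ?thesis
  proof (induction a)
    case (Suc a)
    have "x \<otimes> (x [^] a \<otimes> y [^] b \<otimes> g) = x [^] Suc a \<otimes> y [^] b \<otimes> g"
      using I.Icarr[OF assms] by (simp add: m_ac)
    then show ?case using bform_x[OF Suc] by (simp del: nat_pow_Suc)
  qed (use y I.Icarr[OF assms] in simp)
qed

lemma bform_expand:
  "bform q h \<Longrightarrow> \<exists>a. (\<forall>j\<le>q. a j \<in> I) \<and> h = (\<Oplus>j\<in>{..q}. a j \<otimes> (x [^] j \<otimes> y [^] (q - j)))"
proof (induction rule: bihom_form.induct)
  case (base a)
  then show ?case using I.Icarr by (intro exI[of _ "\<lambda>_. a"]) simp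
next
  case (step q h b)
  then obtain a where a: "\<forall>j\<le>q. a j \<in> I" "h = (\<Oplus>j\<in>{..q}. a j \<otimes> (x [^] j \<otimes> y [^] (q - j)))" by blast
  define a' where "a' j = (case j of 0 \<Rightarrow> b | Suc i \<Rightarrow> a i)" for j
  have I: "\<forall>j\<le>Suc q. a' j \<in> I" using a step by (auto simp: a'_def split: nat.splits)
  have "(\<Oplus>j\<in>{..Suc q}. a' j \<otimes> (x [^] j \<otimes> y [^] (Suc q - j))) =
     (\<Oplus>j\<in>{..q}. a' (Suc j) \<otimes> (x [^] Suc j \<otimes> y [^] (q - j))) \<oplus> a' 0 \<otimes> (x [^] (0::nat) \<otimes> y [^] Suc q)"
    using I I.Icarr by (subst finsum_Suc2) (auto simp del: nat_pow_Suc)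
  also have "(\<Oplus>j\<in>{..q}. a' (Suc j) \<otimes> (x [^] Suc j \<otimes> y [^] (q - j))) =
     (\<Oplus>j\<in>{..q}. x \<otimes> (a j \<otimes> (x [^] j \<otimes> y [^] (q - j))))"
    using a I.Icarr by (intro finsum_cong') (auto simp: a'_def m_ac)
  also have "\<dots> = x \<otimes> h"
    unfolding a(2) using a(1) I.Icarr by (subst finsum_rdistr) auto
  finally have "x \<otimes> h \<oplus> b \<otimes> y [^] Suc q = (\<Oplus>j\<in>{..Suc q}. a' j \<otimes> (x [^] j \<otimes> y [^] (Suc q - j)))"
    by (simp add: a'_def)
  then show ?case using I by blast
qed

text \<open>If \<open>x\<^sup>s - y\<^sup>s \<in> I\<close>, then \<open>x\<^sup>a y\<^sup>b (x\<^sup>s - y\<^sup>s)\<close> is a form of degree \<open>a + b\<close> over \<open>I\<close>, whereas its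
  total degree as a polynomial in \<open>x, y\<close> is \<open>a + b + s\<close>. For generators \<open>s \<le> D\<close> the loss
  of degree is thus at most \<open>D\<close>, and this bound is inherited by all \<open>s\<close> reached by the Euclidean algorithm.
  The condition \<open>D \<le> m\<close> ensures that the difference \<open>a + b + s - D\<close> is not truncated.\<close>

definition eventually_bform :: "nat \<Rightarrow> nat \<Rightarrow> bool" where
  "eventually_bform D s \<longleftrightarrow> (\<exists>m\<ge>D. \<forall>a b. m \<le> a + b \<longrightarrow>
     bform (a + b + s - D) (x [^] a \<otimes> y [^] b \<otimes> (x [^] s \<ominus> y [^] s)))"

lemma eventually_bform_generator:
  assumes "s \<le> D" "x [^] s \<ominus> y [^] s \<in> I" shows "eventually_bform D s"
  unfolding eventually_bform_def using assms
  by (intro exI[of _ D]) (auto intro: bform_le[OF _ bform_monomial])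

text \<open>Writing \<open>e = s - s'\<close>, one has \<open>y\<^sup>s\<^sup>' (x\<^sup>e - y\<^sup>e) = (x\<^sup>s - y\<^sup>s) - x\<^sup>e (x\<^sup>s\<^sup>' - y\<^sup>s\<^sup>')\<close> and
  symmetrically for \<open>x\<^sup>s\<^sup>' (x\<^sup>e - y\<^sup>e)\<close>. A monomial of large degree is divisible by \<open>x\<^sup>s\<^sup>'\<close> or
  by \<open>y\<^sup>s\<^sup>'\<close>.\<close>

lemma eventually_bform_diff:
  assumes "eventually_bform D s" "eventually_bform D s'" "s' \<le> s"
  shows "eventually_bform D (s - s')"
proof -
  from assms obtain m m' where m: "m \<ge> D" "m' \<ge> D"
    and f: "\<And>a b. m \<le> a + b \<Longrightarrow> bform (a + b + s - D) (x [^] a \<otimes> y [^] b \<otimes> (x [^] s \<ominus> y [^] s))"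
    and f': "\<And>a b. m' \<le> a + b \<Longrightarrow> bform (a + b + s' - D) (x [^] a \<otimes> y [^] b \<otimes> (x [^] s' \<ominus> y [^] s'))"
    unfolding eventually_bform_def by metis
  obtain e where e: "s = s' + e" using assms(3) le_Suc_ex by blast
  have pow: "x [^] (i + j) = x [^] i \<otimes> x [^] j" "y [^] (i + j) = y [^] i \<otimes> y [^] j" for i j :: nat
    by (simp_all add: nat_pow_mult)
  have "bform (a + b + e - D) (x [^] a \<otimes> y [^] b \<otimes> (x [^] e \<ominus> y [^] e))"
    if ab: "m + m' + s' + s' \<le> a + b" for a b
  proof (cases "s' \<le> b")
    case True
    then obtain c where c: "b = s' + c" using le_Suc_ex by blast
    have "bform (a + b + e - D) (x [^] a \<otimes> y [^] c \<otimes> (x [^] s \<ominus> y [^] s) \<ominus>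
        x [^] (a + e) \<otimes> y [^] c \<otimes> (x [^] s' \<ominus> y [^] s'))"
      using f[of a c] f'[of "a + e" c] ab by (intro bform_minus) (simp_all add: c e ac_simps)
    also have "x [^] a \<otimes> y [^] c \<otimes> (x [^] s \<ominus> y [^] s) \<ominus> x [^] (a + e) \<otimes> y [^] c \<otimes> (x [^] s' \<ominus> y [^] s')
       = x [^] a \<otimes> y [^] b \<otimes> (x [^] e \<ominus> y [^] e)"
    proof -
      have "xa \<otimes> yc \<otimes> (xs \<otimes> xe \<ominus> ys \<otimes> ye) \<ominus> xa \<otimes> xe \<otimes> yc \<otimes> (xs \<ominus> ys) = xa \<otimes> (ys \<otimes> yc) \<otimes> (xe \<ominus> ye)"
        if "xa \<in> carrier R" "yc \<in> carrier R" "xs \<in> carrier R" "ys \<in> carrier R" "xe \<in> carrier R" "ye \<in> carrier R"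
        for xa yc xs ys xe ye using that by algebra
      then show ?thesis by (simp add: c e pow)
    qed
    finally show ?thesis .
  next
    case False
    then have "s' \<le> a" using ab by simp
    then obtain c where c: "a = s' + c" using le_Suc_ex by blast
    have "bform (a + b + e - D) (x [^] c \<otimes> y [^] b \<otimes> (x [^] s \<ominus> y [^] s) \<ominus>
        x [^] c \<otimes> y [^] (b + e) \<otimes> (x [^] s' \<ominus> y [^] s'))"
      using f[of c b] f'[of c "b + e"] ab by (intro bform_minus) (simp_all add: c e ac_simps)
    also have "x [^] c \<otimes> y [^] b \<otimes> (x [^] s \<ominus> y [^] s) \<ominus> x [^] c \<otimes> y [^] (b + e) \<otimes> (x [^] s' \<ominus> y [^] s')
       = x [^] a \<otimes> y [^] b \<otimes> (x [^] e \<ominus> y [^] e)"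
    proof -
      have "xc \<otimes> yb \<otimes> (xs \<otimes> xe \<ominus> ys \<otimes> ye) \<ominus> xc \<otimes> (yb \<otimes> ye) \<otimes> (xs \<ominus> ys) = xs \<otimes> xc \<otimes> yb \<otimes> (xe \<ominus> ye)"
        if "xc \<in> carrier R" "yb \<in> carrier R" "xs \<in> carrier R" "ys \<in> carrier R" "xe \<in> carrier R" "ye \<in> carrier R"
        for xc yb xs ys xe ye using that by algebra
      then show ?thesis by (simp add: c e pow)
    qed
    finally show ?thesis .
  qed
  then show ?thesis unfolding eventually_bform_def e using m
    by (intro exI[of _ "m + m' + s' + s'"]) simp
qed

lemma eventually_bform_add:
  assumes "eventually_bform D s" "eventually_bform D s'"
  shows "eventually_bform D (s + s')"
proof -
  from assms obtain m m' where m: "m \<ge> D" "m' \<ge> D"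
    and f: "\<And>a b. m \<le> a + b \<Longrightarrow> bform (a + b + s - D) (x [^] a \<otimes> y [^] b \<otimes> (x [^] s \<ominus> y [^] s))"
    and f': "\<And>a b. m' \<le> a + b \<Longrightarrow> bform (a + b + s' - D) (x [^] a \<otimes> y [^] b \<otimes> (x [^] s' \<ominus> y [^] s'))"
    unfolding eventually_bform_def by metis
  have pow: "x [^] (i + j) = x [^] i \<otimes> x [^] j" "y [^] (i + j) = y [^] i \<otimes> y [^] j" for i j :: nat
    by (simp_all add: nat_pow_mult)
  have "bform (a + b + (s + s') - D) (x [^] a \<otimes> y [^] b \<otimes> (x [^] (s + s') \<ominus> y [^] (s + s')))"
    if ab: "m + m' \<le> a + b" for a b
  proof -
    have "bform (a + b + (s + s') - D) (x [^] (a + s) \<otimes> y [^] b \<otimes> (x [^] s' \<ominus> y [^] s') \<oplus>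
        x [^] a \<otimes> y [^] (b + s') \<otimes> (x [^] s \<ominus> y [^] s))"
      using f[of a "b + s'"] f'[of "a + s" b] ab by (intro bform_add) (simp_all add: ac_simps)
    also have "x [^] (a + s) \<otimes> y [^] b \<otimes> (x [^] s' \<ominus> y [^] s') \<oplus> x [^] a \<otimes> y [^] (b + s') \<otimes> (x [^] s \<ominus> y [^] s)
       = x [^] a \<otimes> y [^] b \<otimes> (x [^] (s + s') \<ominus> y [^] (s + s'))"
    proof -
      have "xa \<otimes> xe \<otimes> yb \<otimes> (xs \<ominus> ys) \<oplus> xa \<otimes> (yb \<otimes> ys) \<otimes> (xe \<ominus> ye) = xa \<otimes> yb \<otimes> (xe \<otimes> xs \<ominus> ye \<otimes> ys)"
        if "xa \<in> carrier R" "yb \<in> carrier R" "xs \<in> carrier R" "ys \<in> carrier R" "xe \<in> carrier R" "ye \<in> carrier R"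
        for xa yb xs ys xe ye using that by algebra
      then show ?thesis by (simp add: pow)
    qed
    finally show ?thesis .
  qed
  then show ?thesis unfolding eventually_bform_def using m by (intro exI[of _ "m + m'"]) simp
qed

text \<open>The loss of degree is at most \<open>D\<close> and is compensated by \<open>l \<ge> D\<close>, so multiplication by
  \<open>x\<^sup>l - y\<^sup>l\<close> keeps the degree \<open>q\<close> while moving the coefficients into \<open>I\<close>.\<close>

lemma power_diff_bform:
  fixes D l :: nat
  assumes T: "finite T" "T \<noteq> {}" "\<And>s. s \<in> T \<Longrightarrow> s \<le> D \<and> x [^] s \<ominus> y [^] s \<in> I"
    and l: "D \<le> l" "Gcd T dvd l"
  shows "\<exists>m. \<forall>q\<ge>m. \<forall>i\<le>q. bform q ((x [^] l \<ominus> y [^] l) \<otimes> (x [^] i \<otimes> y [^] (q - i)))"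
proof -
  have "eventually_bform D (Gcd T)"
    by (rule Gcd_if_diff_closed[where P = "eventually_bform D", OF _ T(1,2)])
      (use T(3) in \<open>auto intro: eventually_bform_diff eventually_bform_generator\<close>)
  moreover have "eventually_bform D 0"
    by (rule eventually_bform_generator) (simp_all add: minus_eq r_neg)
  ultimately have "eventually_bform D (k * Gcd T)" for k
    by (induction k) (auto intro: eventually_bform_add)
  with l(2) have "eventually_bform D l" by (metis dvd_def mult.commute)
  then obtain m where m: "\<And>a b. m \<le> a + b \<Longrightarrow> bform (a + b + l - D) (x [^] a \<otimes> y [^] b \<otimes> (x [^] l \<ominus> y [^] l))"
    unfolding eventually_bform_def by blast
  have "bform q ((x [^] l \<ominus> y [^] l) \<otimes> (x [^] i \<otimes> y [^] (q - i)))" if "m \<le> q" "i \<le> q" for i q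
    using bform_le[OF _ m[of i "q - i"]] that l(1) by (simp add: m_comm)
  then show ?thesis by blast
qed

text \<open>The monomials of degree \<open>q\<close> satisfy a linear system to which the determinant trick
  applies, so some monic form \<open>h\<close> annihilates them. The module that they span need not be faithful; instead
  \<open>w = z - u\<close> lies in the ideal of \<open>x\<close> and \<open>y\<close>, so that its power \<open>w\<^sup>q\<close> is a combination of these
  monomials. Hence \<open>h w\<^sup>q = 0\<close>, and \<open>h w\<^sup>q\<close> is again a monic form in \<open>z\<close>.\<close>

lemma integral_closure_if_bform:
  assumes z: "z \<in> carrier R" and u: "u \<in> I" and ab: "\<alpha> \<in> carrier R" "\<beta> \<in> carrier R"
    and zu: "z = u \<oplus> (x \<otimes> \<alpha> \<oplus> y \<otimes> \<beta>)" and q: "q > 0"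
    and stable: "\<And>i. i \<le> q \<Longrightarrow> bform q (z \<otimes> (x [^] i \<otimes> y [^] (q - i)))"
  shows "z \<in> integral_closure R I"
proof -
  interpret integral_element R I z by unfold_locales (rule z)
  define e where "e j = x [^] j \<otimes> y [^] (q - j)" for j
  have ec: "e j \<in> carrier R" for j by (simp add: e_def)
  have "\<exists>a. \<forall>i\<le>q. (\<forall>j\<le>q. a i j \<in> I) \<and> z \<otimes> e i = (\<Oplus>j\<in>{..q}. a i j \<otimes> e j)"
    using bform_expand[OF stable] unfolding e_def by (intro choice) blast
  then obtain a where a: "\<And>i j. i \<le> q \<Longrightarrow> j \<le> q \<Longrightarrow> a i j \<in> I"
    and ze: "\<And>i. i \<le> q \<Longrightarrow> z \<otimes> e i = (\<Oplus>j\<in>{..q}. a i j \<otimes> e j)" by blast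
  \<comment> \<open>The matrix \<open>z - a\<close>, with entries that are forms of degree 1.\<close>
  define b where "b i j = (if i = j then z else \<zero>) \<oplus> \<ominus> \<one> \<otimes> a i j" for i j
  have neg: "\<ominus> \<one> \<otimes> a i j \<in> ipow (Suc 0)" if "i \<le> q" "j \<le> q" for i j
    using I.I_l_closed[OF a[OF that]] ipow_1 by simp
  have "\<exists>k h. form \<one> k h \<and> (\<forall>j<Suc q. h \<otimes> e j = \<zero>)"
  proof (rule elimination[where b = b and k = "Suc 0"])
    fix i assume i: "i < Suc q"
    have "form \<one> (Suc 0) (z \<otimes> \<one> \<oplus> \<ominus> \<one> \<otimes> a i i)"
      using i by (intro integral_form.step integral_form.base neg) auto
    then show "form \<one> (Suc 0) (b i i)" using z by (simp add: b_def)
    have ac: "a i j \<in> carrier R" if "j \<le> q" for j using a[of i j] that i I.Icarr by simp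
    have "(\<Oplus>j\<in>{..q}. b i j \<otimes> e j) =
      (\<Oplus>j\<in>{..q}. (if i = j then z \<otimes> e j else \<zero>) \<oplus> \<ominus> \<one> \<otimes> (a i j \<otimes> e j))"
      using ac ec z by (intro finsum_cong') (auto simp: b_def l_distr m_assoc)
    also have "\<dots> = (\<Oplus>j\<in>{..q}. if i = j then z \<otimes> e j else \<zero>) \<oplus> (\<Oplus>j\<in>{..q}. \<ominus> \<one> \<otimes> (a i j \<otimes> e j))"
      using ac ec z by (intro finsum_addf) auto
    also have "(\<Oplus>j\<in>{..q}. if i = j then z \<otimes> e j else \<zero>) = z \<otimes> e i"
      using i ec z by (intro finsum_singleton) auto
    also have "(\<Oplus>j\<in>{..q}. \<ominus> \<one> \<otimes> (a i j \<otimes> e j)) = \<ominus> \<one> \<otimes> (z \<otimes> e i)"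
      using ac ec i by (simp add: ze finsum_rdistr Pi_def)
    also have "z \<otimes> e i \<oplus> \<ominus> \<one> \<otimes> (z \<otimes> e i) = \<zero>" using z ec by (simp add: l_minus r_neg)
    finally show "(\<Oplus>j\<in>{..<Suc q}. b i j \<otimes> e j) = \<zero>" by (simp add: lessThan_Suc_atMost)
    fix j assume j: "j < Suc q" "i \<noteq> j"
    then show "form \<zero> (Suc 0) (b i j)"
      using form_zero_coeff[OF neg[of i j]] i I.Icarr[OF a[of i j]] by (simp add: b_def)
  qed (rule ec)
  then obtain k h where h: "form \<one> k h" "\<And>j. j \<le> q \<Longrightarrow> h \<otimes> e j = \<zero>" by (auto simp: less_Suc_eq_le)
  have hc: "h \<in> carrier R" using form_carr[OF h(1)] by simp
  define w where "w = x \<otimes> \<alpha> \<oplus> y \<otimes> \<beta>"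
  have wc: "w \<in> carrier R" using ab by (simp add: w_def)
  have kill: "h \<otimes> (x [^] i \<otimes> y [^] j \<otimes> w [^] l) = \<zero>" if "q \<le> i + j + l" for i j l
    using that
  proof (induction l arbitrary: i j)
    case 0
    have pow: "x [^] (i + j) = x [^] i \<otimes> x [^] j" "y [^] (i + j) = y [^] i \<otimes> y [^] j" for i j :: nat
      by (simp_all add: nat_pow_mult)
    have "\<exists>f\<in>carrier R. \<exists>t\<le>q. x [^] i \<otimes> y [^] j = e t \<otimes> f"
    proof (cases "i \<le> q")
      case True
      then have "x [^] i \<otimes> y [^] j = e i \<otimes> y [^] (i + j - q)"
        using 0 pow(2)[of "q - i" "i + j - q"] by (simp add: e_def m_assoc)
      then show ?thesis using True by (meson nat_pow_closed xy_closed)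
    next
      case False
      then have "x [^] i \<otimes> y [^] j = e q \<otimes> (x [^] (i - q) \<otimes> y [^] j)"
        using pow(1)[of q "i - q"] by (simp add: e_def m_assoc)
      then show ?thesis by (meson nat_pow_closed xy_closed m_closed order_refl)
    qed
    then obtain f t where f: "f \<in> carrier R" "t \<le> q" "x [^] i \<otimes> y [^] j = e t \<otimes> f" by blast
    have "h \<otimes> (e t \<otimes> f) = (h \<otimes> e t) \<otimes> f" using hc ec f(1) by (simp add: m_assoc)
    then show ?case using h(2)[OF f(2)] f ec by simp
  next
    case (Suc l)
    have "h \<otimes> (xi \<otimes> yj \<otimes> (wl \<otimes> w)) = \<alpha> \<otimes> (h \<otimes> ((xi \<otimes> x) \<otimes> yj \<otimes> wl)) \<oplus> \<beta> \<otimes> (h \<otimes> (xi \<otimes> (yj \<otimes> y) \<otimes> wl))"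
      if "xi \<in> carrier R" "yj \<in> carrier R" "wl \<in> carrier R" for xi yj wl
      unfolding w_def using that hc ab xy_closed by algebra
    from this[of "x [^] i" "y [^] j" "w [^] l"]
    show ?case using Suc.IH[of "Suc i" j] Suc.IH[of i "Suc j"] Suc.prems ab wc by simp
  qed
  have "h \<otimes> w [^] q = \<zero>" using kill[of 0 0 q] wc by simp
  moreover have "form \<one> (Suc 0) w"
  proof -
    have "form \<one> (Suc 0) (z \<otimes> \<one> \<oplus> \<ominus> u)"
      using ipow_neg[of u 1] ipow_1 u by (intro integral_form.step integral_form.base) auto
    moreover have "z \<otimes> \<one> \<oplus> \<ominus> u = w"
    proof -
      have "u \<oplus> v \<oplus> \<ominus> u = v" if "v \<in> carrier R" for v using that I.Icarr[OF u] by algebra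
      then show ?thesis using z wc zu by (simp add: w_def)
    qed
    ultimately show ?thesis by simp
  qed
  ultimately have "form \<one> (k + q) \<zero>"
    using form_mult[OF h(1) form_pow[of "Suc 0" w q]] by simp
  then show ?thesis using q by (intro integral_closureI[of "k + q"]) auto
qed



text \<open>A sufficient condition for integrality over \<open>I\<close> that is visibly additive, unlike the equation
  of integral dependence itself. The first clause makes a power of \<open>z\<close> a combination of monomials in \<open>x, y\<close> up to
  multiples of \<open>u \<in> I\<close>; the second one provides the linear system for these monomials.\<close>

definition controlled :: "'a \<Rightarrow> bool" where
  "controlled z \<longleftrightarrow>
     (\<exists>u\<in>I. \<exists>\<alpha>\<in>carrier R. \<exists>\<beta>\<in>carrier R. z = u \<oplus> (x \<otimes> \<alpha> \<oplus> y \<otimes> \<beta>)) \<and>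
     (\<exists>m. \<forall>q\<ge>m. \<forall>i\<le>q. bform q (z \<otimes> (x [^] i \<otimes> y [^] (q - i))))"

lemma controlled_carr: "controlled z \<Longrightarrow> z \<in> carrier R"
  unfolding controlled_def using I.Icarr by auto

lemma controlled_ideal:
  assumes "u \<in> I" shows "controlled u"
  unfolding controlled_def
proof (intro conjI)
  show "\<exists>u'\<in>I. \<exists>\<alpha>\<in>carrier R. \<exists>\<beta>\<in>carrier R. u = u' \<oplus> (x \<otimes> \<alpha> \<oplus> y \<otimes> \<beta>)"
    by (rule bexI[OF _ assms], rule bexI[of _ \<zero>], rule bexI[of _ \<zero>]) (use I.Icarr[OF assms] in auto)
  have "bform q (u \<otimes> (x [^] i \<otimes> y [^] (q - i)))" if "i \<le> q" for q i
    using bform_monomial[OF assms, of i "q - i"] that I.Icarr[OF assms] by (simp add: m_comm)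
  then show "\<exists>m. \<forall>q\<ge>m. \<forall>i\<le>q. bform q (u \<otimes> (x [^] i \<otimes> y [^] (q - i)))" by blast
qed

lemma controlled_add:
  assumes "controlled z" "controlled z'" shows "controlled (z \<oplus> z')"
proof -
  obtain u \<alpha> \<beta> m where z: "u \<in> I" "\<alpha> \<in> carrier R" "\<beta> \<in> carrier R" "z = u \<oplus> (x \<otimes> \<alpha> \<oplus> y \<otimes> \<beta>)"
      and m: "\<And>q i. m \<le> q \<Longrightarrow> i \<le> q \<Longrightarrow> bform q (z \<otimes> (x [^] i \<otimes> y [^] (q - i)))"
    using assms(1) unfolding controlled_def by blast
  obtain u' \<alpha>' \<beta>' m' where z': "u' \<in> I" "\<alpha>' \<in> carrier R" "\<beta>' \<in> carrier R"
      "z' = u' \<oplus> (x \<otimes> \<alpha>' \<oplus> y \<otimes> \<beta>')"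
      and m': "\<And>q i. m' \<le> q \<Longrightarrow> i \<le> q \<Longrightarrow> bform q (z' \<otimes> (x [^] i \<otimes> y [^] (q - i)))"
    using assms(2) unfolding controlled_def by blast
  have "z \<oplus> z' = (u \<oplus> u') \<oplus> (x \<otimes> (\<alpha> \<oplus> \<alpha>') \<oplus> y \<otimes> (\<beta> \<oplus> \<beta>'))"
    unfolding z(4) z'(4) using z z' I.Icarr[OF z(1)] I.Icarr[OF z'(1)] xy_closed by algebra
  moreover have "bform q ((z \<oplus> z') \<otimes> (x [^] i \<otimes> y [^] (q - i)))" if "max m m' \<le> q" "i \<le> q" for q i
    using bform_add[OF m[of q i] m'[of q i]] that controlled_carr[OF assms(1)] controlled_carr[OF assms(2)]
    by (simp add: l_distr)
  ultimately show ?thesis unfolding controlled_def using z z' I.a_closed by blast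
qed

lemma controlled_power_diff:
  fixes D l :: nat
  assumes T: "finite T" "T \<noteq> {}" "\<And>s. s \<in> T \<Longrightarrow> s \<le> D \<and> x [^] s \<ominus> y [^] s \<in> I"
    and l: "D \<le> l" "Gcd T dvd l" "0 < l" and s: "s \<in> carrier R"
  shows "controlled (s \<otimes> (x [^] l \<ominus> y [^] l))"
  unfolding controlled_def
proof (intro conjI)
  obtain k where k: "l = Suc k" using l(3) gr0_implies_Suc by blast
  have "s \<otimes> (x [^] l \<ominus> y [^] l) = \<zero> \<oplus> (x \<otimes> (s \<otimes> x [^] k) \<oplus> y \<otimes> (\<ominus> (s \<otimes> y [^] k)))"
  proof -
    have "s \<otimes> (xk \<otimes> x \<ominus> yk \<otimes> y) = \<zero> \<oplus> (x \<otimes> (s \<otimes> xk) \<oplus> y \<otimes> (\<ominus> (s \<otimes> yk)))"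
      if "xk \<in> carrier R" "yk \<in> carrier R" for xk yk using that s xy_closed by algebra
    then show ?thesis by (simp add: k)
  qed
  then show "\<exists>u\<in>I. \<exists>\<alpha>\<in>carrier R. \<exists>\<beta>\<in>carrier R.
      s \<otimes> (x [^] l \<ominus> y [^] l) = u \<oplus> (x \<otimes> \<alpha> \<oplus> y \<otimes> \<beta>)"
    using s I.zero_closed by (meson a_inv_closed m_closed nat_pow_closed xy_closed)
  obtain m where "\<And>q i. m \<le> q \<Longrightarrow> i \<le> q \<Longrightarrow> bform q ((x [^] l \<ominus> y [^] l) \<otimes> (x [^] i \<otimes> y [^] (q - i)))"
    using power_diff_bform[OF T l(1,2)] by blast
  then show "\<exists>m. \<forall>q\<ge>m. \<forall>i\<le>q. bform q (s \<otimes> (x [^] l \<ominus> y [^] l) \<otimes> (x [^] i \<otimes> y [^] (q - i)))"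
    using bform_scale[OF _ s] s by (intro exI[of _ m]) (simp add: m_assoc)
qed

lemma integral_closure_if_controlled:
  assumes "controlled z" shows "z \<in> integral_closure R I"
proof -
  obtain u \<alpha> \<beta> m where z: "u \<in> I" "\<alpha> \<in> carrier R" "\<beta> \<in> carrier R" "z = u \<oplus> (x \<otimes> \<alpha> \<oplus> y \<otimes> \<beta>)"
      and m: "\<And>q i. m \<le> q \<Longrightarrow> i \<le> q \<Longrightarrow> bform q (z \<otimes> (x [^] i \<otimes> y [^] (q - i)))"
    using assms unfolding controlled_def by blast
  show ?thesis
    using integral_closure_if_bform[OF controlled_carr[OF assms] z, of "Suc m"] m by simp
qed

end

section \<open>Power series twisted by a formal root of unity\<close>

text \<open>Polynomials act on two-sided sequences, with the indeterminate acting as the right shift.\<close>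

definition shift_act :: "'a::comm_ring_1 poly \<Rightarrow> (int \<Rightarrow> 'a) \<Rightarrow> int \<Rightarrow> 'a" where
  "shift_act p c = fold_coeffs (\<lambda>a f k. a * c k + f (k - 1)) p (\<lambda>_. 0)"

lemma shift_act_0[simp]: "shift_act 0 c k = 0" by (simp add: shift_act_def)

lemma shift_act_pCons[simp]: "shift_act (pCons a p) c k = a * c k + shift_act p c (k - 1)"
  by (cases "a = 0 \<and> p = 0") (auto simp: shift_act_def fold_coeffs_pCons_eq fun_eq_iff)

lemma shift_act_add: "shift_act (p + q) c k = shift_act p c k + shift_act q c k"
  by (induction p q arbitrary: k rule: poly_induct2) (simp_all add: algebra_simps)

lemma shift_act_const_mult: "shift_act ([:a:] * p) c k = a * shift_act p c k"
  by (induction p arbitrary: k) (simp_all add: algebra_simps)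

lemma shift_act_mult: "shift_act (p * q) c k = shift_act p (shift_act q c) k"
  by (induction p arbitrary: k) (simp_all add: shift_act_add shift_act_const_mult[simplified])

lemma shift_act_power: "shift_act ([:0, 1:] ^ m) c k = c (k - int m)"
  by (induction m arbitrary: k) (simp_all add: shift_act_mult one_pCons algebra_simps)

lemma shift_act_diff: "shift_act (p - q) c k = shift_act p c k - shift_act q c k"
  using shift_act_add[of "p - q" q c k] by (simp add: algebra_simps)

text \<open>Modulo \<open>Z\<^sup>d - 1\<close> a polynomial is determined by its action on the indicator sequence of \<open>d\<int>\<close>. Suppose
  that \<open>p (1 - Z\<^sup>m)\<^sup>2\<close> acts as zero. Then \<open>p (1 - Z\<^sup>m)\<close> yields a sequence \<open>c\<close> invariant under the shift
  by \<open>m\<close>, so the sum of \<open>c\<close> over \<open>d\<close> successive shifts is \<open>d c\<close>; but this sum telescopes to zero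
  because \<open>d\<close> shifts by \<open>m\<close> are a period. As \<open>d\<close> is not a zero divisor, \<open>p (1 - Z\<^sup>m)\<close> already acts
  as zero. In this way the exponent \<open>N\<close> drops to \<open>1\<close>, where the claim can be read off at \<open>0\<close>.\<close>

lemma const_eq_0_if_root_of_unity_dvd:
  fixes a :: "'a::comm_ring_1"
  assumes nzd: "\<And>b::'a. of_nat d * b = 0 \<Longrightarrow> b = 0" and m: "\<not> d dvd m"
    and dvd: "[:0, 1:] ^ d - 1 dvd [:a:] * (1 - [:0, 1:] ^ m) ^ N"
  shows "a = 0"
proof -
  define \<delta> :: "int \<Rightarrow> 'a" where "\<delta> k = of_bool (int d dvd k)" for k
  define c where "c n = shift_act ([:a:] * (1 - [:0, 1:] ^ m) ^ n) \<delta>" for n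
  have c0: "c 0 k = a * \<delta> k" for k by (simp add: c_def)
  have act1: "shift_act 1 f k = f k" for f :: "int \<Rightarrow> 'a" and k by (simp add: one_pCons)
  have cSuc: "c (Suc n) k = c n k - c n (k - int m)" for n k
  proof -
    have "[:a:] * (1 - [:0, 1:] ^ m) ^ Suc n = (1 - [:0, 1:] ^ m) * ([:a:] * (1 - [:0, 1:] ^ m) ^ n)"
      by (simp only: power_Suc mult.left_commute)
    then show ?thesis unfolding c_def by (simp only: shift_act_mult[of "1 - _"] shift_act_diff act1 shift_act_power)
  qed
  have periodic: "c n (k - int d * j) = c n k" for n k j
  proof (induction n arbitrary: k)
    case 0
    have "int d dvd k - int d * j \<longleftrightarrow> int d dvd k" by (simp add: dvd_diff_left_iff)
    then show ?case by (simp add: c0 \<delta>_def)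
  next
    case (Suc n)
    have "k - int d * j - int m = k - int m - int d * j" by simp
    then show ?case by (simp only: cSuc Suc.IH)
  qed
  have down: "c (Suc n) k = 0" if "\<And>k. c (Suc (Suc n)) k = 0" for n k
  proof (rule nzd)
    have "c (Suc n) (k - int m) = c (Suc n) k" for k using that[of k] by (simp add: cSuc[of "Suc n"])
    then have "c (Suc n) (k - int i * int m) = c (Suc n) k" for i
      by (induction i) (metis (no_types, lifting) diff_zero mult_zero_left of_nat_0,
        metis (no_types, lifting) add.commute diff_diff_add distrib_right mult_1 of_nat_Suc)
    then have "of_nat d * c (Suc n) k = (\<Sum>i<d. c (Suc n) (k - int i * int m))" by simp
    also have "\<dots> = (\<Sum>i<d. c n (k - int i * int m) - c n (k - int (Suc i) * int m))"
      by (simp add: cSuc algebra_simps)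
    also have "\<dots> = c n (k - int 0 * int m) - c n (k - int d * int m)"
      by (rule sum_lessThan_telescope')
    also have "\<dots> = 0" using periodic[of n k "int m"] by simp
    finally show "of_nat d * c (Suc n) k = 0" .
  qed
  have one: "a = 0" if "\<And>k. c (Suc 0) k = 0"
    using that[of 0] m by (simp add: cSuc c0 \<delta>_def)
  have all: "a = 0" if "\<And>k. c n k = 0" for n
    using that
  proof (induction n)
    case 0
    then show ?case using 0[of 0] by (simp add: c0 \<delta>_def)
  next
    case (Suc n)
    then show ?case using one down by (cases n) auto
  qed
  obtain q where q: "[:a:] * (1 - [:0, 1:] ^ m) ^ N = q * ([:0, 1:] ^ d - 1)"
    using dvd by (metis dvd_def mult.commute)
  have "shift_act ([:0, 1:] ^ d - 1) \<delta> = (\<lambda>_. 0)"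
    by (simp add: fun_eq_iff shift_act_diff shift_act_power act1 \<delta>_def dvd_diff_left_iff)
  then have "c N = shift_act q (\<lambda>_. 0)"
    unfolding c_def q by (intro ext) (simp only: shift_act_mult)
  moreover have "shift_act q (\<lambda>_. 0) k = 0" for k by (induction q arbitrary: k) auto
  ultimately have "c N k = 0" for k by simp
  then show ?thesis by (rule all)
qed

text \<open>The series \<open>f(s)\<close>, with constant polynomials in \<open>Z\<close> as coefficients.\<close>

definition fps_embed :: "'a::comm_ring_1 fps \<Rightarrow> 'a poly fps" where
  "fps_embed f = Abs_fps (\<lambda>i. [:fps_nth f i:])"

text \<open>The series \<open>f(Z s)\<close>.\<close>

definition fps_twist :: "'a::comm_ring_1 fps \<Rightarrow> 'a poly fps" where
  "fps_twist f = Abs_fps (\<lambda>i. [:fps_nth f i:] * [:0, 1:] ^ i)"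

lemma const_poly_sum:
  fixes f :: "'b \<Rightarrow> 'a::comm_ring_1"
  shows "[:sum f A:] = (\<Sum>i\<in>A. [:f i:])"
proof (induction A rule: infinite_finite_induct)
  case (insert i A)
  have "[:a + b:] = [:a:] + [:b:]" for a b :: 'a by simp
  then show ?case by (simp only: sum.insert[OF insert.hyps(1,2)] insert.IH)
qed auto

lemma fps_embed_hom:
  "fps_embed (f + g) = fps_embed f + fps_embed g" "fps_embed (f * g) = fps_embed f * fps_embed g"
  "fps_embed 1 = 1"
  by (auto simp: fps_embed_def fps_eq_iff fps_mult_nth const_poly_sum one_pCons mult.commute)

lemma fps_twist_hom:
  "fps_twist (f + g) = fps_twist f + fps_twist g" "fps_twist (f * g) = fps_twist f * fps_twist g"
  "fps_twist 1 = 1"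
proof -
  show "fps_twist (f * g) = fps_twist f * fps_twist g"
  proof (rule fps_ext)
    fix n
    have "[:fps_nth f i * fps_nth g (n - i):] * [:0, 1:] ^ n =
        ([:fps_nth f i:] * [:0, 1:] ^ i) * ([:fps_nth g (n - i):] * [:0, 1:] ^ (n - i))" if "i \<le> n" for i
    proof -
      have "([:0, 1:] :: 'a poly) ^ n = [:0, 1:] ^ i * [:0, 1:] ^ (n - i)" using that by (simp flip: power_add)
      moreover have "[:fps_nth f i * fps_nth g (n - i):] = [:fps_nth f i:] * [:fps_nth g (n - i):]" by simp
      ultimately show ?thesis by (simp only: mult.assoc mult.left_commute)
    qed
    then show "fps_nth (fps_twist (f * g)) n = fps_nth (fps_twist f * fps_twist g) n"
      by (simp only: fps_twist_def fps_mult_nth fps_nth_Abs_fps const_poly_sum sum_distrib_right)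
         (intro sum.cong, auto)
  qed
  have "[:a + b:] = [:a:] + [:b:]" for a b :: 'a by simp
  then show "fps_twist (f + g) = fps_twist f + fps_twist g"
    unfolding fps_twist_def fps_eq_iff fps_nth_Abs_fps fps_add_nth by (metis distrib_right)
qed (auto simp: fps_twist_def fps_eq_iff one_pCons)

lemma fps_embed_twist_const: "fps_embed (fps_const a) = fps_twist (fps_const a)"
  by (auto simp: fps_embed_def fps_twist_def fps_eq_iff)

lemma fps_embed_minus_twist_nth:
  "fps_nth (fps_embed f - fps_twist f) m = [:fps_nth f m:] * (1 - [:0, 1:] ^ m)"
  by (simp add: fps_embed_def fps_twist_def algebra_simps)

text \<open>The series of order at least \<open>q\<close> modulo \<open>\<pi>\<close>. Congruences take the place of the quotient by \<open>\<pi>\<close>,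
  because \<open>\<pi>\<close> will depend on the exponent under consideration.\<close>

definition order_ideal :: "'a::comm_ring_1 \<Rightarrow> nat \<Rightarrow> 'a fps set" where
  "order_ideal \<pi> q = {h. \<forall>m<q. \<pi> dvd fps_nth h m}"

lemma order_ideal_add: "f \<in> order_ideal \<pi> q \<Longrightarrow> g \<in> order_ideal \<pi> q \<Longrightarrow> f + g \<in> order_ideal \<pi> q"
  by (auto simp: order_ideal_def)

lemma order_ideal_uminus: "f \<in> order_ideal \<pi> q \<Longrightarrow> - f \<in> order_ideal \<pi> q"
  by (auto simp: order_ideal_def)

lemma order_ideal_zero: "0 \<in> order_ideal \<pi> q"
  by (auto simp: order_ideal_def)

lemma order_ideal_sum: "(\<And>i. i \<in> A \<Longrightarrow> f i \<in> order_ideal \<pi> q) \<Longrightarrow> sum f A \<in> order_ideal \<pi> q"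
  by (induction A rule: infinite_finite_induct) (auto intro: order_ideal_add order_ideal_zero)

lemma order_ideal_mult:
  assumes "f \<in> order_ideal \<pi> p" "g \<in> order_ideal \<pi> q" shows "f * g \<in> order_ideal \<pi> (p + q)"
  unfolding order_ideal_def
proof (intro CollectI allI impI)
  fix m assume m: "m < p + q"
  have "\<pi> dvd fps_nth f i * fps_nth g (m - i)" if "i \<le> m" for i
    using assms that m by (cases "i < p") (auto simp: order_ideal_def)
  then show "\<pi> dvd fps_nth (f * g) m" unfolding fps_mult_nth by (intro dvd_sum) auto
qed

text \<open>All other terms of the Cauchy product have one factor of too small index.\<close>

lemma order_ideal_mult_leading:
  assumes "f \<in> order_ideal \<pi> p" "g \<in> order_ideal \<pi> q"
  shows "\<pi> dvd fps_nth (f * g) (p + q) - fps_nth f p * fps_nth g q"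
proof -
  have "fps_nth (f * g) (p + q) - fps_nth f p * fps_nth g q =
      (\<Sum>i\<in>{0..p + q} - {p}. fps_nth f i * fps_nth g (p + q - i))"
    unfolding fps_mult_nth by (subst sum.remove[of _ p]) auto
  also have "\<pi> dvd \<dots>"
  proof (rule dvd_sum)
    fix i assume "i \<in> {0..p + q} - {p}"
    then show "\<pi> dvd fps_nth f i * fps_nth g (p + q - i)"
      using assms by (cases "i < p") (auto simp: order_ideal_def)
  qed
  finally show ?thesis .
qed

lemma order_ideal_power:
  assumes "z \<in> order_ideal \<pi> m"
  shows "z ^ k \<in> order_ideal \<pi> (m * k)" "\<pi> dvd fps_nth (z ^ k) (m * k) - fps_nth z m ^ k"
proof -
  show *: "z ^ k \<in> order_ideal \<pi> (m * k)" for k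
    by (induction k) (use order_ideal_mult[OF assms] in \<open>auto simp: order_ideal_def\<close>)
  show "\<pi> dvd fps_nth (z ^ k) (m * k) - fps_nth z m ^ k"
  proof (induction k)
    case (Suc k)
    have "\<pi> dvd (fps_nth (z * z ^ k) (m + m * k) - fps_nth z m * fps_nth (z ^ k) (m * k))
        + fps_nth z m * (fps_nth (z ^ k) (m * k) - fps_nth z m ^ k)"
      by (intro dvd_add dvd_mult Suc order_ideal_mult_leading assms *)
    then show ?case by (simp add: algebra_simps)
  qed simp
qed

text \<open>If \<open>z\<close> has order \<open>m < c\<close> modulo \<open>\<pi>\<close>, each term \<open>a\<^sub>i z\<^sup>n\<^sup>-\<^sup>i\<close> has order at least \<open>c i + m (n - i) > m n\<close>, so
  only \<open>z\<^sup>n\<close> contributes to the coefficient of index \<open>m n\<close>.\<close>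

lemma integral_leading_coeff:
  assumes eq: "z ^ n + (\<Sum>i\<in>{1..n}. a i * z ^ (n - i)) = 0"
    and a: "\<And>i. i \<in> {1..n} \<Longrightarrow> a i \<in> order_ideal \<pi> (c * i)"
    and z: "z \<in> order_ideal \<pi> m" and m: "m < c"
  shows "\<pi> dvd fps_nth z m ^ n"
proof -
  have "a i * z ^ (n - i) \<in> order_ideal \<pi> (Suc (m * n))" if i: "i \<in> {1..n}" for i
  proof -
    have "m * i < c * i" using m i by simp
    moreover have "m * n = m * i + m * (n - i)" using i by (simp flip: distrib_left)
    ultimately have "Suc (m * n) \<le> c * i + m * (n - i)" by linarith
    moreover have "a i * z ^ (n - i) \<in> order_ideal \<pi> (c * i + m * (n - i))"
      by (rule order_ideal_mult[OF a[OF i] order_ideal_power(1)[OF z]])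
    ultimately show ?thesis by (auto simp: order_ideal_def)
  qed
  then have "(\<Sum>i\<in>{1..n}. a i * z ^ (n - i)) \<in> order_ideal \<pi> (Suc (m * n))" by (rule order_ideal_sum)
  moreover have "z ^ n = - (\<Sum>i\<in>{1..n}. a i * z ^ (n - i))" using eq by (simp add: eq_neg_iff_add_eq_0)
  ultimately have "z ^ n \<in> order_ideal \<pi> (Suc (m * n))" using order_ideal_uminus by metis
  then have "\<pi> dvd fps_nth (z ^ n) (m * n)" by (simp add: order_ideal_def)
  from dvd_diff[OF this order_ideal_power(2)[OF z, of n]] show ?thesis by simp
qed

text \<open>The coefficient of \<open>f(s) - f(Z s)\<close> of least index not divisible by \<open>\<pi>\<close> would have a power divisible by
  \<open>\<pi>\<close>. This coefficient is \<open>b (1 - Z\<^sup>m)\<close> with \<open>b \<in> R\<close>, so that \<open>b\<^sup>n\<close>, and hence \<open>b\<close>, would vanish.\<close>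

lemma integral_twist_difference:
  fixes f :: "'a::comm_ring_1 fps" and \<pi> :: "'a poly"
  defines "z \<equiv> fps_embed f - fps_twist f"
  assumes reduced: "\<And>a::'a. a ^ n = 0 \<Longrightarrow> a = 0"
    and eq: "z ^ n + (\<Sum>i\<in>{1..n}. a i * z ^ (n - i)) = 0"
    and a: "\<And>i. i \<in> {1..n} \<Longrightarrow> a i \<in> order_ideal \<pi> (c * i)"
    and \<pi>: "\<And>m b. \<not> \<pi> dvd 1 - [:0, 1:] ^ m \<Longrightarrow> \<pi> dvd [:b:] * (1 - [:0, 1:] ^ m) ^ n \<Longrightarrow> b = 0"
  shows "z \<in> order_ideal \<pi> c"
proof -
  have "\<pi> dvd fps_nth z m" if "m < c" for m
    using that
  proof (induction m rule: less_induct)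
    case (less m)
    then have zm: "z \<in> order_ideal \<pi> m" by (simp add: order_ideal_def)
    have nth: "fps_nth z m = [:fps_nth f m:] * (1 - [:0, 1:] ^ m)"
      unfolding z_def by (rule fps_embed_minus_twist_nth)
    show ?case
    proof (cases "\<pi> dvd 1 - [:0, 1:] ^ m")
      case False
      have "[:fps_nth f m:] ^ n = [:fps_nth f m ^ n:]" by (induction n) (simp_all add: one_pCons)
      then have "\<pi> dvd [:fps_nth f m ^ n:] * (1 - [:0, 1:] ^ m) ^ n"
        using integral_leading_coeff[OF eq a zm less.prems] by (simp only: nth power_mult_distrib)
      then have "fps_nth f m = 0" using reduced \<pi>[OF False] by blast
      then show ?thesis by (simp add: nth)
    qed (simp only: nth dvd_mult)
  qed
  then show ?thesis by (simp add: order_ideal_def)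
qed

section \<open>The tensor square of an algebra\<close>

lemma (in cring) minus_sum_sum:
  assumes "p \<in> carrier R" "p' \<in> carrier R" "q \<in> carrier R" "q' \<in> carrier R"
  shows "(p \<oplus> p') \<ominus> (q \<oplus> q') = (p \<ominus> q) \<oplus> (p' \<ominus> q')"
  using assms by algebra

lemma (in cring) r_distr_minus:
  assumes "s \<in> carrier R" "p \<in> carrier R" "q \<in> carrier R"
  shows "s \<otimes> (p \<ominus> q) = s \<otimes> p \<ominus> s \<otimes> q"
  using assms by algebra

text \<open>A tower \<open>R \<rightarrow> A \<rightarrow> B\<close>. The composite \<open>R \<rightarrow> B\<close> has its own name \<open>h\<close>, as
  the tensor square over \<open>R\<close> depends on this map alone.\<close>

locale algebra_tower = A: cring A + B: cring B for A :: "('a, 'k) ring_scheme" and B :: "('b, 'm) ring_scheme" (structure) +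
  fixes R :: "('r, 'l) ring_scheme" and f :: "'r \<Rightarrow> 'a" and g :: "'a \<Rightarrow> 'b"
    and h :: "'r \<Rightarrow> 'b"
  assumes h_eq: "h = g \<circ> f" and f_map: "f \<in> carrier R \<rightarrow> carrier A" and g_map: "g \<in> carrier A \<rightarrow> carrier B"
begin

abbreviation "M \<equiv> integral_monoid_ring (B \<times>\<times> B)"
abbreviation "S \<equiv> tensor_ring R h B h B"
abbreviation "J \<equiv> tensor_ideal R h B h B"
abbreviation "JA \<equiv> tensor_ideal A g B g B"
abbreviation pt :: "'b \<Rightarrow> 'b \<Rightarrow> (('b \<times> 'b) \<Rightarrow>\<^sub>0 int) set" where "pt \<equiv> pure_tensor R h B h B"
abbreviation "K \<equiv> a_kernel S (tensor_ring A g B g B) (tensor_base_change A g B)"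
abbreviation \<Delta> :: "'b \<Rightarrow> (('b \<times> 'b) \<Rightarrow>\<^sub>0 int) set" where "\<Delta> \<equiv> lipschitz_diff R f g B"

lemma h_map: "h \<in> carrier R \<rightarrow> carrier B" using f_map g_map h_eq by auto

lemma g_closed: "a \<in> carrier A \<Longrightarrow> g a \<in> carrier B" using g_map by blast

lemma h_closed: "r \<in> carrier R \<Longrightarrow> h r \<in> carrier B" using h_map by auto

sublocale M: cring M
proof -
  have "comm_monoid (B \<times>\<times> B)" by (rule comm_monoidI) (auto simp: B.m_ac)
  then show "cring M" by (rule integral_monoid_ring_cring)
qed

sublocale S: cring S by (rule cring_tensor(1)[OF B.is_cring B.is_cring h_map h_map])
sublocale SA: cring "tensor_ring A g B g B" by (rule cring_tensor(1)[OF B.is_cring B.is_cring g_map g_map])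
sublocale J: ideal J M by (rule cring_tensor(2)[OF B.is_cring B.is_cring h_map h_map])
sublocale JA: ideal JA M by (rule cring_tensor(2)[OF B.is_cring B.is_cring g_map g_map])

lemma M_carrier: "p \<in> carrier M \<longleftrightarrow> Poly_Mapping.keys p \<subseteq> carrier B \<times> carrier B"
  by (simp add: integral_monoid_ring_def)

lemma M_of: "frag_of (b, c) \<in> carrier M \<longleftrightarrow> b \<in> carrier B \<and> c \<in> carrier B"
  by (simp add: M_carrier keys_frag_of)

lemma M_add: "p \<oplus>\<^bsub>M\<^esub> q = p + q" and M_one: "\<one>\<^bsub>M\<^esub> = frag_of (\<one>, \<one>)"
  by (simp_all add: integral_monoid_ring_def)

lemma M_mult_of: "frag_of (b, c) \<otimes>\<^bsub>M\<^esub> frag_of (b', c') = frag_of (b \<otimes> b', c \<otimes> c')"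
  by (simp add: integral_monoid_ring_def)

lemma S_carrier: "T \<in> carrier S \<longleftrightarrow> (\<exists>p\<in>carrier M. T = J +>\<^bsub>M\<^esub> p)"
  by (auto simp: tensor_ring_def FactRing_def A_RCOSETS_def')

lemma S_add: "p \<in> carrier M \<Longrightarrow> q \<in> carrier M \<Longrightarrow>
    (J +>\<^bsub>M\<^esub> p) \<oplus>\<^bsub>S\<^esub> (J +>\<^bsub>M\<^esub> q) = J +>\<^bsub>M\<^esub> (p + q)"
  by (simp add: tensor_ring_def FactRing_def J.a_rcos_sum M_add)

lemma S_mult: "p \<in> carrier M \<Longrightarrow> q \<in> carrier M \<Longrightarrow>
    (J +>\<^bsub>M\<^esub> p) \<otimes>\<^bsub>S\<^esub> (J +>\<^bsub>M\<^esub> q) = J +>\<^bsub>M\<^esub> (p \<otimes>\<^bsub>M\<^esub> q)"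
  by (simp add: tensor_ring_def FactRing_def J.rcoset_mult_add)

end

lemma coset_mem_iff:
  "p \<in> I +>\<^bsub>integral_monoid_ring G\<^esub> q \<longleftrightarrow> (\<exists>j\<in>I. p = j + q)"
  by (auto simp: a_r_coset_def r_coset_def integral_monoid_ring_def)

context algebra_tower begin

lemma coset_eqI:
  assumes L: "ideal L M" and "p \<in> carrier M" "q \<in> carrier M" "p - q \<in> L"
  shows "L +>\<^bsub>M\<^esub> p = L +>\<^bsub>M\<^esub> q"
proof -
  interpret L: ideal L M by (rule L)
  have "p = (p - q) + q" by simp
  then have "p \<in> L +>\<^bsub>M\<^esub> q" using assms(4) coset_mem_iff by metis
  then show ?thesis using M.a_repr_independence[OF _ assms(3) L.a_subgroup] by simp
qed

lemma tensor_relation_mem: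
  assumes "s \<in> carrier C \<rightarrow> carrier B" and "p \<in> tensor_relations C s B s B"
  shows "p \<in> tensor_ideal C s B s B"
  using M.genideal_self[OF tensor_relations_subset[OF B.is_cring B.is_cring assms(1,1)]] assms(2)
  unfolding tensor_ideal_def by blast

lemma pure_tensor_balanced:
  assumes s: "s \<in> carrier C \<rightarrow> carrier B" and a: "a \<in> carrier C"
  shows "pure_tensor C s B s B (s a) \<one> = pure_tensor C s B s B \<one> (s a)"
proof -
  have c: "s a \<in> carrier B" using s a by blast
  have "frag_of (s a \<otimes> \<one>, \<one>) - frag_of (\<one>, s a \<otimes> \<one>) \<in> tensor_relations C s B s B"
    unfolding tensor_relations_def using a by blast
  then have "frag_of (s a, \<one>) - frag_of (\<one>, s a) \<in> tensor_ideal C s B s B"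
    using c tensor_relation_mem[OF s] by fastforce
  then show ?thesis unfolding pure_tensor_def using c
    by (intro coset_eqI cring_tensor(2)[OF B.is_cring B.is_cring s s]) (auto simp: M_of)
qed

lemma pt_closed[simp]: "b \<in> carrier B \<Longrightarrow> c \<in> carrier B \<Longrightarrow> pt b c \<in> carrier S"
  unfolding S_carrier pure_tensor_def using M_of by blast

lemma pt_mult:
  assumes "b \<in> carrier B" "c \<in> carrier B" "b' \<in> carrier B" "c' \<in> carrier B"
  shows "pt b c \<otimes>\<^bsub>S\<^esub> pt b' c' = pt (b \<otimes> b') (c \<otimes> c')"
  unfolding pure_tensor_def using assms by (simp add: S_mult M_of M_mult_of)

lemma pt_one: "pt \<one> \<one> = \<one>\<^bsub>S\<^esub>"
  by (simp add: pure_tensor_def tensor_ring_def FactRing_def M_one)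

lemma M_plus_closed: "p \<in> carrier M \<Longrightarrow> q \<in> carrier M \<Longrightarrow> p + q \<in> carrier M"
  using M.a_closed by (simp add: M_add)

lemma pt_add_left:
  assumes "b \<in> carrier B" "c \<in> carrier B" "b' \<in> carrier B"
  shows "pt (b \<oplus> b') c = pt b c \<oplus>\<^bsub>S\<^esub> pt b' c"
proof -
  have "frag_of (b \<oplus> b', c) - (frag_of (b, c) + frag_of (b', c)) \<in> J"
    using assms by (intro tensor_relation_mem[OF h_map]) (auto simp: tensor_relations_def diff_diff_add)
  then show ?thesis unfolding pure_tensor_def using assms
    by (simp add: S_add M_of coset_eqI[OF J.is_ideal] M_plus_closed)
qed

lemma pt_add_right:
  assumes "b \<in> carrier B" "c \<in> carrier B" "c' \<in> carrier B"
  shows "pt b (c \<oplus> c') = pt b c \<oplus>\<^bsub>S\<^esub> pt b c'"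
proof -
  have "frag_of (b, c \<oplus> c') - (frag_of (b, c) + frag_of (b, c')) \<in> J"
    using assms by (intro tensor_relation_mem[OF h_map]) (auto simp: tensor_relations_def diff_diff_add)
  then show ?thesis unfolding pure_tensor_def using assms
    by (simp add: S_add M_of coset_eqI[OF J.is_ideal] M_plus_closed)
qed

lemma base_change_hom: "ring_hom_cring S (tensor_ring A g B g B) (tensor_base_change A g B)"
  using tensor_base_change_hom(2)[OF A.is_cring B.is_cring f_map g_map, folded h_eq]
  by unfold_locales (simp add: ring_hom_def)

sublocale \<phi>: ring_hom_cring S "tensor_ring A g B g B" "tensor_base_change A g B"
  by (rule base_change_hom)

lemma K_ideal: "ideal K S" by (rule \<phi>.ring.kernel_is_ideal)

lemma diff_eq: "\<Delta> b = pt b \<one> \<ominus>\<^bsub>S\<^esub> pt \<one> b" by (simp only: lipschitz_diff_def h_eq)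

lemma diff_closed: "b \<in> carrier B \<Longrightarrow> \<Delta> b \<in> carrier S" by (simp add: diff_eq)

text \<open>In \<open>B \<otimes>\<^sub>A B\<close> the two images of an element of \<open>A\<close> agree.\<close>

lemma diff_mem_kernel:
  assumes "a \<in> carrier A" shows "\<Delta> (g a) \<in> K"
proof -
  have c: "g a \<in> carrier B" by (rule g_closed[OF assms])
  have pure: "tensor_base_change A g B (pt b b') = pure_tensor A g B g B b b'"
    if "b \<in> carrier B" "b' \<in> carrier B" for b b'
    by (rule tensor_base_change_pure_tensor[OF A.is_cring B.is_cring f_map g_map that, folded h_eq])
  have eq: "tensor_base_change A g B (pt (g a) \<one>) = tensor_base_change A g B (pt \<one> (g a))"
    unfolding pure[OF c B.one_closed] pure[OF B.one_closed c] by (rule pure_tensor_balanced[OF g_map assms])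
  have "tensor_base_change A g B (\<Delta> (g a)) =
      tensor_base_change A g B (pt (g a) \<one>) \<oplus>\<^bsub>tensor_ring A g B g B\<^esub>
      \<ominus>\<^bsub>tensor_ring A g B g B\<^esub> tensor_base_change A g B (pt \<one> (g a))"
    unfolding diff_eq S.minus_eq using c
    by (subst \<phi>.hom_add) (simp_all only: pt_closed S.a_inv_closed B.one_closed \<phi>.hom_a_inv)
  also have "\<dots> = \<zero>\<^bsub>tensor_ring A g B g B\<^esub>"
    unfolding eq by (rule SA.r_neg[OF \<phi>.hom_closed[OF pt_closed[OF B.one_closed c]]])
  finally show ?thesis unfolding a_kernel_def' using diff_closed[OF c] by blast
qed

lemma diff_add: "b \<in> carrier B \<Longrightarrow> b' \<in> carrier B \<Longrightarrow> \<Delta> (b \<oplus> b') = \<Delta> b \<oplus>\<^bsub>S\<^esub> \<Delta> b'"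
proof -
  assume b: "b \<in> carrier B" "b' \<in> carrier B"
  show ?thesis unfolding diff_eq pt_add_left[OF b(1) B.one_closed b(2)] pt_add_right[OF B.one_closed b]
    by (rule S.minus_sum_sum) (use b in \<open>simp_all only: pt_closed B.one_closed\<close>)
qed

lemma pt_power: "b \<in> carrier B \<Longrightarrow> c \<in> carrier B \<Longrightarrow> pt (b [^] n) (c [^] n) = pt b c [^]\<^bsub>S\<^esub> (n::nat)"
proof (induction n)
  case 0
  show ?case by (simp only: B.nat_pow_0 S.nat_pow_0 pt_one)
next
  case (Suc n)
  then show ?case
    by (simp only: B.nat_pow_Suc S.nat_pow_Suc pt_mult[OF B.nat_pow_closed B.nat_pow_closed, symmetric])
qed

lemma diff_power:
  assumes "t \<in> carrier B" shows "\<Delta> (t [^] l) = pt t \<one> [^]\<^bsub>S\<^esub> l \<ominus>\<^bsub>S\<^esub> pt \<one> t [^]\<^bsub>S\<^esub> (l::nat)"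
  using pt_power[OF assms B.one_closed, of l] pt_power[OF B.one_closed assms, of l]
  by (simp only: diff_eq B.nat_pow_one)

text \<open>Scalars from \<open>R\<close> may be moved across the tensor sign.\<close>

lemma diff_scale:
  assumes r: "r \<in> carrier R" and b: "b \<in> carrier B"
  shows "\<Delta> (h r \<otimes> b) = pt (h r) \<one> \<otimes>\<^bsub>S\<^esub> \<Delta> b"
proof -
  have c: "h r \<in> carrier B" by (rule h_closed[OF r])
  have "pt (h r \<otimes> b) \<one> = pt (h r) \<one> \<otimes>\<^bsub>S\<^esub> pt b \<one>" using b c by (simp add: pt_mult)
  moreover have "pt \<one> (h r \<otimes> b) = pt (h r) \<one> \<otimes>\<^bsub>S\<^esub> pt \<one> b"
    using b c by (simp add: pt_mult pure_tensor_balanced[OF h_map r])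
  moreover have "pt (h r) \<one> \<in> carrier S" "pt b \<one> \<in> carrier S" "pt \<one> b \<in> carrier S" using b c by simp_all
  ultimately show ?thesis by (simp only: diff_eq S.r_distr_minus)
qed

end

locale algebra_tower_element = algebra_tower +
  fixes t assumes t_closed: "t \<in> carrier B"
begin

sublocale pair: ideal_and_pair S K "pt t \<one>\<^bsub>B\<^esub>" "pt \<one>\<^bsub>B\<^esub> t"
  by (intro ideal_and_pair.intro ideal_and_pair_axioms.intro S.is_cring K_ideal) (use t_closed in auto)

lemma lipschitz_saturation_if_controlled:
  "b \<in> carrier B \<Longrightarrow> pair.controlled (\<Delta> b) \<Longrightarrow> b \<in> lipschitz_saturation R f A g B"
  unfolding lipschitz_saturation_def h_eq[symmetric] by (intro CollectI conjI pair.integral_closure_if_controlled)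

text \<open>The exponents in \<open>T\<close> play the role of the generators \<open>\<gamma> 1, \<dots>, \<gamma> j\<close>, with \<open>D = \<gamma> j\<close>.\<close>

lemma controlled_scaled_power:
  fixes l D :: nat
  assumes T: "finite T" "T \<noteq> {}" "\<And>s. s \<in> T \<Longrightarrow> s \<le> D \<and> t [^]\<^bsub>B\<^esub> s \<in> g ` carrier A"
    and l: "D \<le> l" "Gcd T dvd l" "0 < l" and r: "r \<in> carrier R"
  shows "pair.controlled (\<Delta> (h r \<otimes>\<^bsub>B\<^esub> t [^]\<^bsub>B\<^esub> l))"
proof -
  have K: "s \<le> D \<and> pt t \<one>\<^bsub>B\<^esub> [^]\<^bsub>S\<^esub> s \<ominus>\<^bsub>S\<^esub> pt \<one>\<^bsub>B\<^esub> t [^]\<^bsub>S\<^esub> s \<in> K" if "s \<in> T" for s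
  proof -
    from T(3)[OF that] obtain a where a: "s \<le> D" "a \<in> carrier A" "t [^]\<^bsub>B\<^esub> s = g a" by blast
    show ?thesis using diff_mem_kernel[OF a(2)] a(1) by (simp only: diff_power[OF t_closed] simp_thms flip: a(3))
  qed
  have "pt (h r) \<one>\<^bsub>B\<^esub> \<in> carrier S" by (rule pt_closed[OF h_closed[OF r] B.one_closed])
  from pair.controlled_power_diff[OF T(1,2) K l this]
  have "pair.controlled (pt (h r) \<one>\<^bsub>B\<^esub> \<otimes>\<^bsub>S\<^esub>
      (pt t \<one>\<^bsub>B\<^esub> [^]\<^bsub>S\<^esub> l \<ominus>\<^bsub>S\<^esub> pt \<one>\<^bsub>B\<^esub> t [^]\<^bsub>S\<^esub> l))" .
  then show ?thesis by (simp only: diff_scale[OF r B.nat_pow_closed[OF t_closed]] diff_power[OF t_closed])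
qed

end

section \<open>Evaluating the tensor square\<close>

abbreviation (input) type_ring :: "'a::comm_ring_1 ring" where "type_ring \<equiv> ring_of_type_algebra"

lemma type_ring_simps:
  "carrier type_ring = UNIV" "x \<oplus>\<^bsub>type_ring\<^esub> y = x + y" "x \<otimes>\<^bsub>type_ring\<^esub> y = x * y"
  "\<zero>\<^bsub>type_ring\<^esub> = 0" "\<one>\<^bsub>type_ring\<^esub> = 1"
  by (simp_all add: ring_of_type_algebra_def)

interpretation type_ring: cring type_ring by (rule cring_from_type_algebra)

lemma type_ring_pow: "x [^]\<^bsub>type_ring\<^esub> (n::nat) = x ^ n"
  by (induction n) (simp_all add: type_ring_simps mult.commute)

lemma type_ring_neg: "\<ominus>\<^bsub>type_ring\<^esub> x = - x"
  by (rule type_ring.minus_equality) (simp_all add: type_ring_simps)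

lemma type_ring_minus: "x \<ominus>\<^bsub>type_ring\<^esub> y = x - y"
  by (simp add: a_minus_def type_ring_neg type_ring_simps)

lemma type_ring_finsum: "(\<Oplus>\<^bsub>type_ring\<^esub>i\<in>A. h i) = sum h A"
  by (induction A rule: infinite_finite_induct)
    (simp_all add: type_ring_simps type_ring.finsum_infinite)

lemma type_ring_idealI:
  assumes "0 \<in> V" "\<And>a b. a \<in> V \<Longrightarrow> b \<in> V \<Longrightarrow> a + b \<in> V" "\<And>a b. a \<in> V \<Longrightarrow> b * a \<in> V"
  shows "ideal V type_ring"
proof (rule idealI[OF type_ring.ring_axioms])
  have "- a \<in> V" if "a \<in> V" for a using assms(3)[OF that, of "-1"] by simp
  then show "subgroup V (add_monoid type_ring)"
    using assms by (intro type_ring.add.subgroupI) (auto simp: type_ring_simps type_ring_neg simp flip: a_inv_def)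
qed (use assms in \<open>auto simp: type_ring_simps mult.commute\<close>)

text \<open>The additive extension of \<open>(b, c) \<mapsto> p b * q c\<close> to the monoid ring. If \<open>p\<close> and \<open>q\<close> are ring
  homomorphisms, so is this map, and it factors through every tensor product over a ring on which \<open>p\<close> and
  \<open>q\<close> agree.\<close>

definition tensor_eval :: "('b \<Rightarrow> 'c) \<Rightarrow> ('b \<Rightarrow> 'c) \<Rightarrow> (('b \<times> 'b) \<Rightarrow>\<^sub>0 int) \<Rightarrow> 'c::comm_ring_1" where
  "tensor_eval p q P =
     (\<Sum>k\<in>Poly_Mapping.keys P. of_int (Poly_Mapping.lookup P k) * (p (fst k) * q (snd k)))"

lemma tensor_eval_superset:
  assumes "finite F" "Poly_Mapping.keys P \<subseteq> F"
  shows "tensor_eval p q P = (\<Sum>k\<in>F. of_int (Poly_Mapping.lookup P k) * (p (fst k) * q (snd k)))"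
  unfolding tensor_eval_def using assms by (intro sum.mono_neutral_left) (auto simp: in_keys_iff)

lemma tensor_eval_add: "tensor_eval p q (P + Q) = tensor_eval p q P + tensor_eval p q Q"
proof -
  let ?F = "Poly_Mapping.keys P \<union> Poly_Mapping.keys Q"
  have "tensor_eval p q (P + Q) =
      (\<Sum>k\<in>?F. of_int (Poly_Mapping.lookup (P + Q) k) * (p (fst k) * q (snd k)))"
    by (intro tensor_eval_superset keys_add) auto
  also have "\<dots> = tensor_eval p q P + tensor_eval p q Q"
    by (simp add: tensor_eval_superset[of ?F] lookup_add distrib_right sum.distrib)
  finally show ?thesis .
qed

lemma tensor_eval_of[simp]: "tensor_eval p q (frag_of (b, c)) = p b * q c"
  by (simp add: tensor_eval_def)

lemma tensor_eval_zero[simp]: "tensor_eval p q 0 = 0" by (simp add: tensor_eval_def)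

lemma tensor_eval_diff: "tensor_eval p q (P - Q) = tensor_eval p q P - tensor_eval p q Q"
  using tensor_eval_add[of p q "P - Q" Q] by simp

lemma (in integral_element) ipow_Suc: "ipow (Suc i) = ideal_prod R (ipow i) I"
  by (simp add: ideals_set_def)

lemma (in ring_hom_cring) hom_diff:
  assumes "x \<in> carrier R" "y \<in> carrier R" shows "h (x \<ominus> y) = h x \<ominus>\<^bsub>S\<^esub> h y"
  using assms by (simp add: R.minus_eq S.minus_eq)

context algebra_tower begin

lemma tensor_eval_mult:
  assumes p: "p \<in> ring_hom B type_ring" and q: "q \<in> ring_hom B type_ring"
    and P: "P \<in> carrier M" and Q: "Q \<in> carrier M"
  shows "tensor_eval p q (P \<otimes>\<^bsub>M\<^esub> Q) = tensor_eval p q P * tensor_eval p q Q"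
proof -
  have hom: "p (b \<otimes> b') = p b * p b'" "q (b \<otimes> b') = q b * q b'" if "b \<in> carrier B" "b' \<in> carrier B" for b b'
    using ring_hom_mult[OF p that] ring_hom_mult[OF q that] by (simp_all add: type_ring_simps)
  have of: "tensor_eval p q (frag_of k \<otimes>\<^bsub>M\<^esub> Q) = tensor_eval p q (frag_of k) * tensor_eval p q Q"
    if k: "k \<in> carrier B \<times> carrier B" for k
    using Q[unfolded M_carrier]
  proof (induction Q rule: frag_induction)
    case (one k')
    then show ?case using k by (cases k; cases k') (simp add: M_mult_of hom)
  next
    case (diff a b)
    then show ?case
      by (simp add: integral_monoid_ring_def frag_extend_diff tensor_eval_diff right_diff_distrib)
  qed (simp add: integral_monoid_ring_def)
  from P[unfolded M_carrier] show ?thesis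
  proof (induction P rule: frag_induction)
    case (diff a b)
    then show ?case
      by (simp add: integral_monoid_ring_def frag_extend_diff tensor_eval_diff left_diff_distrib)
  qed (simp_all add: of, simp add: integral_monoid_ring_def)
qed

lemma tensor_eval_hom:
  assumes p: "p \<in> ring_hom B type_ring" and q: "q \<in> ring_hom B type_ring"
  shows "tensor_eval p q \<in> ring_hom M type_ring"
  using tensor_eval_mult[OF p q] ring_hom_one[OF p] ring_hom_one[OF q]
  by (intro ring_hom_memI) (simp_all add: type_ring_simps M_add M_one tensor_eval_add)

lemma tensor_eval_ideal:
  assumes p: "p \<in> ring_hom B type_ring" and q: "q \<in> ring_hom B type_ring" and V: "ideal V type_ring"
  shows "ideal {P \<in> carrier M. tensor_eval p q P \<in> V} M"
proof -
  interpret e: ring_hom_ring M type_ring "tensor_eval p q"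
    by (intro ring_hom_ringI2 M.ring_axioms type_ring.ring_axioms tensor_eval_hom p q)
  show ?thesis using e.ideal_vimage[OF V] .
qed

text \<open>Biadditivity relations are mapped to \<open>0\<close>, and a balancing relation to a multiple of
  \<open>p (s r) - q (s r)\<close>. The case \<open>V = 0\<close> makes the evaluation well defined on \<open>B \<otimes>\<^sub>R B\<close>; the case of
  relations over \<open>A\<close> bounds the image of the kernel.\<close>

lemma tensor_eval_relations:
  assumes p: "p \<in> ring_hom B type_ring" and q: "q \<in> ring_hom B type_ring" and V: "ideal V type_ring"
    and s: "s \<in> carrier C \<rightarrow> carrier B" and pq: "\<And>r. r \<in> carrier C \<Longrightarrow> p (s r) - q (s r) \<in> V"
  shows "P \<in> tensor_ideal C s B s B \<Longrightarrow> tensor_eval p q P \<in> V"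
proof -
  interpret V: ideal V type_ring by (rule V)
  have 0: "0 \<in> V" using V.zero_closed by (simp add: type_ring_simps)
  have hom: "p (b \<otimes> b') = p b * p b'" "q (b \<otimes> b') = q b * q b'"
    "p (b \<oplus> b') = p b + p b'" "q (b \<oplus> b') = q b + q b'" if "b \<in> carrier B" "b' \<in> carrier B" for b b'
    using ring_hom_mult[OF p that] ring_hom_mult[OF q that] ring_hom_add[OF p that] ring_hom_add[OF q that]
    by (simp_all add: type_ring_simps)
  have bal: "p (s r) * p b * q c - p b * (q (s r) * q c) \<in> V" if "r \<in> carrier C" for r b c
  proof -
    have "(p b * q c) * (p (s r) - q (s r)) \<in> V"
      using V.I_l_closed[OF pq[OF that], of "p b * q c"] by (simp add: type_ring_simps)
    then show ?thesis by (simp add: algebra_simps)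
  qed
  have "tensor_eval p q P \<in> V" if "P \<in> tensor_relations C s B s B" for P
    using that unfolding tensor_relations_def
  proof (elim UnE CollectE exE conjE)
    fix r b c assume "P = frag_of (s r \<otimes> b, c) - frag_of (b, s r \<otimes> c)" "r \<in> carrier C" "b \<in> carrier B" "c \<in> carrier B"
    then show ?thesis using bal[of r b c] funcset_mem[OF s, of r] by (simp add: tensor_eval_diff hom)
  qed (simp_all add: tensor_eval_diff hom 0 distrib_left distrib_right)
  then have "tensor_relations C s B s B \<subseteq> {P \<in> carrier M. tensor_eval p q P \<in> V}"
    using tensor_relations_subset[OF B.is_cring B.is_cring s s] by blast
  then have "tensor_ideal C s B s B \<subseteq> {P \<in> carrier M. tensor_eval p q P \<in> V}"
    unfolding tensor_ideal_def by (intro M.genideal_minimal tensor_eval_ideal p q V)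
  then show "P \<in> tensor_ideal C s B s B \<Longrightarrow> tensor_eval p q P \<in> V" by blast
qed

text \<open>An element of the kernel is represented by an element of the tensor ideal over \<open>A\<close>, so it suffices to
  control the differences \<open>p - q\<close> on \<open>A\<close>.\<close>

lemma tensor_hom_exists:
  assumes p: "p \<in> ring_hom B type_ring" and q: "q \<in> ring_hom B type_ring"
    and V: "ideal V type_ring" and VA: "\<And>a. a \<in> carrier A \<Longrightarrow> p (g a) - q (g a) \<in> V"
    and eq: "\<And>r. r \<in> carrier R \<Longrightarrow> p (h r) = q (h r)"
  shows "\<exists>\<Psi>\<in>ring_hom S type_ring.
     (\<forall>b\<in>carrier B. \<Psi> (\<Delta> b) = p b - q b) \<and> (\<forall>k\<in>K. \<Psi> k \<in> V)"
proof -
  define \<Psi> where "\<Psi> Q1 = the_elem (tensor_eval p q ` Q1)" for Q1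
  have zero: "ideal {0} type_ring" by (rule type_ring_idealI) auto
  have J0: "tensor_eval p q j = 0" if "j \<in> J" for j
    using tensor_eval_relations[OF p q zero h_map _ that] eq by simp
  have \<Psi>: "\<Psi> (J +>\<^bsub>M\<^esub> P) = tensor_eval p q P" if "P \<in> carrier M" for P
  proof -
    have "tensor_eval p q ` (J +>\<^bsub>M\<^esub> P) = {tensor_eval p q P}"
      using J.a_rcos_self[OF that] by (auto simp: coset_mem_iff tensor_eval_add J0)
    then show ?thesis by (simp add: \<Psi>_def)
  qed
  have pure: "\<Psi> (pt b c) = p b * q c" if "b \<in> carrier B" "c \<in> carrier B" for b c
    unfolding pure_tensor_def using that by (simp add: \<Psi> M_of)
  have hom: "\<Psi> \<in> ring_hom S type_ring"
  proof (rule ring_hom_memI)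
    fix Q1 Q2 assume "Q1 \<in> carrier S" "Q2 \<in> carrier S"
    then obtain P Q where P: "P \<in> carrier M" "Q1 = J +>\<^bsub>M\<^esub> P" and Q: "Q \<in> carrier M" "Q2 = J +>\<^bsub>M\<^esub> Q"
      unfolding S_carrier by blast
    show "\<Psi> (Q1 \<otimes>\<^bsub>S\<^esub> Q2) = \<Psi> Q1 \<otimes>\<^bsub>type_ring\<^esub> \<Psi> Q2"
      unfolding P(2) Q(2) S_mult[OF P(1) Q(1)] using P(1) Q(1)
      by (simp add: \<Psi> tensor_eval_mult[OF p q] type_ring_simps)
    show "\<Psi> (Q1 \<oplus>\<^bsub>S\<^esub> Q2) = \<Psi> Q1 \<oplus>\<^bsub>type_ring\<^esub> \<Psi> Q2"
      unfolding P(2) Q(2) S_add[OF P(1) Q(1)] using P(1) Q(1)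
      by (simp add: \<Psi> tensor_eval_add type_ring_simps M_plus_closed)
  next
    show "\<Psi> \<one>\<^bsub>S\<^esub> = \<one>\<^bsub>type_ring\<^esub>"
      unfolding pt_one[symmetric] pure[OF B.one_closed B.one_closed]
      using ring_hom_one[OF p] ring_hom_one[OF q] by (simp add: type_ring_simps)
  qed (simp add: type_ring_simps)
  note hom_diff = ring_hom_cring.hom_diff[OF ring_hom_cring.intro[OF S.is_cring type_ring.is_cring
    ring_hom_cring_axioms.intro[OF hom]]]
  have "\<Psi> (\<Delta> b) = p b - q b" if b: "b \<in> carrier B" for b
  proof -
    have one: "p \<one> = 1" "q \<one> = 1"
      using ring_hom_one[OF p] ring_hom_one[OF q] by (simp_all only: type_ring_simps)
    have "\<Psi> (\<Delta> b) = \<Psi> (pt b \<one>) - \<Psi> (pt \<one> b)"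
      unfolding diff_eq type_ring_minus[symmetric]
      by (rule hom_diff) (rule pt_closed[OF b B.one_closed] pt_closed[OF B.one_closed b])+
    also have "\<dots> = p b - q b"
      by (simp only: pure[OF b B.one_closed] pure[OF B.one_closed b] one mult_1_left mult_1_right)
    finally show ?thesis .
  qed
  moreover have "\<Psi> k \<in> V" if k: "k \<in> K" for k
  proof -
    from k have "k \<in> carrier S" and k0: "tensor_base_change A g B k = \<zero>\<^bsub>tensor_ring A g B g B\<^esub>"
      unfolding a_kernel_def' by blast+
    then obtain P where P: "P \<in> carrier M" "k = J +>\<^bsub>M\<^esub> P" unfolding S_carrier by blast
    have "JA +>\<^bsub>M\<^esub> P = JA"
      using k0 tensor_base_change_hom(1)[OF A.is_cring B.is_cring f_map g_map P(1), folded h_eq]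
      by (simp add: P(2) tensor_ring_def FactRing_def)
    then have "P \<in> JA" using JA.a_rcos_self[OF P(1)] by simp
    then show ?thesis using tensor_eval_relations[OF p q V g_map VA] by (simp add: P \<Psi>)
  qed
  ultimately show ?thesis using hom by blast
qed

end

text \<open>A multiplicative filtration \<open>W\<close> whose first step contains the image of \<open>I\<close> contains the images of the
  powers of \<open>I\<close> in its higher steps. The intended \<open>W i\<close> is the set of series of order at least \<open>c i\<close> modulo \<open>\<pi>\<close>.\<close>

lemma (in integral_element) integral_equation_image:
  assumes \<Psi>: "\<Psi> \<in> ring_hom R type_ring" and z: "z \<in> integral_closure R I"
    and W: "W 0 = UNIV" "\<And>i j a c. a \<in> W i \<Longrightarrow> c \<in> W j \<Longrightarrow> a * c \<in> W (i + j)"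
      "\<And>i a c. a \<in> W i \<Longrightarrow> c \<in> W i \<Longrightarrow> a + c \<in> W i"
    and I: "\<And>k. k \<in> I \<Longrightarrow> \<Psi> k \<in> W 1"
  shows "\<exists>n>0. \<exists>a. (\<forall>i\<in>{1..n}. a i \<in> W i) \<and>
      \<Psi> z ^ n + (\<Sum>i\<in>{1..n}. a i * \<Psi> z ^ (n - i)) = 0"
proof -
  interpret \<Psi>: ring_hom_cring R type_ring \<Psi> by unfold_locales (rule \<Psi>)
  have pow: "\<Psi> a \<in> W i" if "a \<in> ipow i" for a i
    using that
  proof (induction i arbitrary: a)
    case 0
    then show ?case by (simp add: W)
  next
    case (Suc i)
    from Suc.prems have "a \<in> ideal_prod R (ipow i) I" by (simp only: ipow_Suc)
    then show ?case
    proof (induction rule: ideal_prod.induct)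
      case (prod a k)
      then have "a \<in> carrier R" "k \<in> carrier R" using ipow_carr I.Icarr by blast+
      then show ?case using W(2)[OF Suc.IH[OF prod(1)] I[OF prod(2)]] by (simp add: type_ring_simps)
    next
      case (sum s s')
      have "s \<in> carrier R" "s' \<in> carrier R"
        using sum ideal_prod_in_carrier[OF ipow_ideal[of i] I.is_ideal] by blast+
      then show ?case using W(3)[OF sum(3,4)] by (simp add: type_ring_simps)
    qed
  qed
  from z obtain n a where n: "n > 0" and a: "\<forall>i\<in>{1..n}. a i \<in> ipow i"
    and eq: "z [^] n \<oplus> (\<Oplus>i\<in>{1..n}. a i \<otimes> z [^] (n - i)) = \<zero>"
    unfolding integral_closure_def by blast
  have ac: "a i \<in> carrier R" if "i \<in> {1..n}" for i using a that ipow_carr by blast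
  have terms: "(\<lambda>i. a i \<otimes> z [^] (n - i)) \<in> {1..n} \<rightarrow> carrier R" using ac z_closed by simp
  have "0 = \<Psi> (z [^] n \<oplus> (\<Oplus>i\<in>{1..n}. a i \<otimes> z [^] (n - i)))"
    unfolding eq by (simp only: \<Psi>.hom_zero type_ring_simps)
  also have "\<dots> = \<Psi> (z [^] n) + \<Psi> (\<Oplus>i\<in>{1..n}. a i \<otimes> z [^] (n - i))"
    by (simp only: \<Psi>.hom_add[OF nat_pow_closed[OF z_closed] finsum_closed[OF terms]] type_ring_simps)
  also have "\<Psi> (\<Oplus>i\<in>{1..n}. a i \<otimes> z [^] (n - i)) = (\<Sum>i\<in>{1..n}. \<Psi> (a i \<otimes> z [^] (n - i)))"
    by (simp only: \<Psi>.hom_finsum[OF terms] type_ring_finsum o_def)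
  also have "\<dots> = (\<Sum>i\<in>{1..n}. \<Psi> (a i) * \<Psi> z ^ (n - i))"
    using ac z_closed by (intro sum.cong refl) (simp add: type_ring_simps type_ring_pow)
  also have "\<Psi> (z [^] n) = \<Psi> z ^ n" using z_closed by (simp add: type_ring_pow)
  finally have "\<Psi> z ^ n + (\<Sum>i\<in>{1..n}. \<Psi> (a i) * \<Psi> z ^ (n - i)) = 0" by (rule sym)
  moreover have "\<forall>i\<in>{1..n}. \<Psi> (a i) \<in> W i" using a pow by blast
  ultimately show ?thesis using n by (intro exI[of _ n] conjI exI[of _ "\<lambda>i. \<Psi> (a i)"])
qed

section \<open>Zero divisors in nice rings\<close>

text \<open>In a noetherian ring the union of a chain of ideals belongs to the chain, so Zorn's lemma applies.\<close>

lemma (in noetherian_ring) exists_maximal_ideal_above: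
  assumes "ideal I R" "I \<noteq> carrier R"
  shows "\<exists>P. maximalideal P R \<and> I \<subseteq> P"
proof -
  define \<A> where "\<A> = {L. ideal L R \<and> I \<subseteq> L \<and> \<one> \<notin> L}"
  have "I \<in> \<A>" using assms ideal.one_imp_carrier by (auto simp: \<A>_def)
  have "\<exists>P\<in>\<A>. \<forall>L\<in>\<A>. P \<subseteq> L \<longrightarrow> L = P"
  proof (rule subset_Zorn_nonempty)
    fix C assume C: "C \<noteq> {}" "subset.chain \<A> C"
    then have "subset.chain {L. ideal L R} C" by (auto simp: subset.chain_def \<A>_def)
    then have "\<Union>C \<in> C" by (rule ideal_chain_is_trivial[OF C(1)])
    then show "\<Union>C \<in> \<A>" using C(2) by (auto simp: subset.chain_def)
  qed (use \<open>I \<in> \<A>\<close> in blast)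
  then obtain P where P: "P \<in> \<A>" and max: "\<And>L. L \<in> \<A> \<Longrightarrow> P \<subseteq> L \<Longrightarrow> L = P" by blast
  have "maximalideal P R"
  proof (rule maximalidealI)
    show "ideal P R" "carrier R \<noteq> P" using P by (auto simp: \<A>_def)
    fix L assume L: "ideal L R" "P \<subseteq> L" "L \<subseteq> carrier R"
    then show "L = P \<or> L = carrier R"
      using max[of L] P ideal.one_imp_carrier[OF L(1)] by (auto simp: \<A>_def)
  qed
  then show ?thesis using P by (auto simp: \<A>_def)
qed

lemma (in ideal) quotient_add_pow_one: "[(n::nat)] \<cdot>\<^bsub>R Quot I\<^esub> \<one>\<^bsub>R Quot I\<^esub> = I +>\<^bsub>R\<^esub> ([n] \<cdot>\<^bsub>R\<^esub> \<one>\<^bsub>R\<^esub>)"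
proof (induction n)
  case 0
  show ?case
    using a_coset_add_zero[OF a_subset] by (simp add: FactRing_def add_pow_def)
next
  case (Suc n)
  moreover have "\<one>\<^bsub>R\<^esub> [^]\<^bsub>add_monoid R\<^esub> n \<in> carrier R"
    using add.nat_pow_closed[OF one_closed, of n] by (simp add: add_pow_def)
  ultimately show ?case by (simp add: FactRing_def add_pow_def a_rcos_sum)
qed

lemma type_ring_add_pow_one: "[(n::nat)] \<cdot>\<^bsub>type_ring\<^esub> \<one>\<^bsub>type_ring\<^esub> = of_nat n"
  by (induction n) (auto simp: add_pow_def ring_of_type_algebra_def nat_pow_def add.commute)

text \<open>If \<open>g a = 0\<close> with \<open>a \<noteq> 0\<close>, then \<open>g\<close> lies in the annihilator of \<open>a\<close> and thus in some maximal ideal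
  \<open>P\<close>, so the characteristic of \<open>R / P\<close> divides \<open>g\<close>.\<close>

lemma nice_ring_imp_not_zero_divisor:
  fixes a :: "'a::comm_ring_1"
  assumes noeth: "noetherian_ring (type_ring :: 'a ring)" and nice: "nice_ring g (type_ring :: 'a ring)"
    and a: "of_nat g * a = 0"
  shows "a = 0"
  using nice unfolding nice_ring_def
proof (elim disjE conjE)
  assume "domain (type_ring :: 'a ring)" "\<not> ring_char (type_ring :: 'a ring) dvd g"
  then have "of_nat g \<noteq> (0::'a)"
    by (simp add: ring_char_ring_of_type_algebra of_nat_eq_0_iff_char_dvd)
  then show "a = 0"
    using domain.integral_iff[OF \<open>domain type_ring\<close>, of "of_nat g" a] a by (simp add: type_ring_simps)
next
  assume char: "\<forall>P. primeideal P (type_ring :: 'a ring) \<longrightarrow> \<not> ring_char (type_ring Quot P) dvd g"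
  interpret noetherian_ring "type_ring :: 'a ring" by (rule noeth)
  show "a = 0"
  proof (rule ccontr)
    assume "a \<noteq> 0"
    have ann: "ideal {b. b * a = 0} type_ring"
      by (rule type_ring_idealI) (auto simp: distrib_right mult.assoc)
    have "1 \<notin> {b. b * a = 0}" using \<open>a \<noteq> 0\<close> by simp
    then have "{b. b * a = 0} \<noteq> carrier type_ring" unfolding type_ring_simps by blast
    then obtain P where P: "maximalideal P type_ring" "{b. b * a = 0} \<subseteq> P"
      using exists_maximal_ideal_above[OF ann] by blast
    then have prime: "primeideal P type_ring" by (intro type_ring.maximalideal_prime)
    interpret P: primeideal P type_ring by (rule prime)
    have "[g] \<cdot>\<^bsub>type_ring Quot P\<^esub> \<one>\<^bsub>type_ring Quot P\<^esub> = P +>\<^bsub>type_ring\<^esub> of_nat g"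
      by (simp only: P.quotient_add_pow_one type_ring_add_pow_one)
    also have "\<dots> = \<zero>\<^bsub>type_ring Quot P\<^esub>"
      using P.a_rcos_const[of "of_nat g"] P(2) a by (auto simp: FactRing_def)
    finally have "ring_char (type_ring Quot P) dvd g"
      unfolding ring_char_def by (intro Gcd_dvd) simp
    with char prime show False by blast
  qed
qed

lemma nice_ring_imp_reduced:
  fixes a :: "'a::comm_ring_1"
  assumes nice: "nice_ring g (type_ring :: 'a ring)" and a: "a ^ n = 0"
  shows "a = 0"
  using nice unfolding nice_ring_def
proof (elim disjE conjE)
  assume d: "domain (type_ring :: 'a ring)"
  show "a = 0" using a
  proof (induction n)
    case (Suc n)
    then show ?case using domain.integral_iff[OF d, of a "a ^ n"] by (auto simp: type_ring_simps)
  qed simp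
next
  assume "reduced_ring (type_ring :: 'a ring)"
  then show "a = 0" using a by (auto simp: reduced_ring_def type_ring_simps type_ring_pow)
qed

section \<open>Gaps of numerical semigroups\<close>

locale numerical_semigroup =
  fixes n :: nat and \<gamma> :: "nat \<Rightarrow> nat" and \<Gamma> :: "nat set"
  assumes n: "n \<ge> 1"
    and gamma_pos: "\<And>i. i \<in> {1..n} \<Longrightarrow> \<gamma> i > 0"
    and gamma_incr: "strict_mono_on {1..n} \<gamma>"
    and gamma_gcd: "Gcd (\<gamma> ` {1..n}) = 1"
    and Gamma: "\<Gamma> = semigroup_gen n \<gamma>"
begin

abbreviation d :: "nat \<Rightarrow> nat" where "d \<equiv> partial_gcd \<gamma>"

text \<open>The exponents that may occur in the saturation. The witness \<open>j\<close> may be replaced by any larger index \<open>j'\<close> with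
  \<open>\<gamma> j' \<le> l\<close>, as \<open>d j'\<close> divides \<open>d j\<close>; hence the choice of the largest possible \<open>j\<close> gives the same set.\<close>

definition saturation_exponents :: "nat set" where
  "saturation_exponents = {0} \<union> {l. \<exists>j\<in>{1..n}. \<gamma> j \<le> l \<and> d j dvd l}"

lemma gamma_le: "i \<in> {1..n} \<Longrightarrow> j \<in> {1..n} \<Longrightarrow> i \<le> j \<Longrightarrow> \<gamma> i \<le> \<gamma> j"
  using strict_mono_on_leD[OF gamma_incr] by blast

lemma d_dvd_d: "i \<le> j \<Longrightarrow> d j dvd d i"
  unfolding partial_gcd_def by (intro Gcd_greatest Gcd_dvd) auto

lemma d_dvd_gamma: "1 \<le> i \<Longrightarrow> i \<le> j \<Longrightarrow> d j dvd \<gamma> i"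
  unfolding partial_gcd_def by (intro Gcd_dvd) auto

lemma Gamma_0: "0 \<in> \<Gamma>"
  unfolding Gamma semigroup_gen_def by (auto intro!: exI[of _ "\<lambda>_. 0"])

lemma Gamma_add: "s \<in> \<Gamma> \<Longrightarrow> s' \<in> \<Gamma> \<Longrightarrow> s + s' \<in> \<Gamma>"
proof -
  assume "s \<in> \<Gamma>" "s' \<in> \<Gamma>"
  then obtain c c' where "s = (\<Sum>i=1..n. c i * \<gamma> i)" "s' = (\<Sum>i=1..n. c' i * \<gamma> i)"
    unfolding Gamma semigroup_gen_def by blast
  then have "s + s' = (\<Sum>i=1..n. (c i + c' i) * \<gamma> i)" by (simp add: sum.distrib distrib_right)
  then show ?thesis unfolding Gamma semigroup_gen_def by (intro CollectI exI[of _ "\<lambda>i. c i + c' i"]) simp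
qed

lemma Gamma_mult: "s \<in> \<Gamma> \<Longrightarrow> k * s \<in> \<Gamma>"
  by (induction k) (auto intro: Gamma_add Gamma_0)

lemma gamma_in_Gamma: "i \<in> {1..n} \<Longrightarrow> \<gamma> i \<in> \<Gamma>"
  unfolding Gamma semigroup_gen_def
  by (intro CollectI exI[of _ "\<lambda>k. if k = i then 1 else 0"])
    (simp add: if_distrib[of "\<lambda>c. c * _"] sum.delta cong: if_cong)

text \<open>A generator larger than \<open>s\<close> cannot contribute to \<open>s\<close>. For \<open>j = n\<close> there is no such generator, and
  for \<open>j = 0\<close> the conclusion reads \<open>s = 0\<close> since \<open>d 0 = 0\<close>.\<close>

lemma d_dvd_Gamma:
  assumes s: "s \<in> \<Gamma>" and j: "j \<le> n" "j < n \<Longrightarrow> s < \<gamma> (Suc j)"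
  shows "d j dvd s"
proof -
  obtain c where c: "s = (\<Sum>i=1..n. c i * \<gamma> i)" using s unfolding Gamma semigroup_gen_def by blast
  have "d j dvd c i * \<gamma> i" if i: "i \<in> {1..n}" for i
  proof (cases "i \<le> j")
    case True
    then show ?thesis using d_dvd_gamma[of i j] i by simp
  next
    case False
    have "c i * \<gamma> i \<le> s" unfolding c using i by (intro member_le_sum) auto
    also have "s < \<gamma> (Suc j)" using j False i by simp
    also have "\<gamma> (Suc j) \<le> \<gamma> i" using False i by (intro gamma_le) auto
    finally show ?thesis by (cases "c i") auto
  qed
  then show ?thesis unfolding c by (intro dvd_sum) auto
qed

lemma last_gamma_le:
  assumes "i \<in> {1..n}" "\<gamma> i \<le> l"
  obtains j where "j \<in> {1..n}" "i \<le> j" "\<gamma> j \<le> l" "\<forall>k\<in>{1..n}. j < k \<longrightarrow> l < \<gamma> k"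
proof -
  define j where "j = Max {j \<in> {1..n}. \<gamma> j \<le> l}"
  have ne: "finite {j \<in> {1..n}. \<gamma> j \<le> l}" "{j \<in> {1..n}. \<gamma> j \<le> l} \<noteq> {}" using assms by auto
  have "j \<in> {j \<in> {1..n}. \<gamma> j \<le> l}" unfolding j_def by (rule Max_in[OF ne])
  moreover have "i \<le> j" unfolding j_def using assms ne by (intro Max_ge) auto
  moreover have less: "l < \<gamma> k" if "k \<in> {1..n}" "j < k" for k
  proof (rule ccontr)
    assume "\<not> l < \<gamma> k"
    then have "k \<le> j" unfolding j_def using that ne by (intro Max_ge) auto
    with that show False by simp
  qed
  ultimately show ?thesis by (intro that[of j]) auto
qed

lemma Gamma_subset: "\<Gamma> \<subseteq> saturation_exponents"
proof
  fix s assume s: "s \<in> \<Gamma>"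
  show "s \<in> saturation_exponents"
  proof (cases "\<gamma> 1 \<le> s")
    case True
    have "1 \<in> {1..n}" using n by simp
    then obtain j where j: "j \<in> {1..n}" "1 \<le> j" "\<gamma> j \<le> s" "\<forall>k\<in>{1..n}. j < k \<longrightarrow> s < \<gamma> k"
      by (rule last_gamma_le[OF _ True])
    then have "d j dvd s" using s by (intro d_dvd_Gamma) (auto dest: bspec[of _ _ "Suc j"])
    then show ?thesis using j by (auto simp: saturation_exponents_def)
  next
    case False
    then have "d 0 dvd s" using s n by (intro d_dvd_Gamma) auto
    then show ?thesis by (simp add: partial_gcd_def saturation_exponents_def)
  qed
qed

lemma saturation_exponents_add:
  assumes "l \<in> saturation_exponents" "l' \<in> saturation_exponents" shows "l + l' \<in> saturation_exponents"
proof (cases "l = 0 \<or> l' = 0")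
  case False
  with assms obtain j j' where j: "j \<in> {1..n}" "\<gamma> j \<le> l" "d j dvd l" "j' \<in> {1..n}" "\<gamma> j' \<le> l'" "d j' dvd l'"
    by (auto simp: saturation_exponents_def)
  have "d (max j j') dvd l" "d (max j j') dvd l'"
    using j d_dvd_d[of j "max j j'"] d_dvd_d[of j' "max j j'"] dvd_trans by fastforce+
  moreover have "\<gamma> (max j j') \<le> l + l'" using j by (auto simp: max_def)
  moreover have "max j j' \<in> {1..n}" using j by auto
  ultimately show ?thesis unfolding saturation_exponents_def using dvd_add by blast
qed (use assms in auto)

text \<open>By the Euclidean algorithm some \<open>u \<in> \<Gamma>\<close> is congruent to \<open>1\<close> modulo \<open>\<gamma> 1\<close>. The multiples of \<open>u\<close> by
  \<open>0, \<dots>, \<gamma> 1 - 1\<close> represent every residue class, and adding multiples of \<open>\<gamma> 1\<close> to them reaches every larger number.\<close>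

lemma finite_gaps: "finite (- \<Gamma>)"
proof -
  have one: "1 \<in> {1..n}" using n by simp
  define P where "P a \<longleftrightarrow> (\<exists>s\<in>\<Gamma>. s mod \<gamma> 1 = a mod \<gamma> 1)" for a
  have "P (Gcd (\<gamma> ` {1..n}))"
  proof (rule Gcd_if_diff_closed)
    fix a b assume "P a" "P b" "b \<le> a"
    then obtain s s' where s: "s \<in> \<Gamma>" "s mod \<gamma> 1 = a mod \<gamma> 1" "s' \<in> \<Gamma>" "s' mod \<gamma> 1 = b mod \<gamma> 1"
      unfolding P_def by blast
    \<comment> \<open>Adding \<open>\<gamma> 1 - 1\<close> copies of \<open>s'\<close> subtracts \<open>s'\<close> modulo \<open>\<gamma> 1\<close> within \<open>\<Gamma>\<close>.\<close>
    have "(s + (\<gamma> 1 - 1) * s') mod \<gamma> 1 = (a + (\<gamma> 1 - 1) * b) mod \<gamma> 1"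
      by (rule mod_add_cong[OF s(2) mod_mult_cong[OF refl s(4)]])
    also have "a + (\<gamma> 1 - 1) * b = (a - b) + \<gamma> 1 * b"
      using gamma_pos[OF one] \<open>b \<le> a\<close> by (cases "\<gamma> 1") auto
    finally have "(s + (\<gamma> 1 - 1) * s') mod \<gamma> 1 = (a - b) mod \<gamma> 1" by simp
    then show "P (a - b)" unfolding P_def using Gamma_add[OF s(1) Gamma_mult[OF s(3)]] by blast
  next
    show "P s" if "s \<in> \<gamma> ` {1..n}" for s using that gamma_in_Gamma unfolding P_def by blast
  qed (use n in auto)
  then have "P 1" by (simp only: gamma_gcd)
  then obtain u where u: "u \<in> \<Gamma>" "u mod \<gamma> 1 = 1 mod \<gamma> 1" unfolding P_def by blast
  have "l \<in> \<Gamma>" if l: "\<gamma> 1 * u \<le> l" for l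
  proof -
    define k where "k = l mod \<gamma> 1"
    have "k < \<gamma> 1" using gamma_pos[OF one] by (simp add: k_def)
    then have ku: "k * u \<le> l" using l by (meson le_trans less_imp_le mult_le_mono1)
    have "k * u mod \<gamma> 1 = k * 1 mod \<gamma> 1" using u(2) by (metis mod_mult_right_eq)
    then have "k * u mod \<gamma> 1 = l mod \<gamma> 1" by (simp add: k_def)
    then have "\<gamma> 1 dvd l - k * u" using ku by (metis mod_eq_dvd_iff_nat)
    then obtain m where "l - k * u = \<gamma> 1 * m" by blast
    then have "l = k * u + m * \<gamma> 1" using ku by (simp add: mult.commute)
    then show ?thesis using Gamma_add Gamma_mult u(1) gamma_in_Gamma[OF one] by metis
  qed
  then have "- \<Gamma> \<subseteq> {..<\<gamma> 1 * u}" by (meson ComplD lessThan_iff not_le subsetI)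
  then show ?thesis using finite_subset by blast
qed

lemma finite_saturation_gaps: "finite (saturation_exponents - \<Gamma>)"
  using finite_gaps by (rule finite_subset[rotated]) auto

text \<open>Divide \<open>l - \<gamma> j\<close> by \<open>\<gamma> 1\<close> with remainder; a gap minus a multiple of \<open>\<gamma> 1\<close> is again a gap, so the result differs
  from \<open>\<gamma> j \<in> \<Gamma>\<close>.\<close>

lemma gap_reduction:
  assumes j: "j \<in> {1..n}" and l: "l \<notin> \<Gamma>" "\<gamma> j \<le> l"
  obtains l' k where "l = l' + k * \<gamma> 1" "l' \<notin> \<Gamma>" "\<gamma> j < l'" "l' \<le> \<gamma> j + \<gamma> 1 - 1"
proof
  have one: "1 \<in> {1..n}" using n by simp
  define k where "k = (l - \<gamma> j) div \<gamma> 1"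
  define l' where "l' = \<gamma> j + (l - \<gamma> j) mod \<gamma> 1"
  show eq: "l = l' + k * \<gamma> 1" unfolding l'_def k_def using l(2) by simp
  show nin: "l' \<notin> \<Gamma>"
  proof
    assume "l' \<in> \<Gamma>"
    then have "l' + k * \<gamma> 1 \<in> \<Gamma>" by (intro Gamma_add Gamma_mult gamma_in_Gamma one)
    with eq l(1) show False by simp
  qed
  have "l' \<noteq> \<gamma> j" using nin gamma_in_Gamma[OF j] by auto
  then show "\<gamma> j < l'" by (simp add: l'_def)
  have "(l - \<gamma> j) mod \<gamma> 1 < \<gamma> 1" using gamma_pos[OF one] by simp
  then show "l' \<le> \<gamma> j + \<gamma> 1 - 1" by (simp add: l'_def)
qed

lemma saturation_exponents_gap_cases:
  assumes r: "r \<in> {1..n}" and l: "l \<in> saturation_exponents" "l \<notin> \<Gamma>"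
  obtains j where "j \<in> {1..r - 1}" "l \<in> gap_L \<Gamma> \<gamma> j" |
    l' k where "l' \<in> gap_Ltilde \<Gamma> \<gamma> r" "l = l' + k * \<gamma> 1"
proof (cases "\<gamma> r \<le> l")
  case True
  obtain l' k where *: "l = l' + k * \<gamma> 1" "l' \<notin> \<Gamma>" "\<gamma> r < l'" "l' \<le> \<gamma> r + \<gamma> 1 - 1"
    by (rule gap_reduction[OF r l(2) True])
  then have "l' \<in> gap_Ltilde \<Gamma> \<gamma> r" by (simp add: gap_Ltilde_def gaps_def)
  then show ?thesis using *(1) that(2) by blast
next
  case False
  have "l \<noteq> 0" using l(2) Gamma_0 by metis
  then obtain i where i: "i \<in> {1..n}" "\<gamma> i \<le> l" "d i dvd l" using l by (auto simp: saturation_exponents_def)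
  obtain j where j: "j \<in> {1..n}" "i \<le> j" "\<gamma> j \<le> l" "\<forall>k\<in>{1..n}. j < k \<longrightarrow> l < \<gamma> k"
    by (rule last_gamma_le[OF i(1,2)])
  have jr: "j < r" using False j gamma_le[OF r j(1)] by force
  have "\<gamma> j \<noteq> l" using l gamma_in_Gamma[OF j(1)] by auto
  moreover have "d j dvd l" using d_dvd_d[OF j(2)] i(3) dvd_trans by blast
  moreover have "l < \<gamma> (j + 1)" using bspec[OF j(4), of "j + 1"] jr r j(1) by auto
  ultimately have "l \<in> gap_L \<Gamma> \<gamma> j" using l j by (auto simp: gap_L_def gaps_def)
  moreover have "j \<in> {1..r - 1}" using jr j(1) by auto
  ultimately show ?thesis using that(1) by blast
qed

lemma gap_L_reduction:
  assumes j: "j \<in> {1..n}" and l: "l \<in> gap_L \<Gamma> \<gamma> j"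
  obtains l' k where "l' \<in> gap_cL \<Gamma> \<gamma> j" "l = l' + k * \<gamma> 1"
proof -
  have l': "l \<notin> \<Gamma>" "\<gamma> j \<le> l" "l < \<gamma> (j + 1)" "d j dvd l" using l by (auto simp: gap_L_def gaps_def)
  obtain l' k where *: "l = l' + k * \<gamma> 1" "l' \<notin> \<Gamma>" "\<gamma> j < l'" "l' \<le> \<gamma> j + \<gamma> 1 - 1"
    using gap_reduction[OF j l'(1,2)] by blast
  have "d j dvd l' + k * \<gamma> 1" using l'(4) *(1) by simp
  then have "d j dvd l'" using d_dvd_gamma[of 1 j] j by (auto simp: dvd_add_left_iff)
  then have "l' \<in> gap_cL \<Gamma> \<gamma> j" using * l'(3) by (auto simp: gap_cL_def gap_L_def gaps_def)
  then show ?thesis using that *(1) by blast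
qed

lemma gap_L_subset: "j \<in> {1..n} \<Longrightarrow> gap_L \<Gamma> \<gamma> j \<subseteq> saturation_exponents"
  by (auto simp: gap_L_def saturation_exponents_def intro: less_imp_le)

lemma gap_Ltilde_subset: "r \<in> {1..n} \<Longrightarrow> d r = 1 \<Longrightarrow> gap_Ltilde \<Gamma> \<gamma> r \<subseteq> saturation_exponents"
  by (auto simp: gap_Ltilde_def saturation_exponents_def intro!: bexI[of _ r])

text \<open>In both cases \<open>l\<close> lies below a bound such that all smaller elements of \<open>\<Gamma>\<close> share a divisor that does not
  divide \<open>l\<close>, the divisor being \<open>0\<close> in the first case.\<close>

lemma not_saturation_exponents_cases:
  assumes l: "l \<notin> saturation_exponents"
  obtains "0 < l" "l < \<gamma> 1" |
    j where "j \<in> {1..<n}" "l < \<gamma> (Suc j)" "\<not> d j dvd l"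
proof (cases "l < \<gamma> 1")
  case True
  have "0 < l" using l by (cases l) (simp_all add: saturation_exponents_def)
  then show ?thesis using that(1) True by blast
next
  case False
  have "1 \<in> {1..n}" "\<gamma> 1 \<le> l" using n False by auto
  then obtain j where j: "j \<in> {1..n}" "1 \<le> j" "\<gamma> j \<le> l" "\<forall>k\<in>{1..n}. j < k \<longrightarrow> l < \<gamma> k"
    by (rule last_gamma_le)
  then have nd: "\<not> d j dvd l" using l by (auto simp: saturation_exponents_def)
  then have "j \<noteq> n" using gamma_gcd by (auto simp: partial_gcd_def)
  then have "j < n" using j(1) by simp
  then have "j \<in> {1..<n}" "l < \<gamma> (Suc j)" using j(1) bspec[OF j(4), of "Suc j"] by auto
  then show ?thesis using that(2) nd by blast
qed

end

section \<open>Subalgebras of the power series ring\<close>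

lemma fps_subalgebraD:
  assumes "fps_subalgebra S"
  shows "0 \<in> S" "1 \<in> S" "f \<in> S \<Longrightarrow> g \<in> S \<Longrightarrow> f + g \<in> S" "f \<in> S \<Longrightarrow> g \<in> S \<Longrightarrow> f * g \<in> S"
    "f \<in> S \<Longrightarrow> - f \<in> S" "fps_const c \<in> S" "f \<in> S \<Longrightarrow> f ^ k \<in> S"
proof -
  have S: "subring S fps_ring" "constants \<subseteq> S" using assms by (auto simp: fps_subalgebra_def)
  show "0 \<in> S" "1 \<in> S" "f \<in> S \<Longrightarrow> g \<in> S \<Longrightarrow> f + g \<in> S" "f \<in> S \<Longrightarrow> - f \<in> S"
    and mult: "f \<in> S \<Longrightarrow> g \<in> S \<Longrightarrow> f * g \<in> S" for f g
    using subringE(2,3,5,6,7)[OF S(1)] by (auto simp: type_ring_simps type_ring_neg)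
  then show "f \<in> S \<Longrightarrow> f ^ k \<in> S" by (induction k) auto
  show "fps_const c \<in> S" using S(2) by blast
qed

lemma fps_subalgebraI:
  assumes "1 \<in> S" "\<And>f g. f \<in> S \<Longrightarrow> g \<in> S \<Longrightarrow> f + g \<in> S" "\<And>f g. f \<in> S \<Longrightarrow> g \<in> S \<Longrightarrow> f * g \<in> S"
    "\<And>c. fps_const c \<in> S"
  shows "fps_subalgebra S"
proof -
  have "- f \<in> S" if "f \<in> S" for f
    using assms(3)[OF assms(4)[of "-1"] that] by (simp flip: fps_const_neg)
  then show ?thesis unfolding fps_subalgebra_def using assms
    by (auto intro!: type_ring.subringI simp: type_ring_simps type_ring_neg)
qed

lemma fps_subalgebra_cring: "fps_subalgebra S \<Longrightarrow> cring (fps_ring\<lparr>carrier := S\<rparr>)"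
  unfolding fps_subalgebra_def
  using type_ring.subcringI'[of S] type_ring.subcring_iff[of S] unfolding type_ring_simps by blast

lemma fps_subalgebra_adjoin:
  assumes "fps_subalgebra A" shows "fps_subalgebra (adjoin A S)"
proof (rule fps_subalgebraI)
  show "fps_const c \<in> adjoin A S" for c
    unfolding adjoin_def using fps_subalgebraD(6)[OF assms] by (intro generate_ring.incl) simp
qed (use generate_ring.one[of fps_ring "A \<union> S"] generate_ring.eng_add[of _ fps_ring "A \<union> S"]
    generate_ring.eng_mult[of _ fps_ring "A \<union> S"] in \<open>simp_all add: adjoin_def type_ring_simps\<close>)

lemma adjoin_superset: "A \<subseteq> adjoin A S" "S \<subseteq> adjoin A S"
  unfolding adjoin_def by (auto intro: generate_ring.incl)

lemma adjoin_minimal: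
  assumes "fps_subalgebra C" "A \<subseteq> C" "S \<subseteq> C" shows "adjoin A S \<subseteq> C"
  unfolding adjoin_def using assms
  by (intro type_ring.generate_ring_min_subring1) (auto simp: fps_subalgebra_def type_ring_simps)

lemma fps_subalgebra_submodule:
  assumes C: "fps_subalgebra C" and "K \<subseteq> C" shows "subalgebra K C fps_ring"
proof (intro subalgebra.intro subalgebra_axioms.intro)
  show "subgroup C (add_monoid fps_ring)"
    using C unfolding fps_subalgebra_def by (auto dest: subring.axioms(1))
qed (use fps_subalgebraD(4)[OF C] assms(2) in \<open>auto simp: type_ring_simps\<close>)

lemma submodule_span_superset: "S \<subseteq> submodule_span K S"
  unfolding submodule_span_def by (rule hull_subset)

lemma submodule_span_minimal: "subalgebra K C fps_ring \<Longrightarrow> S \<subseteq> C \<Longrightarrow> submodule_span K S \<subseteq> C"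
  unfolding submodule_span_def by (rule hull_minimal)

lemma submodule_span_closed:
  shows "0 \<in> submodule_span K S"
    and "f \<in> submodule_span K S \<Longrightarrow> g \<in> submodule_span K S \<Longrightarrow> f + g \<in> submodule_span K S"
    and "k \<in> K \<Longrightarrow> f \<in> submodule_span K S \<Longrightarrow> k * f \<in> submodule_span K S"
proof -
  have closed: "0 \<in> C" "f \<in> C \<Longrightarrow> g \<in> C \<Longrightarrow> f + g \<in> C" "k \<in> K \<Longrightarrow> f \<in> C \<Longrightarrow> k * f \<in> C"
    if C: "subalgebra K C fps_ring" for C and f g k :: "'a fps"
  proof -
    interpret subalgebra K C fps_ring by (rule C)
    show "0 \<in> C" "f \<in> C \<Longrightarrow> g \<in> C \<Longrightarrow> f + g \<in> C" "k \<in> K \<Longrightarrow> f \<in> C \<Longrightarrow> k * f \<in> C"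
      using one_closed m_closed[of f g] smult_closed[of k f] by (auto simp: type_ring_simps)
  qed
  show "0 \<in> submodule_span K S"
    "f \<in> submodule_span K S \<Longrightarrow> g \<in> submodule_span K S \<Longrightarrow> f + g \<in> submodule_span K S"
    "k \<in> K \<Longrightarrow> f \<in> submodule_span K S \<Longrightarrow> k * f \<in> submodule_span K S"
    unfolding submodule_span_def hull_def using closed by blast+
qed

lemma scaled_power_nth: "fps_nth (fps_const c * fps_X ^ l) i = (if i = l then c else 0)"
  by (simp add: fps_X_power_nth)

section \<open>The saturation\<close>

locale lipschitz_setting = numerical_semigroup +
  fixes A B :: "'a::comm_ring_1 fps set"
  assumes A_sub: "fps_subalgebra A" and B_sub: "fps_subalgebra B" and A_B: "A \<subseteq> B"
    and X_B: "fps_X \<in> B" and gamma_A: "\<And>i. i \<in> {1..n} \<Longrightarrow> fps_X ^ \<gamma> i \<in> A"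
    and A_Gamma: "\<And>f i. f \<in> A \<Longrightarrow> fps_nth f i \<noteq> 0 \<Longrightarrow> i \<in> \<Gamma>"
    and A_closed: "gamma_closed \<Gamma> B A"
begin

abbreviation rA :: "'a fps ring" where "rA \<equiv> fps_ring\<lparr>carrier := A\<rparr>"
abbreviation rB :: "'a fps ring" where "rB \<equiv> fps_ring\<lparr>carrier := B\<rparr>"

text \<open>This subalgebra turns out to be the saturation.\<close>

definition supported :: "'a fps set" where
  "supported = {f \<in> B. \<forall>i. fps_nth f i \<noteq> 0 \<longrightarrow> i \<in> saturation_exponents}"

lemma rB_simps:
  "carrier rB = B" "f \<oplus>\<^bsub>rB\<^esub> g = f + g" "f \<otimes>\<^bsub>rB\<^esub> g = f * g" "\<one>\<^bsub>rB\<^esub> = 1"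
  "f [^]\<^bsub>rB\<^esub> (k::nat) = f ^ k"
  using type_ring.nat_pow_consistent[of f k B] by (simp_all add: type_ring_simps type_ring_pow)

sublocale tower: algebra_tower_element rA rB "type_ring :: 'a ring" fps_const "\<lambda>f. f" fps_const fps_X
proof (intro algebra_tower_element.intro algebra_tower.intro algebra_tower_axioms.intro
    algebra_tower_element_axioms.intro fps_subalgebra_cring A_sub B_sub)
  show "fps_const = (\<lambda>f. f) \<circ> (fps_const :: 'a \<Rightarrow> 'a fps)" by (simp add: fun_eq_iff)
qed (use fps_subalgebraD(6)[OF A_sub] A_B X_B in auto)

lemma supported_subalgebra: "fps_subalgebra supported"
proof (rule fps_subalgebraI)
  have 0: "0 \<in> saturation_exponents" by (simp add: saturation_exponents_def)
  show "1 \<in> supported" "fps_const c \<in> supported" for c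
    using fps_subalgebraD[OF B_sub] 0 by (auto simp: supported_def)
  fix f g assume fg: "f \<in> supported" "g \<in> supported"
  have "i \<in> saturation_exponents" if "fps_nth (f + g) i \<noteq> 0" for i
    using fg that by (cases "fps_nth f i = 0") (auto simp: supported_def)
  then show "f + g \<in> supported"
    using fg fps_subalgebraD(3)[OF B_sub, of f g] by (simp add: supported_def)
  have "i \<in> saturation_exponents" if i: "fps_nth (f * g) i \<noteq> 0" for i
  proof -
    obtain k where k: "k \<le> i" "fps_nth f k * fps_nth g (i - k) \<noteq> 0"
      using i unfolding fps_mult_nth by (meson atLeastAtMost_iff sum.not_neutral_contains_not_neutral)
    have "fps_nth f k \<noteq> 0" "fps_nth g (i - k) \<noteq> 0" using mult_not_zero[OF k(2)] by auto
    then have "k \<in> saturation_exponents" "i - k \<in> saturation_exponents" using fg by (auto simp: supported_def)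
    from saturation_exponents_add[OF this] k(1) show ?thesis by simp
  qed
  then show "f * g \<in> supported" using fg fps_subalgebraD(4)[OF B_sub, of f g] by (simp add: supported_def)
qed

lemma A_supported: "A \<subseteq> supported"
  unfolding supported_def using A_B A_Gamma Gamma_subset by blast

lemma power_supported: "l \<in> saturation_exponents \<Longrightarrow> fps_X ^ l \<in> supported"
  using fps_subalgebraD(7)[OF B_sub X_B] by (auto simp: supported_def fps_X_power_nth)

lemma scaled_power_B: "fps_const c * fps_X ^ l \<in> B"
  by (intro fps_subalgebraD(4,6,7)[OF B_sub] X_B)

lemma scaled_power_A: "fps_const c * fps_X ^ (k * \<gamma> 1) \<in> A"
proof -
  have "1 \<in> {1..n}" using n by simp
  from fps_subalgebraD(7)[OF A_sub gamma_A[OF this], of k] show ?thesis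
    by (intro fps_subalgebraD(4)[OF A_sub] fps_subalgebraD(6)[OF A_sub])
      (simp only: mult.commute[of k] power_mult)
qed

text \<open>The summand \<open>a\<close> is the part of \<open>f\<close> supported in \<open>\<Gamma>\<close>, which \<open>A\<close> contains because it is closed. What remains is
  a polynomial, since there are only finitely many gaps.\<close>

lemma supported_decomposition:
  assumes "f \<in> supported"
  obtains a where "a \<in> A" "f = a + (\<Sum>l\<in>saturation_exponents - \<Gamma>. fps_const (fps_nth f l) * fps_X ^ l)"
proof
  show "Abs_fps (\<lambda>i. if i \<in> \<Gamma> then fps_nth f i else 0) \<in> A"
    using A_closed assms by (auto simp: gamma_closed_def supported_def)
  show "f = Abs_fps (\<lambda>i. if i \<in> \<Gamma> then fps_nth f i else 0) +
      (\<Sum>l\<in>saturation_exponents - \<Gamma>. fps_const (fps_nth f l) * fps_X ^ l)"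
  proof (rule fps_ext)
    fix i
    have "(\<Sum>l\<in>saturation_exponents - \<Gamma>. fps_nth (fps_const (fps_nth f l) * fps_X ^ l) i) =
        (if i \<in> saturation_exponents - \<Gamma> then fps_nth f i else 0)"
      unfolding scaled_power_nth using finite_saturation_gaps by (simp add: sum.delta)
    then show "fps_nth f i = fps_nth (Abs_fps (\<lambda>i. if i \<in> \<Gamma> then fps_nth f i else 0) +
      (\<Sum>l\<in>saturation_exponents - \<Gamma>. fps_const (fps_nth f l) * fps_X ^ l)) i"
      using assms unfolding fps_add_nth fps_sum_nth by (auto simp: supported_def)
  qed
qed

lemma controlled_scaled_power:
  assumes l: "l \<in> saturation_exponents" "l \<notin> \<Gamma>"
  shows "tower.pair.controlled (tower.\<Delta> (fps_const c * fps_X ^ l))"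
proof -
  have "l \<noteq> 0" using l(2) Gamma_0 by metis
  then obtain j where j: "j \<in> {1..n}" "\<gamma> j \<le> l" "d j dvd l" using l(1) by (auto simp: saturation_exponents_def)
  have mem: "s \<le> \<gamma> j \<and> fps_X [^]\<^bsub>rB\<^esub> s \<in> (\<lambda>f. f) ` carrier rA" if "s \<in> \<gamma> ` {1..j}" for s
  proof -
    obtain i where i: "s = \<gamma> i" "i \<in> {1..j}" using \<open>s \<in> \<gamma> ` {1..j}\<close> by blast
    then have "i \<in> {1..n}" using j(1) by auto
    then show ?thesis using gamma_le[of i j] gamma_A[of i] i j(1) by (simp add: rB_simps)
  qed
  have ne: "\<gamma> ` {1..j} \<noteq> {}" "0 < l" using j(1) \<open>l \<noteq> 0\<close> by auto
  show ?thesis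
    using tower.controlled_scaled_power[OF _ ne(1) mem j(2) j(3)[unfolded partial_gcd_def] ne(2), of c]
    by (simp add: rB_simps type_ring_simps)
qed

lemma supported_subset_saturation: "supported \<subseteq> lipschitz_saturation type_ring fps_const rA (\<lambda>f. f) rB"
proof
  fix f assume f: "f \<in> supported"
  obtain a where a: "a \<in> A" "f = a + (\<Sum>l\<in>saturation_exponents - \<Gamma>. fps_const (fps_nth f l) * fps_X ^ l)"
    by (rule supported_decomposition[OF f])
  have A_controlled: "tower.pair.controlled (tower.\<Delta> a)" if "a \<in> A" for a
    using tower.pair.controlled_ideal[OF tower.diff_mem_kernel[of a]] that by simp
  have add: "tower.pair.controlled (tower.\<Delta> (u + v))"
    if "u \<in> B" "v \<in> B" "tower.pair.controlled (tower.\<Delta> u)" "tower.pair.controlled (tower.\<Delta> v)" for u v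
    using tower.pair.controlled_add[OF that(3,4)] tower.diff_add[of u v] that(1,2)
    by (simp add: type_ring_simps)
  have sum: "(\<Sum>l\<in>L. fps_const (fps_nth f l) * fps_X ^ l) \<in> B \<and>
      tower.pair.controlled (tower.\<Delta> (\<Sum>l\<in>L. fps_const (fps_nth f l) * fps_X ^ l))"
    if "finite L" "L \<subseteq> saturation_exponents - \<Gamma>" for L
    using that
  proof (induction L rule: finite_induct)
    case empty
    show ?case unfolding sum.empty
      using fps_subalgebraD(1)[OF B_sub] A_controlled[OF fps_subalgebraD(1)[OF A_sub]] by blast
  next
    case (insert l L)
    have IH: "(\<Sum>l\<in>L. fps_const (fps_nth f l) * fps_X ^ l) \<in> B"
      "tower.pair.controlled (tower.\<Delta> (\<Sum>l\<in>L. fps_const (fps_nth f l) * fps_X ^ l))"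
      using insert.IH insert.prems by blast+
    have l: "tower.pair.controlled (tower.\<Delta> (fps_const (fps_nth f l) * fps_X ^ l))"
      using insert.prems by (intro controlled_scaled_power) auto
    show ?case unfolding sum.insert[OF insert.hyps]
      using add[OF scaled_power_B IH(1) l IH(2)] fps_subalgebraD(3)[OF B_sub scaled_power_B IH(1)] by blast
  qed
  have "tower.pair.controlled (tower.\<Delta> (a + (\<Sum>l\<in>saturation_exponents - \<Gamma>. fps_const (fps_nth f l) * fps_X ^ l)))"
    using sum[OF finite_saturation_gaps order_refl] A_B a(1) A_controlled[OF a(1)] by (intro add) blast+
  then have "tower.pair.controlled (tower.\<Delta> f)" by (simp only: a(2)[symmetric])
  moreover have "f \<in> carrier rB" using f by (simp add: supported_def rB_simps)
  ultimately show "f \<in> lipschitz_saturation type_ring fps_const rA (\<lambda>f. f) rB"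
    by (intro tower.lipschitz_saturation_if_controlled)
qed

text \<open>Compare \<open>f(s)\<close> with \<open>f(Z s)\<close> modulo \<open>\<pi>\<close>. The hypothesis on \<open>\<Gamma>\<close> says that these agree up to order \<open>c\<close> for
  \<open>f \<in> A\<close>; integrality extends this to \<open>f\<close> in the saturation.\<close>

lemma saturation_coefficient:
  assumes reduced: "\<And>(a::'a) k. a ^ k = 0 \<Longrightarrow> a = 0"
    and f: "f \<in> lipschitz_saturation type_ring fps_const rA (\<lambda>f. f) rB"
    and \<pi>: "\<And>m (b::'a) k. \<not> \<pi> dvd 1 - [:0, 1:] ^ m \<Longrightarrow> \<pi> dvd [:b:] * (1 - [:0, 1:] ^ m) ^ k \<Longrightarrow> b = 0"
    and Gamma_\<pi>: "\<And>s. s \<in> \<Gamma> \<Longrightarrow> s < c \<Longrightarrow> \<pi> dvd 1 - [:0, 1:] ^ s"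
    and l: "l < c" "\<not> \<pi> dvd 1 - [:0, 1:] ^ l"
  shows "fps_nth f l = 0"
proof -
  have hom: "fps_embed \<in> ring_hom rB type_ring" "fps_twist \<in> ring_hom rB type_ring"
    by (auto intro!: ring_hom_memI simp: rB_simps type_ring_simps fps_embed_hom fps_twist_hom)
  have V: "ideal (order_ideal \<pi> c) type_ring"
    using order_ideal_mult[of _ \<pi> 0 _ c]
    by (intro type_ring_idealI order_ideal_zero order_ideal_add) (auto simp: order_ideal_def[of _ 0])
  have VA: "fps_embed a - fps_twist a \<in> order_ideal \<pi> c" if a: "a \<in> carrier rA" for a
    unfolding order_ideal_def
  proof (intro CollectI allI impI)
    fix m assume "m < c"
    show "\<pi> dvd fps_nth (fps_embed a - fps_twist a) m"
    proof (cases "fps_nth a m = 0")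
      case False
      then have "m \<in> \<Gamma>" using A_Gamma[of a] a by simp
      from Gamma_\<pi>[OF this \<open>m < c\<close>] show ?thesis
        unfolding fps_embed_minus_twist_nth by (rule dvd_mult)
    qed (simp only: fps_embed_minus_twist_nth, simp)
  qed
  obtain \<Psi> where \<Psi>: "\<Psi> \<in> ring_hom tower.S type_ring"
    "\<And>b. b \<in> carrier rB \<Longrightarrow> \<Psi> (tower.\<Delta> b) = fps_embed b - fps_twist b"
    "\<And>k. k \<in> tower.K \<Longrightarrow> \<Psi> k \<in> order_ideal \<pi> c"
    using tower.tensor_hom_exists[OF hom V VA fps_embed_twist_const] by blast
  have fB: "f \<in> carrier rB" and fc: "tower.\<Delta> f \<in> integral_closure tower.S tower.K"
    using f unfolding lipschitz_saturation_def tower.h_eq[symmetric] by blast+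
  interpret integral_element tower.S tower.K "tower.\<Delta> f"
    by (intro integral_element.intro integral_element_axioms.intro tower.S.is_cring tower.K_ideal
        tower.diff_closed fB)
  have "\<exists>k>0. \<exists>a. (\<forall>i\<in>{1..k}. a i \<in> order_ideal \<pi> (c * i)) \<and>
      \<Psi> (tower.\<Delta> f) ^ k + (\<Sum>i\<in>{1..k}. a i * \<Psi> (tower.\<Delta> f) ^ (k - i)) = 0"
  proof (rule integral_equation_image[OF \<Psi>(1) fc])
    show "order_ideal \<pi> (c * 0) = UNIV" by (simp add: order_ideal_def)
    show "x * y \<in> order_ideal \<pi> (c * (i + j))"
      if "x \<in> order_ideal \<pi> (c * i)" "y \<in> order_ideal \<pi> (c * j)" for i j x y
      using order_ideal_mult[OF that] by (simp add: distrib_left)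
    show "\<Psi> k \<in> order_ideal \<pi> (c * 1)" if "k \<in> tower.K" for k using \<Psi>(3)[OF that] by simp
  qed (rule order_ideal_add)
  then obtain k a where eq: "\<And>i. i \<in> {1..k} \<Longrightarrow> a i \<in> order_ideal \<pi> (c * i)"
      "(fps_embed f - fps_twist f) ^ k + (\<Sum>i\<in>{1..k}. a i * (fps_embed f - fps_twist f) ^ (k - i)) = 0"
    unfolding \<Psi>(2)[OF fB] by blast
  have "fps_embed f - fps_twist f \<in> order_ideal \<pi> c"
    by (rule integral_twist_difference[OF reduced eq(2,1) \<pi>])
  then have "\<pi> dvd [:fps_nth f l:] * (1 - [:0, 1:] ^ l) ^ 1"
    using l(1) unfolding order_ideal_def by (simp only: mem_Collect_eq fps_embed_minus_twist_nth power_one_right)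
  then show ?thesis using \<pi>[OF l(2)] by blast
qed

lemma poly_0_if_X_dvd: "[:0, 1:] dvd p \<Longrightarrow> poly p 0 = 0" for p :: "'b::comm_ring_1 poly"
  by (auto simp: dvd_def)

text \<open>Take \<open>\<pi> = Z\<close> and \<open>c = \<gamma> 1\<close> for exponents below \<open>\<gamma> 1\<close>, which amounts to comparing \<open>f\<close> with its
  constant term. Otherwise take \<open>\<pi> = Z^d j - 1\<close> and \<open>c = \<gamma> (j + 1)\<close>.\<close>

lemma saturation_subset_supported:
  assumes reduced: "\<And>(a::'a) k. a ^ k = 0 \<Longrightarrow> a = 0"
    and nzd: "\<And>a::'a. of_nat (\<gamma> 1) * a = 0 \<Longrightarrow> a = 0"
  shows "lipschitz_saturation type_ring fps_const rA (\<lambda>f. f) rB \<subseteq> supported"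
proof
  fix f assume f: "f \<in> lipschitz_saturation type_ring fps_const rA (\<lambda>f. f) rB"
  have "fps_nth f l = 0" if "l \<notin> saturation_exponents" for l
    using that
  proof (cases rule: not_saturation_exponents_cases)
    case 1
    have Z: "\<not> [:0, 1:] dvd (1 - [:0, 1:] ^ m :: 'a poly)" if "0 < m" for m
    proof
      assume "[:0, 1:] dvd (1 - [:0, 1:] ^ m :: 'a poly)"
      then have "poly (1 - [:0, 1:] ^ m :: 'a poly) 0 = 0" by (rule poly_0_if_X_dvd)
      then show False using that by (simp add: poly_power zero_power)
    qed
    show ?thesis
    proof (rule saturation_coefficient[OF reduced f, where \<pi> = "[:0, 1:]" and c = "\<gamma> 1"])
      fix m k and b :: 'a
      assume m: "\<not> [:0, 1:] dvd (1 - [:0, 1:] ^ m :: 'a poly)"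
        and dvd: "[:0, 1:] dvd [:b:] * (1 - [:0, 1:] ^ m) ^ k"
      have "0 < m" using m by (cases m) auto
      from dvd have "poly ([:b:] * (1 - [:0, 1:] ^ m) ^ k) 0 = 0" by (rule poly_0_if_X_dvd)
      then show "b = 0" using \<open>0 < m\<close> by (simp add: poly_power zero_power)
    next
      fix s assume s: "s \<in> \<Gamma>" "s < \<gamma> 1"
      then have "d 0 dvd s" using n by (intro d_dvd_Gamma) auto
      then show "[:0, 1:] dvd (1 - [:0, 1:] ^ s :: 'a poly)" by (simp add: partial_gcd_def)
    qed (use 1 Z in auto)
  next
    case (2 j)
    let ?\<pi> = "[:0, 1:] ^ d j - 1 :: 'a poly"
    have "d j dvd \<gamma> 1" using 2(1) by (intro d_dvd_gamma) auto
    then obtain e where e: "\<gamma> 1 = e * d j" by (metis dvd_def mult.commute)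
    have nzd_d: "b = 0" if "of_nat (d j) * b = 0" for b :: 'a
    proof (rule nzd)
      have "of_nat (\<gamma> 1) * b = of_nat e * (of_nat (d j) * b)" unfolding e of_nat_mult by (rule mult.assoc)
      then show "of_nat (\<gamma> 1) * b = 0" using that by simp
    qed
    have pi_dvd: "?\<pi> dvd 1 - [:0, 1:] ^ m" if "d j dvd m" for m
    proof -
      from that obtain k where k: "m = d j * k" by (rule dvdE)
      have "?\<pi> dvd ([:0, 1:] ^ d j) ^ k - 1" by (simp only: power_diff_1_eq dvd_triv_left)
      then have "?\<pi> dvd - (([:0, 1:] ^ d j) ^ k - 1)" by (simp only: dvd_minus_iff)
      then show ?thesis by (simp only: k power_mult minus_diff_eq)
    qed
    have pi_zero: "b = 0" if "\<not> d j dvd m" "?\<pi> dvd [:b:] * (1 - [:0, 1:] ^ m) ^ k" for b :: 'a and m k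
      using const_eq_0_if_root_of_unity_dvd[OF nzd_d that] .
    show ?thesis
    proof (rule saturation_coefficient[OF reduced f, where \<pi> = "?\<pi>" and c = "\<gamma> (Suc j)"])
      show "b = 0" if "\<not> ?\<pi> dvd 1 - [:0, 1:] ^ m" "?\<pi> dvd [:b:] * (1 - [:0, 1:] ^ m) ^ k" for m k and b :: 'a
        using pi_zero[OF _ that(2)] pi_dvd that(1) by blast
      show "?\<pi> dvd 1 - [:0, 1:] ^ s" if "s \<in> \<Gamma>" "s < \<gamma> (Suc j)" for s
        using 2(1) that by (intro pi_dvd d_dvd_Gamma) auto
      show "l < \<gamma> (Suc j)" by (rule 2(2))
      show "\<not> ?\<pi> dvd 1 - [:0, 1:] ^ l"
      proof
        assume "?\<pi> dvd 1 - [:0, 1:] ^ l"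
        then have "?\<pi> dvd [:1:] * (1 - [:0, 1:] ^ l) ^ 1" by (simp only: power_one_right dvd_mult)
        from pi_zero[OF 2(3) this] show False by simp
      qed
    qed
  qed
  moreover have "f \<in> B" using f by (simp add: lipschitz_saturation_def)
  ultimately show "f \<in> supported" unfolding supported_def by blast
qed

lemma supported_subset_sum:
  assumes U: "0 \<in> U" "\<And>f g. f \<in> U \<Longrightarrow> g \<in> U \<Longrightarrow> f + g \<in> U"
    and V: "0 \<in> V" "\<And>f g. f \<in> V \<Longrightarrow> g \<in> V \<Longrightarrow> f + g \<in> V"
    and mem: "\<And>l c. l \<in> saturation_exponents \<Longrightarrow> l \<notin> \<Gamma> \<Longrightarrow>
      fps_const c * fps_X ^ l \<in> U \<or> fps_const c * fps_X ^ l \<in> V"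
  shows "supported \<subseteq> A + U + V"
proof
  fix f assume f: "f \<in> supported"
  obtain a where a: "a \<in> A" "f = a + (\<Sum>l\<in>saturation_exponents - \<Gamma>. fps_const (fps_nth f l) * fps_X ^ l)"
    by (rule supported_decomposition[OF f])
  have "\<exists>u\<in>U. \<exists>v\<in>V. (\<Sum>l\<in>L. fps_const (fps_nth f l) * fps_X ^ l) = u + v"
    if "finite L" "L \<subseteq> saturation_exponents - \<Gamma>" for L
    using that
  proof (induction L rule: finite_induct)
    case empty
    then show ?case using U(1) V(1) by (intro bexI[of _ 0]) auto
  next
    case (insert l L)
    then obtain u v where uv: "u \<in> U" "v \<in> V" "(\<Sum>l\<in>L. fps_const (fps_nth f l) * fps_X ^ l) = u + v" by blast
    define w where "w = fps_const (fps_nth f l) * fps_X ^ l"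
    have sum: "(\<Sum>l\<in>insert l L. fps_const (fps_nth f l) * fps_X ^ l) = w + (u + v)"
      using insert.hyps uv(3) by (simp add: w_def)
    have "w \<in> U \<or> w \<in> V" unfolding w_def using insert.prems by (intro mem) auto
    then show ?case
    proof
      assume "w \<in> U"
      then show ?thesis unfolding sum using U(2)[of w u] uv(1,2)
        by (intro bexI[of _ "w + u"] bexI[of _ v]) (auto simp: add.assoc)
    next
      assume "w \<in> V"
      then show ?thesis unfolding sum using V(2)[of w v] uv(1,2)
        by (intro bexI[of _ u] bexI[of _ "w + v"]) (auto simp: ac_simps)
    qed
  qed
  from this[OF finite_saturation_gaps order_refl] obtain u v where "u \<in> U" "v \<in> V" "f = a + (u + v)" using a(2) by metis
  then show "f \<in> A + U + V" using a(1) by (auto simp: set_plus_def add.assoc intro!: exI) 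
qed

lemma sum_subset_subalgebra:
  assumes C: "fps_subalgebra C" and "U \<subseteq> C" "V \<subseteq> C" "W \<subseteq> C"
  shows "U + V + W \<subseteq> C"
proof
  fix f assume "f \<in> U + V + W"
  then obtain u v w where "u \<in> U" "v \<in> V" "w \<in> W" "f = u + v + w" by (auto elim!: set_plus_elim)
  then show "f \<in> C" using assms(2-4) fps_subalgebraD(3)[OF C] by blast
qed

text \<open>Scalars from \<open>R\<close> suffice for the full sets \<open>L\<^sub>j\<close>. For the truncated sets the missing exponents are
  recovered by multiplying with powers of \<open>t\<close> to \<open>\<gamma> 1\<close>, which lie in \<open>A\<close>.\<close>

lemma supported_presentations:
  assumes r: "r \<in> {1..n}" "d r = 1"
  shows "supported = A + submodule_span constants (t_powers (\<Union>j\<in>{1..r - 1}. gap_L \<Gamma> \<gamma> j))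
                  + submodule_span A (t_powers (gap_Ltilde \<Gamma> \<gamma> r))" (is "_ = A + ?U + ?V")
    and "supported = A + submodule_span A (t_powers (\<Union>j\<in>{1..r - 1}. gap_cL \<Gamma> \<gamma> j))
                  + submodule_span A (t_powers (gap_Ltilde \<Gamma> \<gamma> r))" (is "_ = A + ?U' + _")
    and "supported = adjoin A (t_powers (gap_cL_upto \<Gamma> \<gamma> r))" (is "_ = ?C")
    and "adjoin A (t_powers (gap_cL_upto \<Gamma> \<gamma> r)) = adjoin A (t_powers (gap_L_upto \<Gamma> \<gamma> r))" (is "_ = ?D")
proof -
  have L: "t_powers (gap_L_upto \<Gamma> \<gamma> r) \<subseteq> supported"
    using gap_L_subset gap_Ltilde_subset[OF r] power_supported r(1)
    unfolding t_powers_def gap_L_upto_def by fastforce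
  have const: "constants \<subseteq> A" using fps_subalgebraD(6)[OF A_sub] by blast
  have V_mem: "fps_const c * fps_X ^ (l' + k * \<gamma> 1) \<in> submodule_span A (t_powers Y)" if "l' \<in> Y" for Y l' k c
  proof -
    have "fps_X ^ l' \<in> submodule_span A (t_powers Y)"
      using that by (intro subsetD[OF submodule_span_superset]) (simp add: t_powers_def)
    then have "(fps_const c * fps_X ^ (k * \<gamma> 1)) * fps_X ^ l' \<in> submodule_span A (t_powers Y)"
      by (rule submodule_span_closed(3)[OF scaled_power_A])
    then show ?thesis by (simp add: power_add mult.assoc mult.commute mult.left_commute)
  qed
  have U_mem: "fps_const c * fps_X ^ l \<in> ?U" if "j \<in> {1..r - 1}" "l \<in> gap_L \<Gamma> \<gamma> j" for j l c
  proof -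
    have "fps_X ^ l \<in> t_powers (\<Union>j\<in>{1..r - 1}. gap_L \<Gamma> \<gamma> j)"
      unfolding t_powers_def using that by blast
    then have "fps_X ^ l \<in> ?U" by (rule subsetD[OF submodule_span_superset])
    then show ?thesis by (rule submodule_span_closed(3)[OF rangeI])
  qed
  have a1: "supported \<subseteq> A + ?U + ?V"
  proof (rule supported_subset_sum)
    fix l c assume "l \<in> saturation_exponents" "l \<notin> \<Gamma>"
    with r(1) show "fps_const c * fps_X ^ l \<in> ?U \<or> fps_const c * fps_X ^ l \<in> ?V"
    proof (cases rule: saturation_exponents_gap_cases)
      case (1 j)
      then show ?thesis using U_mem by blast
    next
      case (2 l' k)
      then show ?thesis using V_mem by blast
    qed
  qed (rule submodule_span_closed; assumption)+
  have span_sat: "submodule_span K (t_powers Y) \<subseteq> supported"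
    if "K \<subseteq> A" "Y \<subseteq> gap_L_upto \<Gamma> \<gamma> r" for K Y
  proof (rule submodule_span_minimal)
    show "subalgebra K supported fps_ring"
      using that(1) A_supported by (intro fps_subalgebra_submodule supported_subalgebra) auto
    show "t_powers Y \<subseteq> supported" using that(2) L by (auto simp: t_powers_def)
  qed
  have "A + ?U + ?V \<subseteq> supported"
    by (rule sum_subset_subalgebra[OF supported_subalgebra A_supported span_sat[OF const] span_sat[OF order_refl]])
      (auto simp: gap_L_upto_def)
  with a1 show "supported = A + ?U + ?V" by (rule antisym)
  have b1: "supported \<subseteq> A + ?U' + ?V"
  proof (rule supported_subset_sum)
    fix l c assume "l \<in> saturation_exponents" "l \<notin> \<Gamma>"
    with r(1) show "fps_const c * fps_X ^ l \<in> ?U' \<or> fps_const c * fps_X ^ l \<in> ?V"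
    proof (cases rule: saturation_exponents_gap_cases)
      case (1 j)
      have "j \<in> {1..n}" using 1(1) r(1) by auto
      then obtain l' k where "l' \<in> gap_cL \<Gamma> \<gamma> j" "l = l' + k * \<gamma> 1" by (rule gap_L_reduction[OF _ 1(2)])
      then show ?thesis using V_mem[of l' "\<Union>j\<in>{1..r - 1}. gap_cL \<Gamma> \<gamma> j"] 1(1) by blast
    next
      case (2 l' k)
      then show ?thesis using V_mem by blast
    qed
  qed (rule submodule_span_closed; assumption)+
  have "A + ?U' + ?V \<subseteq> supported"
    by (rule sum_subset_subalgebra[OF supported_subalgebra A_supported span_sat[OF order_refl] span_sat[OF order_refl]])
      (auto simp: gap_L_upto_def gap_cL_def)
  with b1 show "supported = A + ?U' + ?V" by (rule antisym)
  have span_C: "submodule_span A (t_powers Y) \<subseteq> ?C" if "Y \<subseteq> gap_cL_upto \<Gamma> \<gamma> r" for Y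
  proof (rule submodule_span_minimal)
    show "subalgebra A ?C fps_ring"
      by (intro fps_subalgebra_submodule fps_subalgebra_adjoin A_sub adjoin_superset)
    show "t_powers Y \<subseteq> ?C"
      using that adjoin_superset(2)[of "t_powers (gap_cL_upto \<Gamma> \<gamma> r)" A] by (auto simp: t_powers_def)
  qed
  have "A + ?U' + ?V \<subseteq> ?C"
    by (rule sum_subset_subalgebra[OF fps_subalgebra_adjoin[OF A_sub] adjoin_superset(1) span_C span_C])
      (auto simp: gap_cL_upto_def)
  with b1 have 1: "supported \<subseteq> ?C" by (rule order_trans)
  have "t_powers (gap_cL_upto \<Gamma> \<gamma> r) \<subseteq> t_powers (gap_L_upto \<Gamma> \<gamma> r)"
    unfolding t_powers_def gap_cL_upto_def gap_L_upto_def gap_cL_def by (intro image_mono) auto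
  then have "t_powers (gap_cL_upto \<Gamma> \<gamma> r) \<subseteq> ?D" by (rule order_trans[OF _ adjoin_superset(2)])
  then have 2: "?C \<subseteq> ?D"
    by (rule adjoin_minimal[OF fps_subalgebra_adjoin[OF A_sub] adjoin_superset(1)])
  have 3: "?D \<subseteq> supported" by (rule adjoin_minimal[OF supported_subalgebra A_supported L])
  show "supported = ?C" "?C = ?D" using 1 2 3 by blast+
qed

lemma saturation_presentations:
  assumes reduced: "\<And>(a::'a) k. a ^ k = 0 \<Longrightarrow> a = 0"
    and nzd: "\<And>a::'a. of_nat (\<gamma> 1) * a = 0 \<Longrightarrow> a = 0"
    and r: "r \<in> {1..n}" "d r = 1"
  defines "S \<equiv> lipschitz_saturation type_ring fps_const rA (\<lambda>f. f) rB"
  shows "S = A + submodule_span constants (t_powers (\<Union>j\<in>{1..r - 1}. gap_L \<Gamma> \<gamma> j))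
                  + submodule_span A (t_powers (gap_Ltilde \<Gamma> \<gamma> r))
       \<and> S = A + submodule_span A (t_powers (\<Union>j\<in>{1..r - 1}. gap_cL \<Gamma> \<gamma> j))
                  + submodule_span A (t_powers (gap_Ltilde \<Gamma> \<gamma> r))
       \<and> S = adjoin A (t_powers (gap_cL_upto \<Gamma> \<gamma> r))
       \<and> adjoin A (t_powers (gap_cL_upto \<Gamma> \<gamma> r)) = adjoin A (t_powers (gap_L_upto \<Gamma> \<gamma> r))"
proof -
  have "S = supported"
    unfolding S_def using saturation_subset_supported[OF reduced nzd] supported_subset_saturation by (rule antisym)
  then show ?thesis using supported_presentations[OF r] by (intro conjI) (simp_all only:)
qed

end

lemma monomial_power_series_support:
  assumes "f \<in> monomial_power_series n \<gamma>" "fps_nth f k \<noteq> 0"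
  shows "k \<in> semigroup_gen n \<gamma>"
proof -
  obtain c where "f = Abs_fps (\<lambda>k. \<Sum>\<alpha> | \<alpha> \<in> {1..n} \<rightarrow>\<^sub>E UNIV \<and> (\<Sum>i=1..n. \<alpha> i * \<gamma> i) = k. c \<alpha>)"
    using assms(1) unfolding monomial_power_series_def by blast
  with assms(2) have "{\<alpha>. \<alpha> \<in> {1..n} \<rightarrow>\<^sub>E UNIV \<and> (\<Sum>i=1..n. \<alpha> i * \<gamma> i) = k} \<noteq> {}"
    by (metis (no_types, lifting) fps_nth_Abs_fps sum.empty)
  then show ?thesis unfolding semigroup_gen_def by blast
qed

theorem theorem3p14:
  fixes n r :: nat and \<gamma> :: "nat \<Rightarrow> nat" and \<Gamma> :: "nat set"
    and A B Asat :: "'a::comm_ring_1 fps set"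
  assumes n: "n \<ge> 2"
    and gamma_pos: "\<And>i. i \<in> {1..n} \<Longrightarrow> \<gamma> i > 0"
    and gamma_incr: "strict_mono_on {1..n} \<gamma>"
    and gamma_gcd: "Gcd (\<gamma> ` {1..n}) = 1"
    and gamma_ndvd: "\<And>i j. i \<in> {1..n} \<Longrightarrow> j \<in> {1..n} \<Longrightarrow> i < j \<Longrightarrow> \<not> \<gamma> i dvd \<gamma> j"
    and Gamma: "\<Gamma> = semigroup_gen n \<gamma>"
    and B_sub: "fps_subalgebra B"
    and B_contains: "adjoin constants {fps_X} \<subseteq> B"
    and A_sub: "fps_subalgebra A"
    and A_le: "A \<subseteq> B \<inter> monomial_power_series n \<gamma>"
    and A_contains: "adjoin constants (t_powers (\<gamma> ` {1..n})) \<subseteq> A"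
    and r: "r \<in> {2..n}" "partial_gcd \<gamma> r = 1"
    and A_closed: "gamma_closed \<Gamma> B A"
    and R_noetherian: "noetherian_ring (ring_of_type_algebra :: 'a ring)"
    and R_nice: "nice_ring (\<gamma> 1) (ring_of_type_algebra :: 'a ring)"
    and Asat: "Asat = lipschitz_saturation (ring_of_type_algebra :: 'a ring) fps_const
                 (fps_ring\<lparr>carrier := A\<rparr>) (\<lambda>x. x) (fps_ring\<lparr>carrier := B\<rparr>)"
  shows "Asat = A + submodule_span constants (t_powers (\<Union>j\<in>{1..r - 1}. gap_L \<Gamma> \<gamma> j))
                  + submodule_span A (t_powers (gap_Ltilde \<Gamma> \<gamma> r))
       \<and> Asat = A + submodule_span A (t_powers (\<Union>j\<in>{1..r - 1}. gap_cL \<Gamma> \<gamma> j))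
                  + submodule_span A (t_powers (gap_Ltilde \<Gamma> \<gamma> r))
       \<and> Asat = adjoin A (t_powers (gap_cL_upto \<Gamma> \<gamma> r))
       \<and> adjoin A (t_powers (gap_cL_upto \<Gamma> \<gamma> r)) = adjoin A (t_powers (gap_L_upto \<Gamma> \<gamma> r))"
proof -
  have setting: "lipschitz_setting n \<gamma> \<Gamma> A B"
  proof (intro lipschitz_setting.intro numerical_semigroup.intro lipschitz_setting_axioms.intro)
    show "1 \<le> n" using n by simp
    show "A \<subseteq> B" using A_le by blast
    show "fps_X \<in> B" using B_contains adjoin_superset(2) by blast
    show "fps_X ^ \<gamma> i \<in> A" if "i \<in> {1..n}" for i
    proof -
      have "fps_X ^ \<gamma> i \<in> t_powers (\<gamma> ` {1..n})" unfolding t_powers_def using that by blast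
      then show ?thesis using A_contains adjoin_superset(2) by blast
    qed
    show "i \<in> \<Gamma>" if "f \<in> A" "fps_nth f i \<noteq> 0" for f i
      unfolding Gamma using A_le that by (intro monomial_power_series_support) auto
    show "\<gamma> i > 0" if "i \<in> {1..n}" for i by (rule gamma_pos[OF that])
  qed (rule gamma_incr gamma_gcd Gamma B_sub A_sub A_closed)+
  have r1: "r \<in> {1..n}" using r(1) by auto
  show ?thesis
    unfolding Asat
    by (rule lipschitz_setting.saturation_presentations[OF setting _ _ r1 r(2)])
      (erule nice_ring_imp_reduced[OF R_nice] nice_ring_imp_not_zero_divisor[OF R_noetherian R_nice])+
qed

end
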